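(* Let $V$ be a complex vector space of dimension $n+1$, let $d\ge1$ and $1\le k\le n$, and let $f\in\mathrm{SOS}_k\subset\mathrm{Sym}^{2d}V$ be generic. Then $\dim \mathrm{SOS}_k(f)=\binom{k}{2}$.
   Context: $\mathrm{Sym}^mV$ denotes the space of homogeneous polynomials of degree $m$ in $x_0,\dots,x_n$ over $\mathbb{C}$, where $x_0,\dots,x_n$ is a basis of $V$. For $k\ge1$, $\mathrm{SOS}_k\subset \mathrm{Sym}^{2d}V$ is the Zariski closure of $\{f_1^2+\dots+f_k^2 : f_i\in \mathrm{Sym}^dV\}$; it is an irreducible affine variety. For $f\in\mathrm{SOS}_k$, $\mathrm{SOS}_k(f)=\{(f_1,\dots,f_k)\in \prod_{i=1}^k\mathrm{Sym}^dV : \sum_{i=1}^k f_i^2=f\}$, viewed as an affine algebraic variety. "Generic $f\in\mathrm{SOS}_k$" means: for all $f$ in some dense Zariski-open subset of $\mathrm{SOS}_k$. *)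

theory Defs
  imports "HOL-Analysis.Analysis" "HOL-Library.Poly_Mapping"
begin

section \<open>Forms\<close>

text \<open>
  A polynomial in countably many variables is a finitely supported map from exponent vectors
  \<^typ>\<open>nat \<Rightarrow>\<^sub>0 nat\<close> to coefficients; multiplication on \<^typ>\<open>(nat \<Rightarrow>\<^sub>0 nat) \<Rightarrow>\<^sub>0 complex\<close> is the
  convolution product. With \<open>V\<close> of dimension \<open>n + 1\<close>, only the variables \<open>x\<^sub>0, \<dots>, x\<^sub>n\<close> occur.
\<close>

type_synonym cpoly = "(nat \<Rightarrow>\<^sub>0 nat) \<Rightarrow>\<^sub>0 complex"

definition monomials_of_degree :: "nat \<Rightarrow> nat \<Rightarrow> (nat \<Rightarrow>\<^sub>0 nat) set" where
  "monomials_of_degree n m =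
     {\<alpha>. Poly_Mapping.keys \<alpha> \<subseteq> {0..n} \<and> (\<Sum>i=0..n. Poly_Mapping.lookup \<alpha> i) = m}"

definition Sym :: "nat \<Rightarrow> nat \<Rightarrow> cpoly set" where
  "Sym n m = {f. Poly_Mapping.keys f \<subseteq> monomials_of_degree n m}"

section \<open>Zariski topology and dimension\<close>

text \<open>The ring of functions generated over the complex numbers by the coordinate functions \<open>C\<close>.\<close>

inductive_set polynomial_functions :: "('a \<Rightarrow> complex) set \<Rightarrow> ('a \<Rightarrow> complex) set"
  for C where
  const: "(\<lambda>x. c) \<in> polynomial_functions C"
| coord: "p \<in> C \<Longrightarrow> p \<in> polynomial_functions C"
| add: "p \<in> polynomial_functions C \<Longrightarrow> q \<in> polynomial_functions C \<Longrightarrow>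
        (\<lambda>x. p x + q x) \<in> polynomial_functions C"
| mult: "p \<in> polynomial_functions C \<Longrightarrow> q \<in> polynomial_functions C \<Longrightarrow>
        (\<lambda>x. p x * q x) \<in> polynomial_functions C"

definition zero_locus :: "'a set \<Rightarrow> ('a \<Rightarrow> complex) set \<Rightarrow> 'a set" where
  "zero_locus W S = {x \<in> W. \<forall>p\<in>S. p x = 0}"

definition zariski :: "('a \<Rightarrow> complex) set \<Rightarrow> 'a set \<Rightarrow> 'a topology" where
  "zariski C W = topology (\<lambda>U. \<exists>S \<subseteq> polynomial_functions C. U = W - zero_locus W S)"

lemma istopology_zariski:
  "istopology (\<lambda>U. \<exists>S \<subseteq> polynomial_functions C. U = W - zero_locus W S)"
  unfolding istopology_def
proof (intro conjI allI impI)
  fix U V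
  assume "\<exists>S\<subseteq>polynomial_functions C. U = W - zero_locus W S"
    and "\<exists>S\<subseteq>polynomial_functions C. V = W - zero_locus W S"
  then obtain S T where S: "S \<subseteq> polynomial_functions C" "U = W - zero_locus W S"
    and T: "T \<subseteq> polynomial_functions C" "V = W - zero_locus W T" by blast
  let ?R = "(\<lambda>(p, q) x. p x * q x) ` (S \<times> T)"
  have "?R \<subseteq> polynomial_functions C"
    using S(1) T(1) by (auto intro: polynomial_functions.mult)
  moreover have "U \<inter> V = W - zero_locus W ?R"
  proof (intro set_eqI iffI)
    fix x
    assume "x \<in> U \<inter> V"
    then obtain p q where "x \<in> W" "p \<in> S" "q \<in> T" "p x * q x \<noteq> 0"
      unfolding S(2) T(2) zero_locus_def by auto
    then show "x \<in> W - zero_locus W ?R"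
      unfolding zero_locus_def by force
  next
    fix x
    assume "x \<in> W - zero_locus W ?R"
    then obtain p q where "x \<in> W" "p \<in> S" "q \<in> T" "p x * q x \<noteq> 0"
      unfolding zero_locus_def by auto
    then show "x \<in> U \<inter> V"
      unfolding S(2) T(2) zero_locus_def by auto
  qed
  ultimately show "\<exists>S\<subseteq>polynomial_functions C. U \<inter> V = W - zero_locus W S" by blast
next
  fix \<U>
  assume "\<forall>U\<in>\<U>. \<exists>S\<subseteq>polynomial_functions C. U = W - zero_locus W S"
  then obtain S where S': "\<forall>U\<in>\<U>. S U \<subseteq> polynomial_functions C \<and> U = W - zero_locus W (S U)"
    by (rule bchoice[THEN exE])
  have S: "S U \<subseteq> polynomial_functions C" "W - zero_locus W (S U) = U" if "U \<in> \<U>" for U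
    using conjunct1[OF bspec[OF S' that]] conjunct2[OF bspec[OF S' that], symmetric] .
  have "\<Union>\<U> = (\<Union>U\<in>\<U>. W - zero_locus W (S U))" by (simp add: S(2) cong: SUP_cong)
  also have "\<dots> = W - zero_locus W (\<Union>U\<in>\<U>. S U)"
    unfolding zero_locus_def by blast
  finally show "\<exists>S\<subseteq>polynomial_functions C. \<Union>\<U> = W - zero_locus W S"
    using S(1) by (intro exI[of _ "\<Union>U\<in>\<U>. S U"] conjI UN_least)
qed

lemma openin_zariski:
  "openin (zariski C W) U \<longleftrightarrow> (\<exists>S \<subseteq> polynomial_functions C. U = W - zero_locus W S)"
  unfolding zariski_def
  by (rule fun_cong[OF topology_inverse'[OF istopology_zariski[of C W]]])

lemma topspace_zariski [simp]: "topspace (zariski C W) = W"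
proof
  show "topspace (zariski C W) \<subseteq> W"
    unfolding topspace_def openin_zariski by blast
  have "W = W - zero_locus W {\<lambda>x. 1}" by (auto simp: zero_locus_def)
  then have "openin (zariski C W) W"
    unfolding openin_zariski
    by (intro exI[of _ "{\<lambda>x. 1}"]) (auto intro: polynomial_functions.const)
  then show "W \<subseteq> topspace (zariski C W)" by (rule openin_subset)
qed

lemma closedin_zariski:
  "closedin (zariski C W) Z \<longleftrightarrow> (\<exists>S \<subseteq> polynomial_functions C. Z = zero_locus W S)"
proof
  assume "closedin (zariski C W) Z"
  then obtain S where "Z \<subseteq> W" "S \<subseteq> polynomial_functions C" "W - Z = W - zero_locus W S"
    unfolding closedin_def openin_zariski by auto
  moreover have "zero_locus W S \<subseteq> W" by (auto simp: zero_locus_def)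
  ultimately have "Z = zero_locus W S" by blast
  then show "\<exists>S \<subseteq> polynomial_functions C. Z = zero_locus W S"
    using \<open>S \<subseteq> polynomial_functions C\<close> by blast
next
  assume "\<exists>S \<subseteq> polynomial_functions C. Z = zero_locus W S"
  then obtain S where S: "S \<subseteq> polynomial_functions C" "Z = zero_locus W S" by blast
  have "openin (zariski C W) (W - Z)"
    unfolding openin_zariski S(2) using S(1) by (intro exI[of _ S] conjI refl)
  then show "closedin (zariski C W) Z"
    by (auto simp: closedin_def S(2) zero_locus_def)
qed

definition irreducible_space :: "'a topology \<Rightarrow> bool" where
  "irreducible_space X \<longleftrightarrow> topspace X \<noteq> {} \<and>
     (\<forall>A B. closedin X A \<and> closedin X B \<and> topspace X = A \<union> B \<longrightarrow>
        A = topspace X \<or> B = topspace X)"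

text \<open>
  Krull dimension, the supremum of the lengths of strict chains of irreducible closed subsets.
  It is taken in \<^typ>\<open>ereal\<close>, so that the empty space has dimension \<open>-\<infinity>\<close> and not \<open>0\<close>.
\<close>

definition krull_dim :: "'a topology \<Rightarrow> ereal" where
  "krull_dim X = Sup {ereal (real l) | l. \<exists>Z :: nat \<Rightarrow> 'a set.
     (\<forall>i\<le>l. closedin X (Z i) \<and> irreducible_space (subtopology X (Z i))) \<and>
     (\<forall>i<l. Z i \<subset> Z (Suc i))}"

definition for_generic :: "'a topology \<Rightarrow> ('a \<Rightarrow> bool) \<Rightarrow> bool" where
  "for_generic X P \<longleftrightarrow> (\<exists>U. openin X U \<and> X closure_of U = topspace X \<and> (\<forall>x\<in>U. P x))"

section \<open>Sums of squares\<close>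

text \<open>
  \<open>Sym n m\<close> is an affine space whose coordinates are the coefficients of a form. A \<open>k\<close>-tuple of
  forms is an extensional function on \<open>{1..k}\<close>; its coordinates are the coefficients of the
  entries.
\<close>

definition zariski_Sym :: "nat \<Rightarrow> nat \<Rightarrow> cpoly topology" where
  "zariski_Sym n m =
     zariski {\<lambda>f. Poly_Mapping.lookup f \<alpha> | \<alpha>. \<alpha> \<in> monomials_of_degree n m} (Sym n m)"

definition Sym_tuples :: "nat \<Rightarrow> nat \<Rightarrow> nat \<Rightarrow> (nat \<Rightarrow> cpoly) set" where
  "Sym_tuples k n m = {1..k} \<rightarrow>\<^sub>E Sym n m"

definition zariski_Sym_tuples :: "nat \<Rightarrow> nat \<Rightarrow> nat \<Rightarrow> (nat \<Rightarrow> cpoly) topology" where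
  "zariski_Sym_tuples k n m =
     zariski {\<lambda>F. Poly_Mapping.lookup (F i) \<alpha> | i \<alpha>. i \<in> {1..k} \<and> \<alpha> \<in> monomials_of_degree n m}
       (Sym_tuples k n m)"

text \<open>\<open>SOS n d k\<close> is the closure in forms of degree \<open>2 * d\<close> of the sums of \<open>k\<close> squares.\<close>

definition SOS :: "nat \<Rightarrow> nat \<Rightarrow> nat \<Rightarrow> cpoly set" where
  "SOS n d k = zariski_Sym n (2 * d) closure_of {\<Sum>i=1..k. (F i)\<^sup>2 | F. F \<in> Sym_tuples k n d}"

definition SOS_decompositions :: "nat \<Rightarrow> nat \<Rightarrow> nat \<Rightarrow> cpoly \<Rightarrow> (nat \<Rightarrow> cpoly) set" where
  "SOS_decompositions n d k f = {F \<in> Sym_tuples k n d. (\<Sum>i=1..k. (F i)\<^sup>2) = f}"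

end

theory Submission
  imports Defs "HOL-Complex_Analysis.Conformal_Mappings" "HOL-Computational_Algebra.Fundamental_Theorem_Algebra"
    "Jordan_Normal_Form.Determinant"
begin

text \<open>
  Let \<open>\<Phi>(F) = \<Sum> F\<^sub>i\<^sup>2\<close>. The coefficients of \<open>\<Phi>\<close> at the distinct monomials \<open>x\<^sub>i\<^sup>d m\<close> are algebraically
  independent, because the differential of \<open>\<Phi>\<close> at \<open>(x\<^sub>1\<^sup>d, \<dots>, x\<^sub>k\<^sup>d)\<close> maps onto them: its kernel
  consists of the constant skew-symmetric syzygies. Hence \<open>\<Phi>\<close> has at least \<open>N - (k choose 2)\<close>
  algebraically independent coefficients, where \<open>N\<close> is the number of coordinates of a tuple.

  Upper bound: counting monomials produces relations over the ring generated by the coefficients of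
  \<open>\<Phi>\<close>; as in Noether normalisation, linear changes of coordinates make them monic over a nonempty
  open set of \<open>f\<close>, so the polynomials of degree at most \<open>D\<close> restricted to a generic fibre span a
  space of dimension \<open>O(D\<^sup>t)\<close> with \<open>t \<le> k choose 2\<close>. A chain of \<open>l\<close> strict inclusions of irreducible
  closed sets yields \<open>l\<close> algebraically independent functions, whence \<open>l \<le> t\<close>.

  Lower bound: a generic \<open>f\<close> has a decomposition \<open>F\<close> with linearly independent entries, by extending
  points of the closure of the graph of \<open>\<Phi>\<close> one coordinate at a time. Applying to \<open>F\<close> the plane
  rotations of an Euler angle decomposition of \<open>SO(k)\<close> one after the other gives sets whose closures
  form a chain of length \<open>k choose 2\<close>; they are irreducible because any two of their points lie on an
  entire curve.
\<close>

text \<open>The number k choose 2 arises twice, independently. Above, it counts the coincidences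
  x_i^d x_j^d = x_j^d x_i^d with j < i, that is, the pairs discarded from the index set of
  independent coefficients. Below, it counts rotations in coordinate planes. Nothing is assumed
  about the fibre, such as irreducibility or smoothness: both bounds speak directly about chains of
  irreducible closed sets. Polynomials enter only as functions modulo vanishing on a set, so ideals
  and radicals are replaced by pointwise statements, and irreducibility by the absence of zero
  divisors among functions. The obstacle is that \<open>SOS\<close> is a closure: a member need not
  be a sum of squares, and an empty fibre has dimension -\<infinity>. Existence of a decomposition
  for generic f is therefore a statement of Chevalley type. It is needed in a stronger form, with
  independent entries, since otherwise the rotations could move the tuple in too few directions. One
  test point serves both sides: the tuple of pure powers x_1^d, ..., x_k^d, available because k
  \<le> n.\<close>

abbreviation "PF \<equiv> polynomial_functions"

lemmas PF_intros = polynomial_functions.intros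

lemma PF_sum:
  assumes "\<And>i. i \<in> A \<Longrightarrow> f i \<in> PF C"
  shows "(\<lambda>x. \<Sum>i\<in>A. f i x) \<in> PF C"
  using assms
  by (induction A rule: infinite_finite_induct) (auto intro: PF_intros)

lemma PF_prod:
  assumes "\<And>i. i \<in> A \<Longrightarrow> f i \<in> PF C"
  shows "(\<lambda>x. \<Prod>i\<in>A. f i x) \<in> PF C"
  using assms
  by (induction A rule: infinite_finite_induct) (auto intro: PF_intros)

lemma PF_power:
  assumes "f \<in> PF C"
  shows "(\<lambda>x. f x ^ m) \<in> PF C"
  using assms by (induction m) (auto intro: PF_intros)

lemma PF_cmult:
  assumes "f \<in> PF C"
  shows "(\<lambda>x. c * f x) \<in> PF C"
  using assms by (auto intro: PF_intros)

lemma PF_diff: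
  assumes "f \<in> PF C" "g \<in> PF C"
  shows "(\<lambda>x. f x - g x) \<in> PF C"
  using polynomial_functions.add[OF assms(1) PF_cmult[OF assms(2), of "-1"]] by simp

lemma PF_compose:
  assumes "p \<in> PF C" "\<And>c. c \<in> C \<Longrightarrow> (\<lambda>x. c (\<phi> x)) \<in> PF C'"
  shows "(\<lambda>x. p (\<phi> x)) \<in> PF C'"
  using assms by (induction rule: polynomial_functions.induct) (auto intro: PF_intros)

lemma PF_subset:
  assumes "C \<subseteq> PF C'"
  shows "PF C \<subseteq> PF C'"
  using PF_compose[of _ C "\<lambda>x. x" C'] assms by auto

lemma PF_mono: "C \<subseteq> C' \<Longrightarrow> PF C \<subseteq> PF C'"
  by (rule PF_subset) (auto intro: PF_intros)

section \<open>Irreducible subsets as sets whose functions form a domain\<close>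

definition domain_on :: "('a \<Rightarrow> complex) set \<Rightarrow> 'a set \<Rightarrow> bool" where
  "domain_on C Z \<longleftrightarrow> (\<forall>p\<in>PF C. \<forall>q\<in>PF C. (\<forall>x\<in>Z. p x * q x = 0) \<longrightarrow>
      (\<forall>x\<in>Z. p x = 0) \<or> (\<forall>x\<in>Z. q x = 0))"

lemma domain_onD:
  assumes "domain_on C Z" "p \<in> PF C" "q \<in> PF C" "\<And>x. x \<in> Z \<Longrightarrow> p x * q x = 0"
    "\<not> (\<forall>x\<in>Z. p x = 0)"
  shows "\<forall>x\<in>Z. q x = 0"
  using assms unfolding domain_on_def by blast

lemma subtopology_zariski:
  assumes "Y \<subseteq> W"
  shows "subtopology (zariski C W) Y = zariski C Y"
proof -
  have "openin (subtopology (zariski C W) Y) U \<longleftrightarrow> openin (zariski C Y) U" for U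
  proof -
    have *: "(W - zero_locus W S) \<inter> Y = Y - zero_locus Y S" for S
      using assms by (auto simp: zero_locus_def)
    show ?thesis
      unfolding openin_subtopology openin_zariski using * by metis
  qed
  then show ?thesis by (simp add: topology_eq)
qed

lemma irreducible_zariski_iff:
  "irreducible_space (zariski C Z) \<longleftrightarrow> Z \<noteq> {} \<and> domain_on C Z"
proof (intro iffI conjI)
  assume irr: "irreducible_space (zariski C Z)"
  then show "Z \<noteq> {}" by (simp add: irreducible_space_def)
  show "domain_on C Z" unfolding domain_on_def
  proof (intro ballI impI)
    fix p q assume p: "p \<in> PF C" and q: "q \<in> PF C" and pq: "\<forall>x\<in>Z. p x * q x = 0"
    have "closedin (zariski C Z) (zero_locus Z {p})" "closedin (zariski C Z) (zero_locus Z {q})"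
      unfolding closedin_zariski using p q by blast+
    moreover have "Z = zero_locus Z {p} \<union> zero_locus Z {q}"
      using pq by (auto simp: zero_locus_def)
    ultimately have "zero_locus Z {p} = Z \<or> zero_locus Z {q} = Z"
      using irr unfolding irreducible_space_def topspace_zariski by blast
    then show "(\<forall>x\<in>Z. p x = 0) \<or> (\<forall>x\<in>Z. q x = 0)"
      by (auto simp: zero_locus_def)
  qed
next
  assume "Z \<noteq> {} \<and> domain_on C Z"
  then have ne: "Z \<noteq> {}" and dom: "domain_on C Z" by auto
  show "irreducible_space (zariski C Z)"
    unfolding irreducible_space_def topspace_zariski
  proof (intro conjI ne allI impI)
    fix A B assume "closedin (zariski C Z) A \<and> closedin (zariski C Z) B \<and> Z = A \<union> B"
    then obtain S T where S: "S \<subseteq> PF C" "A = zero_locus Z S" and T: "T \<subseteq> PF C" "B = zero_locus Z T"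
      and Z: "Z = A \<union> B" unfolding closedin_zariski by blast
    show "A = Z \<or> B = Z"
    proof (rule ccontr)
      assume "\<not> ?thesis"
      then obtain p q where p: "p \<in> S" "\<not> (\<forall>x\<in>Z. p x = 0)" and q: "q \<in> T" "\<not> (\<forall>x\<in>Z. q x = 0)"
        unfolding S T zero_locus_def by blast
      have "p x * q x = 0" if "x \<in> Z" for x
        using that Z p(1) q(1) unfolding S(2) T(2) by (auto simp: zero_locus_def)
      with domain_onD[OF dom, of p q] p q S T show False by blast
    qed
  qed
qed

subsection \<open>Linear algebra\<close>

text \<open>Gaussian elimination by induction on the equations: an unknown \<open>i\<close> with
  nonzero coefficient in equation \<open>g\<close> is eliminated from the others, which removes one
  equation and one unknown and keeps the strict inequality of the counts.\<close>

lemma underdetermined_system: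
  fixes M :: "'j \<Rightarrow> 'g \<Rightarrow> 'c :: field"
  assumes "finite G" "finite J" "card G < card J"
  shows "\<exists>c. (\<exists>j\<in>J. c j \<noteq> 0) \<and> (\<forall>g\<in>G. (\<Sum>j\<in>J. c j * M j g) = 0)"
  using assms
proof (induction G arbitrary: J M rule: finite_induct)
  case empty
  then have "J \<noteq> {}" by auto
  then show ?case by (intro exI[of _ "\<lambda>_. 1"]) auto
next
  case (insert g G)
  show ?case
  proof (cases "\<forall>j\<in>J. M j g = 0")
    case True
    have "card G < card J" using insert by simp
    from insert.IH[OF insert.prems(1) this, of M] obtain c where c: "\<exists>j\<in>J. c j \<noteq> 0"
      "\<forall>g\<in>G. (\<Sum>j\<in>J. c j * M j g) = 0" by blast
    then show ?thesis using True by (intro exI[of _ c]) auto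
  next
    case False
    then obtain i where i: "i \<in> J" "M i g \<noteq> 0" by blast
    have "card G < card (J - {i})" using insert i by simp
    from insert.IH[OF _ this, of "\<lambda>j h. M j h - M j g / M i g * M i h"] insert.prems
    obtain c where c: "\<exists>j\<in>J - {i}. c j \<noteq> 0"
      "\<forall>h\<in>G. (\<Sum>j\<in>J-{i}. c j * (M j h - M j g / M i g * M i h)) = 0" by auto
    \<comment> \<open>Back substitution: the value at \<open>i\<close> is the one forced by equation
      \<open>g\<close>.\<close>
    define d where "d = c(i := - (\<Sum>j\<in>J-{i}. c j * M j g / M i g))"
    have split: "(\<Sum>j\<in>J. d j * M j h) = d i * M i h + (\<Sum>j\<in>J-{i}. c j * M j h)" for h
    proof -
      have "(\<Sum>j\<in>J. d j * M j h) = d i * M i h + (\<Sum>j\<in>J-{i}. d j * M j h)"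
        using i(1) insert.prems(1) by (rule sum.remove[rotated])
      also have "(\<Sum>j\<in>J-{i}. d j * M j h) = (\<Sum>j\<in>J-{i}. c j * M j h)"
        by (rule sum.cong) (auto simp: d_def)
      finally show ?thesis .
    qed
    have eq: "(\<Sum>j\<in>J. d j * M j h) = (\<Sum>j\<in>J-{i}. c j * (M j h - M j g / M i g * M i h))" for h
      unfolding split
      by (simp add: d_def sum_subtractf algebra_simps sum_distrib_left sum_distrib_right sum_divide_distrib
          sum_negf)
    have "(\<Sum>j\<in>J. d j * M j h) = 0" if "h \<in> insert g G" for h
      using that c(2) i(2) unfolding eq by auto
    moreover have "\<exists>j\<in>J. d j \<noteq> 0" using c(1) by (auto simp: d_def)
    ultimately show ?thesis by blast
  qed
qed

text \<open>Equality is demanded on \<open>Y\<close> only, so this is a span in the ring of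
  functions on \<open>Y\<close>; shrinking \<open>Y\<close> can only enlarge it. The spanning
  functions index their own coefficients.\<close>

definition lspan :: "('a \<Rightarrow> complex) set \<Rightarrow> 'a set \<Rightarrow> ('a \<Rightarrow> complex) set" where
  "lspan G Y = {p. \<exists>c. \<forall>x\<in>Y. p x = (\<Sum>g\<in>G. c g * g x)}"

lemma lspan_base: "finite G \<Longrightarrow> g \<in> G \<Longrightarrow> g \<in> lspan G Y"
  unfolding lspan_def
  by (rule CollectI, rule exI[of _ "\<lambda>h. if h = g then 1 else 0"])
    (simp add: if_distrib[of "\<lambda>c. c * _"] sum.delta cong: if_cong)

lemma lspan_add: 
  assumes "p \<in> lspan G Y" "q \<in> lspan G Y" shows "(\<lambda>x. p x + q x) \<in> lspan G Y"
proof -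
  from assms obtain c d where "\<forall>x\<in>Y. p x = (\<Sum>g\<in>G. c g * g x)" "\<forall>x\<in>Y. q x = (\<Sum>g\<in>G. d g * g x)"
    unfolding lspan_def by blast
  then show ?thesis unfolding lspan_def
    by (intro CollectI exI[of _ "\<lambda>g. c g + d g"]) (auto simp: sum.distrib algebra_simps)
qed

lemma lspan_cmult:
  assumes "p \<in> lspan G Y" shows "(\<lambda>x. a * p x) \<in> lspan G Y"
proof -
  from assms obtain c where "\<forall>x\<in>Y. p x = (\<Sum>g\<in>G. c g * g x)"
    unfolding lspan_def by blast
  then show ?thesis unfolding lspan_def
    by (intro CollectI exI[of _ "\<lambda>g. a * c g"]) (auto simp: sum_distrib_left mult.assoc)
qed

lemma lspan_zero: "(\<lambda>x. 0) \<in> lspan G Y"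
  unfolding lspan_def by (intro CollectI exI[of _ "\<lambda>g. 0"]) auto

lemma lspan_sum: "(\<And>i. i \<in> A \<Longrightarrow> f i \<in> lspan G Y) \<Longrightarrow> (\<lambda>x. \<Sum>i\<in>A. f i x) \<in> lspan G Y"
  by (induction A rule: infinite_finite_induct) (auto intro: lspan_zero lspan_add)

lemma lspan_cong: "p \<in> lspan G Y \<Longrightarrow> (\<And>x. x \<in> Y \<Longrightarrow> p x = q x) \<Longrightarrow> q \<in> lspan G Y"
  unfolding lspan_def by auto

lemma lspan_anti_mono: "Y' \<subseteq> Y \<Longrightarrow> lspan G Y \<subseteq> lspan G Y'"
  unfolding lspan_def by blast

lemma lspan_dependent:
  assumes "finite G" "finite J" "card G < card J" "\<And>j. j \<in> J \<Longrightarrow> b j \<in> lspan G Y"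
  shows "\<exists>c. (\<exists>j\<in>J. c j \<noteq> 0) \<and> (\<forall>x\<in>Y. (\<Sum>j\<in>J. c j * b j x) = 0)"
proof -
  from assms(4) obtain M where M: "\<And>j x. j \<in> J \<Longrightarrow> x \<in> Y \<Longrightarrow> b j x = (\<Sum>g\<in>G. M j g * g x)"
    unfolding lspan_def by simp metis
  obtain c where c: "\<exists>j\<in>J. c j \<noteq> 0" "\<forall>g\<in>G. (\<Sum>j\<in>J. c j * M j g) = 0"
    using underdetermined_system[OF assms(1-3), of M] by blast
  have "(\<Sum>j\<in>J. c j * b j x) = 0" if "x \<in> Y" for x
  proof -
    have "(\<Sum>j\<in>J. c j * b j x) = (\<Sum>j\<in>J. \<Sum>g\<in>G. c j * M j g * g x)"
      using that by (simp add: M sum_distrib_left mult.assoc)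
    also have "\<dots> = (\<Sum>g\<in>G. (\<Sum>j\<in>J. c j * M j g) * g x)"
      by (subst sum.swap) (simp add: sum_distrib_right)
    finally show ?thesis using c(2) by simp
  qed
  with c(1) show ?thesis by blast
qed

subsection \<open>Bounded degree and growth\<close>

text \<open>A degree filtration on functions rather than on polynomials: some expression of degree
  at most \<open>D\<close> in the generators \<open>C\<close> exists. Multiplication by one
  generator at a time makes every induction below a one-step argument.\<close>

inductive bounded_degree :: "('a \<Rightarrow> complex) set \<Rightarrow> nat \<Rightarrow> ('a \<Rightarrow> complex) \<Rightarrow> bool" for C where
  const: "bounded_degree C D (\<lambda>x. c)"
| add: "bounded_degree C D p \<Longrightarrow> bounded_degree C D q \<Longrightarrow> bounded_degree C D (\<lambda>x. p x + q x)"
| mult: "bounded_degree C D p \<Longrightarrow> g \<in> C \<Longrightarrow> bounded_degree C (Suc D) (\<lambda>x. g x * p x)"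

lemma bounded_degree_Suc: "bounded_degree C D p \<Longrightarrow> bounded_degree C (Suc D) p"
  by (induction rule: bounded_degree.induct) (auto intro: bounded_degree.intros)

lemma bounded_degree_mono:
  assumes "bounded_degree C D p" "D \<le> E"
  shows "bounded_degree C E p"
  using assms(2,1) by (induction rule: dec_induct) (auto intro: bounded_degree_Suc)

lemma bounded_degree_cmult: "bounded_degree C D p \<Longrightarrow> bounded_degree C D (\<lambda>x. c * p x)"
proof (induction rule: bounded_degree.induct)
  case (mult D p g)
  then show ?case using bounded_degree.mult[of C D "\<lambda>x. c * p x" g] by (simp add: mult.left_commute)
qed (auto intro: bounded_degree.intros simp: distrib_left)

lemma bounded_degree_mult:
  "bounded_degree C D p \<Longrightarrow> bounded_degree C E q \<Longrightarrow> bounded_degree C (D + E) (\<lambda>x. p x * q x)"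
proof (induction rule: bounded_degree.induct)
  case (const D c)
  then show ?case by (auto intro: bounded_degree_cmult bounded_degree_mono)
next
  case (add D p q)
  then show ?case by (auto simp: distrib_right intro: bounded_degree.add)
next
  case (mult D p g)
  then show ?case using bounded_degree.mult[of C "D + E" "\<lambda>x. p x * q x" g]
    by (simp add: mult.assoc)
qed

lemma bounded_degree_power:
  "bounded_degree C D p \<Longrightarrow> bounded_degree C (D * m) (\<lambda>x. p x ^ m)"
  by (induction m) (auto intro: bounded_degree.const bounded_degree_mult)

lemma bounded_degree_prod:
  "finite A \<Longrightarrow> (\<And>i. i \<in> A \<Longrightarrow> bounded_degree C D (f i)) \<Longrightarrow>
    bounded_degree C (D * card A) (\<lambda>x. \<Prod>i\<in>A. f i x)"
  by (induction A rule: finite_induct) (auto intro: bounded_degree.const bounded_degree_mult)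

lemma bounded_degree_generator: "g \<in> C \<Longrightarrow> bounded_degree C (Suc D) g"
  using bounded_degree.mult[OF bounded_degree.const[of C D 1], of g] by simp

lemma PF_bounded_degree: "p \<in> PF C \<Longrightarrow> \<exists>D. bounded_degree C D p"
proof (induction rule: polynomial_functions.induct)
  case (const c)
  then show ?case by (blast intro: bounded_degree.const)
next
  case (coord p)
  then show ?case by (blast intro: bounded_degree_generator)
next
  case (add p q)
  then obtain D E where "bounded_degree C D p" "bounded_degree C E q" by blast
  then have "bounded_degree C (max D E) (\<lambda>x. p x + q x)"
    by (intro bounded_degree.add) (auto intro: bounded_degree_mono)
  then show ?case by blast
next
  case (mult p q)
  then show ?case by (blast intro: bounded_degree_mult)
qed

lemma PF_bounded_degree_uniform:
  assumes "finite A" "\<And>i. i \<in> A \<Longrightarrow> f i \<in> PF C"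
  shows "\<exists>D. \<forall>i\<in>A. bounded_degree C D (f i)"
proof -
  from assms(2) have "\<forall>i\<in>A. \<exists>D. bounded_degree C D (f i)" by (blast intro: PF_bounded_degree)
  then obtain d where d: "\<forall>i\<in>A. bounded_degree C (d i) (f i)" by metis
  have "bounded_degree C (\<Sum>i\<in>A. d i) (f i)" if "i \<in> A" for i
    by (rule bounded_degree_mono[OF d[rule_format, OF that]])
      (use that assms(1) in \<open>auto intro: member_le_sum\<close>)
  then show ?thesis by blast
qed

lemma bounded_degree_subst:
  assumes "bounded_degree C D p" "\<And>g. g \<in> C \<Longrightarrow> bounded_degree C' e g"
  shows "bounded_degree C' (e * D) p"
  using assms
proof (induction rule: bounded_degree.induct)
  case (mult D p g)
  then show ?case using bounded_degree_mult[of C' e g "e * D" p] by simp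
qed (auto intro: bounded_degree.intros)

text \<open>A box instead of a bound on the total degree: the number of exponent vectors is then
  exactly \<open>(D + 1) ^ card I\<close>, and extensionality makes each vector count once.\<close>

definition exponents :: "'i set \<Rightarrow> nat \<Rightarrow> ('i \<Rightarrow> nat) set" where
  "exponents I D = (I \<rightarrow>\<^sub>E {..D})"

definition monom_fun :: "'i set \<Rightarrow> ('i \<Rightarrow> 'a \<Rightarrow> complex) \<Rightarrow> ('i \<Rightarrow> nat) \<Rightarrow> 'a \<Rightarrow> complex" where
  "monom_fun I g \<alpha> x = (\<Prod>i\<in>I. g i x ^ \<alpha> i)"

lemma finite_exponents [simp]: "finite I \<Longrightarrow> finite (exponents I D)"
  unfolding exponents_def by (intro finite_PiE) auto

lemma card_exponents: "finite I \<Longrightarrow> card (exponents I D) = (D + 1) ^ card I"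
  unfolding exponents_def by (simp add: card_PiE)

lemma monom_fun_PF: "(\<And>i. i \<in> I \<Longrightarrow> g i \<in> PF C) \<Longrightarrow> monom_fun I g \<alpha> \<in> PF C"
  unfolding monom_fun_def[abs_def] by (intro PF_prod PF_power) auto

lemma bounded_degree_monom:
  assumes "finite I" "\<alpha> \<in> exponents I D" "\<And>i. i \<in> I \<Longrightarrow> bounded_degree C e (g i)"
  shows "bounded_degree C (e * D * card I) (monom_fun I g \<alpha>)"
  unfolding monom_fun_def[abs_def]
proof (intro bounded_degree_prod assms(1))
  fix i assume i: "i \<in> I"
  then have "\<alpha> i \<le> D" using assms(2) by (auto simp: exponents_def)
  then show "bounded_degree C (e * D) (\<lambda>x. g i x ^ \<alpha> i)"
    using bounded_degree_power[OF assms(3)[OF i], of "\<alpha> i"] by (auto intro: bounded_degree_mono)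
qed

lemma bounded_degree_in_lspan:
  assumes I: "finite I" and "bounded_degree (g ` I) D p"
  shows "p \<in> lspan (monom_fun I g ` exponents I D) Y"
  using assms(2)
proof (induction rule: bounded_degree.induct)
  case (const D c)
  have "(\<lambda>i\<in>I. 0) \<in> exponents I D" by (auto simp: exponents_def)
  then have "monom_fun I g (\<lambda>i\<in>I. 0) \<in> lspan (monom_fun I g ` exponents I D) Y"
    using I by (intro lspan_base) auto
  from lspan_cmult[OF this, of c] show ?case by (rule lspan_cong) (simp add: monom_fun_def)
next
  case (add D p q)
  then show ?case by (intro lspan_add)
next
  case (mult D p h)
  from mult.hyps obtain i where i: "i \<in> I" "h = g i" by blast
  from mult.IH obtain c where c: "\<And>x. x \<in> Y \<Longrightarrow> p x = (\<Sum>f\<in>monom_fun I g ` exponents I D. c f * f x)"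
    unfolding lspan_def by blast
  have *: "(\<lambda>x. h x * f x) \<in> lspan (monom_fun I g ` exponents I (Suc D)) Y"
    if f: "f \<in> monom_fun I g ` exponents I D" for f
  proof -
    from f obtain \<alpha> where \<alpha>: "\<alpha> \<in> exponents I D" "f = monom_fun I g \<alpha>" by blast
    have "\<alpha>(i := Suc (\<alpha> i)) \<in> exponents I (Suc D)" using \<alpha>(1) i(1)
      unfolding exponents_def by (fastforce simp: PiE_iff extensional_def)
    moreover have "monom_fun I g (\<alpha>(i := Suc (\<alpha> i))) = (\<lambda>x. h x * f x)"
    proof
      fix x
      have "(\<Prod>j\<in>I - {i}. g j x ^ (\<alpha>(i := Suc (\<alpha> i))) j) = (\<Prod>j\<in>I - {i}. g j x ^ \<alpha> j)"
        by (rule prod.cong) auto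
      then show "monom_fun I g (\<alpha>(i := Suc (\<alpha> i))) x = h x * f x"
        using I i unfolding \<alpha>(2) monom_fun_def by (simp add: prod.remove[of I i] mult.assoc)
    qed
    ultimately show ?thesis using I by (metis finite_exponents finite_imageI imageI lspan_base)
  qed
  have "(\<lambda>x. \<Sum>f\<in>monom_fun I g ` exponents I D. c f * (h x * f x)) \<in> lspan (monom_fun I g ` exponents I (Suc D)) Y"
    by (intro lspan_sum lspan_cmult *)
  then show ?case
    by (rule lspan_cong) (simp add: c sum_distrib_left mult.left_commute)
qed

lemma card_monom_image_le:
  "finite I \<Longrightarrow> card (monom_fun I g ` exponents I D) \<le> (D + 1) ^ card I"
  using card_image_le[OF finite_exponents, of I "monom_fun I g" D] by (simp add: card_exponents)

text \<open>The Hilbert function of the ring of functions on \<open>Y\<close> is O(D^t), with a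
  constant \<open>K\<close> independent of \<open>D\<close>. This is the substitute for the
  transcendence degree, and it passes to arbitrary subsets of \<open>Y\<close>.\<close>

definition growth_le :: "('a \<Rightarrow> complex) set \<Rightarrow> 'a set \<Rightarrow> nat \<Rightarrow> bool" where
  "growth_le C Y t \<longleftrightarrow> (\<exists>K. \<forall>D. \<exists>G. finite G \<and> card G \<le> K * (D + 1) ^ t \<and>
      {p. bounded_degree C D p} \<subseteq> lspan G Y)"

lemma growth_le_card:
  assumes "finite I" "card I \<le> t"
  shows "growth_le (g ` I) Y t"
  unfolding growth_le_def
proof (intro exI[of _ 1] allI)
  fix D
  have "card (monom_fun I g ` exponents I D) \<le> (D + 1) ^ card I" using assms(1) by (rule card_monom_image_le)
  also have "\<dots> \<le> 1 * (D + 1) ^ t" using assms(2) by (simp add: power_increasing del: One_nat_def)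
  finally show "\<exists>G. finite G \<and> card G \<le> 1 * (D + 1) ^ t \<and> {p. bounded_degree (g ` I) D p} \<subseteq> lspan G Y"
    using assms(1) bounded_degree_in_lspan by (intro exI[of _ "monom_fun I g ` exponents I D"]) auto
qed

lemma growth_scale: "(e * D + 1) ^ t \<le> (e + 1) ^ t * (D + 1) ^ (t::nat)" for e D :: nat
proof -
  have "e * D + 1 \<le> (e + 1) * (D + 1)" by (simp add: algebra_simps)
  then have "(e * D + 1) ^ t \<le> ((e + 1) * (D + 1)) ^ t" by (rule power_mono) simp
  then show ?thesis by (simp only: power_mult_distrib)
qed

lemma growth_le_subst:
  assumes "growth_le C Y t" "finite C'" "C' \<subseteq> PF C"
  shows "growth_le C' Y t"
proof -
  obtain e where e: "\<And>g. g \<in> C' \<Longrightarrow> bounded_degree C e g"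
    using PF_bounded_degree_uniform[OF assms(2), of "\<lambda>g. g" C] assms(3) by blast
  obtain K where K: "\<And>D. \<exists>G. finite G \<and> card G \<le> K * (D + 1) ^ t \<and> {p. bounded_degree C D p} \<subseteq> lspan G Y"
    using assms(1) unfolding growth_le_def by blast
  show ?thesis unfolding growth_le_def
  proof (intro exI[of _ "K * (e + 1) ^ t"] allI)
    fix D
    obtain G where G: "finite G" "card G \<le> K * (e * D + 1) ^ t" "{p. bounded_degree C (e * D) p} \<subseteq> lspan G Y"
      using K by blast
    have "card G \<le> K * ((e + 1) ^ t * (D + 1) ^ t)"
      using G(2) growth_scale[of e D t] by (meson le_trans mult_le_mono2)
    moreover have "{p. bounded_degree C' D p} \<subseteq> lspan G Y"
      using G(3) bounded_degree_subst[OF _ e] by blast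
    ultimately show "\<exists>G. finite G \<and> card G \<le> K * (e + 1) ^ t * (D + 1) ^ t \<and>
        {p. bounded_degree C' D p} \<subseteq> lspan G Y"
      using G(1) by (auto simp: mult.assoc)
  qed
qed

text \<open>An element integral over \<open>C\<close> adds only the finitely many powers 1, ...,
  z^(m-1) as module generators. Rewriting raises the degree of the coefficients by a constant
  factor, and both effects are absorbed by the constant of \<open>growth_le\<close>.\<close>

lemma growth_le_integral:
  assumes gr: "growth_le C Y t" and Q: "\<And>l. l < m \<Longrightarrow> Q l \<in> PF C"
    and eq: "\<And>x. x \<in> Y \<Longrightarrow> z x ^ m = (\<Sum>l<m. Q l x * z x ^ l)"
  shows "growth_le (insert z C) Y t"
proof -
  obtain e where e: "\<And>l. l < m \<Longrightarrow> bounded_degree C e (Q l)"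
    using PF_bounded_degree_uniform[of "{..<m}" Q C] Q by auto
  \<comment> \<open>Each multiplication by a generator costs degree 1 if the generator is in
    \<open>C\<close> and at most \<open>e\<close> if it is \<open>z\<close> and z^m has to be
    replaced; \<open>Suc e\<close> per step covers both.\<close>
  have red: "\<exists>q. (\<forall>l<m. bounded_degree C (Suc e * D) (q l)) \<and>
      (\<forall>x\<in>Y. p x = (\<Sum>l<m. q l x * z x ^ l))"
    if "bounded_degree (insert z C) D p" for D p
    using that
  proof (induction rule: bounded_degree.induct)
    case (const D c)
    show ?case
    proof (cases m)
      case 0
      \<comment> \<open>For m = 0 the integral equation reads 1 = 0.\<close>
      then have "Y = {}" using eq by auto
      then show ?thesis using 0 by auto
    next
      case (Suc m')
      have "(\<Sum>l<m. (if l = 0 then c else 0) * z x ^ l) = c" for x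
        unfolding Suc by (subst sum.lessThan_Suc_shift) simp
      then show ?thesis using bounded_degree.const[of C]
        by (intro exI[of _ "\<lambda>l x. if l = 0 then c else 0"]) auto
    qed
  next
    case (add D p p')
    then obtain q q' where "\<forall>l<m. bounded_degree C (Suc e * D) (q l)" "\<forall>x\<in>Y. p x = (\<Sum>l<m. q l x * z x ^ l)"
      "\<forall>l<m. bounded_degree C (Suc e * D) (q' l)" "\<forall>x\<in>Y. p' x = (\<Sum>l<m. q' l x * z x ^ l)"
      by blast
    then show ?case
      by (intro exI[of _ "\<lambda>l x. q l x + q' l x"]) (auto intro: bounded_degree.add simp: sum.distrib distrib_right)
  next
    case (mult D p g)
    then obtain q where q: "\<forall>l<m. bounded_degree C (Suc e * D) (q l)" "\<forall>x\<in>Y. p x = (\<Sum>l<m. q l x * z x ^ l)"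
      by blast
    show ?case
    proof (cases "g \<in> C")
      case True
      have "bounded_degree C (Suc e * Suc D) (\<lambda>x. g x * q l x)" if "l < m" for l
        using bounded_degree.mult[OF q(1)[rule_format, OF that] True] by (rule bounded_degree_mono) simp
      then show ?thesis using q(2)
        by (intro exI[of _ "\<lambda>l x. g x * q l x"]) (auto simp: sum_distrib_left mult.assoc)
    next
      case False
      then have g: "g = z" using mult by blast
      show ?thesis
      proof (cases m)
        case 0
        then have "Y = {}" using eq by auto
        then show ?thesis using 0 by auto
      next
        case (Suc m')
        \<comment> \<open>Multiplication by \<open>z\<close> shifts the coefficients, and the
          overflowing top term is replaced by means of the integral equation.\<close>
        define r where "r l x = (if l = 0 then 0 else q (l - 1) x) + q m' x * Q l x" for l x
        have "bounded_degree C (Suc e * Suc D) (r l)" if l: "l < m" for l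
        proof -
          have "bounded_degree C (Suc e * Suc D) (\<lambda>x. if l = 0 then 0 else q (l - 1) x)"
          proof (cases l)
            case (Suc l')
            then show ?thesis using l bounded_degree_mono[OF q(1)[rule_format, of l'], of "Suc e * Suc D"] by simp
          qed (auto intro: bounded_degree.const)
          moreover have "bounded_degree C (Suc e * D + e) (\<lambda>x. q m' x * Q l x)"
            using q(1) Suc l e by (intro bounded_degree_mult) auto
          then have "bounded_degree C (Suc e * Suc D) (\<lambda>x. q m' x * Q l x)"
            by (rule bounded_degree_mono) simp
          ultimately show ?thesis unfolding r_def by (rule bounded_degree.add)
        qed
        moreover have "z x * p x = (\<Sum>l<m. r l x * z x ^ l)" if x: "x \<in> Y" for x
        proof -
          have "z x * p x = (\<Sum>l<m. q l x * z x ^ Suc l)"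
            using q(2) x by (simp add: sum_distrib_left mult.left_commute)
          also have "\<dots> = (\<Sum>l<m'. q l x * z x ^ Suc l) + q m' x * z x ^ m" by (simp add: Suc)
          also have "(\<Sum>l<m'. q l x * z x ^ Suc l) = (\<Sum>l<m. (if l = 0 then 0 else q (l - 1) x) * z x ^ l)"
            unfolding Suc by (subst sum.lessThan_Suc_shift) simp
          also have "q m' x * z x ^ m = (\<Sum>l<m. q m' x * Q l x * z x ^ l)"
            using eq[OF x] by (simp add: sum_distrib_left mult.assoc)
          finally show ?thesis by (simp add: r_def sum.distrib distrib_right)
        qed
        ultimately show ?thesis using g by blast
      qed
    qed
  qed
  obtain K where K: "\<And>D. \<exists>G. finite G \<and> card G \<le> K * (D + 1) ^ t \<and> {p. bounded_degree C D p} \<subseteq> lspan G Y"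
    using gr unfolding growth_le_def by blast
  show ?thesis unfolding growth_le_def
  proof (intro exI[of _ "m * (K * (Suc e + 1) ^ t)"] allI)
    fix D
    obtain G where G: "finite G" "card G \<le> K * (Suc e * D + 1) ^ t" "{p. bounded_degree C (Suc e * D) p} \<subseteq> lspan G Y"
      using K by blast
    define H where "H = (\<lambda>(g, l) x. g x * z x ^ l) ` (G \<times> {..<m})"
    have "card H \<le> card (G \<times> {..<m})" unfolding H_def using G(1) by (intro card_image_le) auto
    also have "\<dots> \<le> K * (Suc e * D + 1) ^ t * m" using G by simp
    also have "\<dots> \<le> (K * ((Suc e + 1) ^ t * (D + 1) ^ t)) * m"
      by (intro mult_le_mono growth_scale order.refl)
    finally have "card H \<le> m * (K * (Suc e + 1) ^ t) * (D + 1) ^ t" by (simp only: ac_simps)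
    moreover have fH: "finite H" unfolding H_def using G(1) by auto
    moreover have "p \<in> lspan H Y" if p: "bounded_degree (insert z C) D p" for p
    proof -
      obtain q where q: "\<forall>l<m. bounded_degree C (Suc e * D) (q l)" "\<forall>x\<in>Y. p x = (\<Sum>l<m. q l x * z x ^ l)"
        using red[OF p] by blast
      have "(\<lambda>x. q l x * z x ^ l) \<in> lspan H Y" if l: "l < m" for l
      proof -
        from G(3) q(1) l obtain c where c: "\<And>x. x \<in> Y \<Longrightarrow> q l x = (\<Sum>g\<in>G. c g * g x)"
          unfolding lspan_def by blast
        have "(\<lambda>x. g x * z x ^ l) \<in> H" if "g \<in> G" for g
          using that l unfolding H_def by force
        then have "(\<lambda>x. \<Sum>g\<in>G. c g * (g x * z x ^ l)) \<in> lspan H Y"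
          by (intro lspan_sum lspan_cmult lspan_base fH)
        then show ?thesis by (rule lspan_cong) (simp add: c sum_distrib_right mult.assoc)
      qed
      then have "(\<lambda>x. \<Sum>l<m. q l x * z x ^ l) \<in> lspan H Y" by (intro lspan_sum) auto
      then show ?thesis by (rule lspan_cong) (use q(2) in auto)
    qed
    ultimately show "\<exists>G. finite G \<and> card G \<le> m * (K * (Suc e + 1) ^ t) * (D + 1) ^ t \<and>
        {p. bounded_degree (insert z C) D p} \<subseteq> lspan G Y" by blast
  qed
qed

section \<open>Algebraic independence and chains of irreducible closed sets\<close>

definition alg_indep :: "'i set \<Rightarrow> ('i \<Rightarrow> 'a \<Rightarrow> complex) \<Rightarrow> 'a set \<Rightarrow> bool" where
  "alg_indep I p Z \<longleftrightarrow> (\<forall>D c. (\<forall>x\<in>Z. (\<Sum>\<alpha>\<in>exponents I D. c \<alpha> * monom_fun I p \<alpha> x) = 0) \<longrightarrow>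
      (\<forall>\<alpha>\<in>exponents I D. c \<alpha> = 0))"

lemma alg_indepD:
  assumes "alg_indep I p Z" "\<And>x. x \<in> Z \<Longrightarrow> (\<Sum>\<alpha>\<in>exponents I D. c \<alpha> * monom_fun I p \<alpha> x) = 0"
    "\<alpha> \<in> exponents I D"
  shows "c \<alpha> = 0"
  using assms unfolding alg_indep_def by metis

lemma alg_indep_empty: "Z \<noteq> {} \<Longrightarrow> alg_indep {} p Z"
  by (auto simp: alg_indep_def exponents_def monom_fun_def)

lemma sum_exponents_insert:
  assumes "i \<notin> I" "finite I"
  shows "(\<Sum>\<alpha>\<in>exponents (insert i I) D. f \<alpha>) = (\<Sum>j\<le>D. \<Sum>\<beta>\<in>exponents I D. f (\<beta>(i := j)))"
proof -
  have "inj_on (\<lambda>(y, g). g(i := y)) ({..D} \<times> (I \<rightarrow>\<^sub>E {..D}))"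
    using inj_combinator[OF assms(1), of "\<lambda>_. {..D}"] by simp
  then show ?thesis
    unfolding exponents_def PiE_insert_eq
    by (simp add: sum.reindex sum.cartesian_product case_prod_unfold)
qed

text \<open>Passing from \<open>Z\<close> to a larger irreducible set gains one independent
  function, namely one that vanishes on \<open>Z\<close> but not on \<open>Z'\<close>. Order a
  relation on \<open>Z'\<close> by powers of \<open>p i\<close>. The lowest power can be cancelled
  because functions on \<open>Z'\<close> form a domain; restriction to \<open>Z\<close> then kills
  all higher terms and leaves a relation among the old functions.\<close>

lemma alg_indep_insert:
  assumes I: "finite I" "i \<notin> I" and ind: "alg_indep I p Z" and Z: "Z \<subseteq> Z'"
    and dom: "domain_on C Z'" and p: "\<And>j. j \<in> insert i I \<Longrightarrow> p j \<in> PF C"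
    and p0: "\<And>x. x \<in> Z \<Longrightarrow> p i x = 0" and p1: "\<not> (\<forall>x\<in>Z'. p i x = 0)"
  shows "alg_indep (insert i I) p Z'"
  unfolding alg_indep_def
proof (intro allI impI)
  fix D c
  assume rel: "\<forall>x\<in>Z'. (\<Sum>\<alpha>\<in>exponents (insert i I) D. c \<alpha> * monom_fun (insert i I) p \<alpha> x) = 0"
  define q where "q j x = (\<Sum>\<beta>\<in>exponents I D. c (\<beta>(i := j)) * monom_fun I p \<beta> x)" for j x
  have qPF: "q j \<in> PF C" for j
    unfolding q_def[abs_def] using p by (intro PF_sum PF_cmult monom_fun_PF) auto
  have mon: "monom_fun (insert i I) p (\<beta>(i := j)) x = p i x ^ j * monom_fun I p \<beta> x" for \<beta> j x
  proof -
    have "(\<Prod>k\<in>I. p k x ^ (if k = i then j else \<beta> k)) = (\<Prod>k\<in>I. p k x ^ \<beta> k)"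
      using I by (intro prod.cong) auto
    then show ?thesis using I by (simp add: monom_fun_def)
  qed
  have rel': "(\<Sum>j\<le>D. p i x ^ j * q j x) = 0" if "x \<in> Z'" for x
    using rel that I unfolding q_def
    by (simp add: sum_exponents_insert mon sum_distrib_left ac_simps)
  have coeffs: "\<forall>\<beta>\<in>exponents I D. c (\<beta>(i := j)) = 0" if "j \<le> D" for j
    using that
  proof (induction j rule: less_induct)
    case (less j)
    \<comment> \<open>The relation divided by \<open>p i ^ j\<close>, once the coefficients below
      \<open>j\<close> are known to be zero.\<close>
    define R where "R x = (\<Sum>j'\<in>{j..D}. p i x ^ (j' - j) * q j' x)" for x
    have "R \<in> PF C" unfolding R_def[abs_def] using p qPF
      by (intro PF_sum polynomial_functions.mult PF_power) auto
    have q0: "q j' x = 0" if "j' < j" for j' x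
      unfolding q_def using less.IH[OF that] less.prems that by (intro sum.neutral) (simp add: fun_upd_def)
    have "p i x ^ j * R x = 0" if x: "x \<in> Z'" for x
    proof -
      have "(\<Sum>j\<le>D. p i x ^ j * q j x) = (\<Sum>j'\<in>{j..D}. p i x ^ j' * q j' x)"
        using less.prems q0 by (intro sum.mono_neutral_right) auto
      also have "\<dots> = p i x ^ j * R x"
        unfolding R_def sum_distrib_left
        by (intro sum.cong) (auto simp: mult.assoc[symmetric] simp flip: power_add)
      finally show ?thesis using rel'[OF x] by simp
    qed
    then have R0: "\<forall>x\<in>Z'. R x = 0"
      using domain_onD[OF dom, of "\<lambda>x. p i x ^ j" R] p \<open>R \<in> PF C\<close> p1 by (auto intro: PF_power)
    have "q j x = 0" if x: "x \<in> Z" for x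
    proof -
      have "R x = (\<Sum>j'\<in>{j}. p i x ^ (j' - j) * q j' x)"
        unfolding R_def using p0[OF x] less.prems by (intro sum.mono_neutral_right) auto
      then show ?thesis using R0 x Z by auto
    qed
    then show ?case using alg_indepD[OF ind, of "\<lambda>\<beta>. c (\<beta>(i := j))" D] by (simp add: q_def fun_upd_def)
  qed
  show "\<forall>\<alpha>\<in>exponents (insert i I) D. c \<alpha> = 0"
  proof
    fix \<alpha> assume "\<alpha> \<in> exponents (insert i I) D"
    then obtain j \<beta> where "j \<le> D" "\<beta> \<in> exponents I D" "\<alpha> = \<beta>(i := j)"
      unfolding exponents_def PiE_insert_eq by auto
    then show "c \<alpha> = 0" using coeffs by blast
  qed
qed

text \<open>Independence makes (D+1)^(card I) monomials of degree O(D) linearly independent, in a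
  space of dimension O(D^t); for large \<open>D\<close> this forces card I \<le> t.\<close>

lemma alg_indep_card_le:
  assumes I: "finite I" and ind: "alg_indep I p Y" and p: "\<And>i. i \<in> I \<Longrightarrow> p i \<in> PF C"
    and gr: "growth_le C Y t"
  shows "card I \<le> t"
proof (rule ccontr)
  assume "\<not> card I \<le> t"
  then have t: "Suc t \<le> card I" by simp
  obtain e where e: "\<And>i. i \<in> I \<Longrightarrow> bounded_degree C e (p i)"
    using PF_bounded_degree_uniform[of I p C] I p by blast
  obtain K where K: "\<And>D. \<exists>G. finite G \<and> card G \<le> K * (D + 1) ^ t \<and> {p. bounded_degree C D p} \<subseteq> lspan G Y"
    using gr unfolding growth_le_def by blast
  define E where "E = e * card I"
  \<comment> \<open>Chosen so that the bound K (E+1)^t (D+1)^t equals D (D+1)^t, just below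
    (D+1)^(t+1).\<close>
  define D where "D = K * (E + 1) ^ t"
  obtain G where G: "finite G" "card G \<le> K * (E * D + 1) ^ t" "{p. bounded_degree C (E * D) p} \<subseteq> lspan G Y"
    using K by blast
  note G(2)
  also have "K * (E * D + 1) ^ t \<le> K * ((E + 1) ^ t * (D + 1) ^ t)"
    by (intro mult_le_mono2 growth_scale)
  also have "\<dots> = D * (D + 1) ^ t" by (simp add: D_def)
  also have "\<dots> < (D + 1) ^ Suc t" by simp
  also have "\<dots> \<le> (D + 1) ^ card I" using t by (intro power_increasing) auto
  also have "\<dots> = card (exponents I D)" using I by (simp add: card_exponents)
  finally have "card G < card (exponents I D)" .
  moreover have "monom_fun I p \<alpha> \<in> lspan G Y" if "\<alpha> \<in> exponents I D" for \<alpha>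
    using bounded_degree_monom[OF I that e] G(3) by (auto simp: E_def ac_simps)
  ultimately have "\<exists>c. (\<exists>\<alpha>\<in>exponents I D. c \<alpha> \<noteq> 0) \<and>
      (\<forall>x\<in>Y. (\<Sum>\<alpha>\<in>exponents I D. c \<alpha> * monom_fun I p \<alpha> x) = 0)"
    by (intro lspan_dependent[OF G(1) finite_exponents[OF I]])
  then obtain c \<alpha> where "\<alpha> \<in> exponents I D" "c \<alpha> \<noteq> 0"
    "\<forall>x\<in>Y. (\<Sum>\<alpha>\<in>exponents I D. c \<alpha> * monom_fun I p \<alpha> x) = 0" by blast
  with alg_indepD[OF ind, of c D \<alpha>] show False by simp
qed

text \<open>Since \<open>Z i\<close> is closed, each strict inclusion supplies a function that
  vanishes on \<open>Z i\<close> but not on \<open>Z (Suc i)\<close>, so l inclusions among l + 1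
  sets give l independent functions. The smallest set contributes nothing beyond being
  nonempty.\<close>

lemma irreducible_chain_alg_indep:
  assumes "\<And>i. i \<le> l \<Longrightarrow> closedin (zariski C Y) (Z i) \<and> irreducible_space (subtopology (zariski C Y) (Z i))"
    and "\<And>i. i < l \<Longrightarrow> Z i \<subset> Z (Suc i)"
  shows "\<exists>p. (\<forall>i<l. p i \<in> PF C) \<and> alg_indep {..<l} p (Z l)"
  using assms
proof (induction l)
  case 0
  then have "topspace (subtopology (zariski C Y) (Z 0)) \<noteq> {}"
    by (simp add: irreducible_space_def)
  then have "Z 0 \<noteq> {}" by auto
  then show ?case by (simp add: alg_indep_empty lessThan_empty_iff)
next
  case (Suc l)
  then have "\<exists>p. (\<forall>i<l. p i \<in> PF C) \<and> alg_indep {..<l} p (Z l)"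
    by (intro Suc.IH Suc.prems) simp_all
  then obtain p where p: "\<And>i. i < l \<Longrightarrow> p i \<in> PF C" "alg_indep {..<l} p (Z l)" by blast
  have sub: "Z i \<subseteq> Y" if "i \<le> Suc l" for i
    using Suc.prems(1)[OF that] closedin_subset[of "zariski C Y" "Z i"] by simp
  have dom: "domain_on C (Z (Suc l))"
    using Suc.prems(1)[of "Suc l"] sub[of "Suc l"]
    by (simp add: subtopology_zariski irreducible_zariski_iff)
  obtain S where S: "S \<subseteq> PF C" "Z l = zero_locus Y S"
    using Suc.prems(1)[of l] unfolding closedin_zariski by auto
  have "Z l \<subset> Z (Suc l)" using Suc.prems(2)[of l] by simp
  then obtain q where q: "q \<in> S" "\<not> (\<forall>x\<in>Z (Suc l). q x = 0)"
    using S(2) sub[of "Suc l"] unfolding zero_locus_def by auto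
  define p' where "p' = p(l := q)"
  have "alg_indep {..<l} p' (Z l)"
  proof -
    have "monom_fun {..<l} p' = monom_fun {..<l} p"
      by (auto simp: monom_fun_def fun_eq_iff p'_def)
    then show ?thesis using p(2) by (simp add: alg_indep_def)
  qed
  then have "alg_indep (insert l {..<l}) p' (Z (Suc l))"
  proof (rule alg_indep_insert[rotated 2])
    show "Z l \<subseteq> Z (Suc l)" using \<open>Z l \<subset> Z (Suc l)\<close> by blast
    show "domain_on C (Z (Suc l))" by fact
    show "p' j \<in> PF C" if "j \<in> insert l {..<l}" for j
      using that p(1) q(1) S(1) by (auto simp: p'_def)
    show "p' l x = 0" if "x \<in> Z l" for x
      using that q(1) S(2) by (auto simp: p'_def zero_locus_def)
    show "\<not> (\<forall>x\<in>Z (Suc l). p' l x = 0)" using q(2) by (simp add: p'_def)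
  qed auto
  moreover have "\<forall>i<Suc l. p' i \<in> PF C" using p(1) q(1) S(1) by (auto simp: p'_def less_Suc_eq)
  ultimately show ?case by (auto simp: lessThan_Suc)
qed

lemma krull_dim_le_growth:
  assumes "growth_le C Y t"
  shows "krull_dim (zariski C Y) \<le> ereal (real t)"
  unfolding krull_dim_def
proof (rule Sup_least, clarsimp)
  fix l and Z :: "nat \<Rightarrow> 'a set"
  assume Z: "\<forall>i\<le>l. closedin (zariski C Y) (Z i) \<and> irreducible_space (subtopology (zariski C Y) (Z i))"
    "\<forall>i<l. Z i \<subset> Z (Suc i)"
  then obtain p where p: "\<forall>i<l. p i \<in> PF C" "alg_indep {..<l} p (Z l)"
    using irreducible_chain_alg_indep[of l C Y Z] by blast
  have "Z l \<subseteq> Y" using Z(1) closedin_subset[of "zariski C Y" "Z l"] by simp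
  have "growth_le C (Z l) t"
    using assms lspan_anti_mono[OF \<open>Z l \<subseteq> Y\<close>] unfolding growth_le_def by (meson order_trans)
  from alg_indep_card_le[OF _ p(2) _ this] p(1) show "l \<le> t" by simp
qed

lemma PF_if:
  assumes "p \<in> PF C" "q \<in> PF C"
  shows "(\<lambda>x. if b then p x else q x) \<in> PF C"
  using assms by (cases b) simp_all

subsection \<open>Entire curves\<close>

text \<open>A criterion for irreducibility that applies to sets not known to be algebraic. Entire
  rather than polynomial curves are allowed because the rotations are parametrised by sine and
  cosine.\<close>

definition entire_connected :: "('a \<Rightarrow> complex) set \<Rightarrow> 'a set \<Rightarrow> bool" where
  "entire_connected C Z \<longleftrightarrow> (\<forall>x\<in>Z. \<forall>y\<in>Z. \<exists>\<phi>. \<phi> 0 = x \<and> \<phi> 1 = y \<and> range \<phi> \<subseteq> Z \<and>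
      (\<forall>c\<in>C. (\<lambda>t. c (\<phi> t)) holomorphic_on UNIV))"

lemma PF_holomorphic_on:
  assumes "p \<in> PF C" "\<And>c. c \<in> C \<Longrightarrow> (\<lambda>t. c (\<phi> t)) holomorphic_on A"
  shows "(\<lambda>t. p (\<phi> t)) holomorphic_on A"
  using assms by (induction rule: polynomial_functions.induct) (auto intro!: holomorphic_intros)

lemma entire_connected_domain_on:
  assumes "entire_connected C Z"
  shows "domain_on C Z"
  unfolding domain_on_def
proof (intro ballI impI, rule ccontr)
  fix p q assume p: "p \<in> PF C" and q: "q \<in> PF C" and pq: "\<forall>x\<in>Z. p x * q x = 0"
    and "\<not> ((\<forall>x\<in>Z. p x = 0) \<or> (\<forall>x\<in>Z. q x = 0))"
  then obtain x y where xy: "x \<in> Z" "p x \<noteq> 0" "y \<in> Z" "q y \<noteq> 0" by blast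
  obtain \<phi> where \<phi>: "\<phi> 0 = x" "\<phi> 1 = y" "range \<phi> \<subseteq> Z" "\<And>c. c \<in> C \<Longrightarrow> (\<lambda>t. c (\<phi> t)) holomorphic_on UNIV"
    using assms xy unfolding entire_connected_def by metis
  have hp: "(\<lambda>t. p (\<phi> t)) holomorphic_on UNIV" and hq: "(\<lambda>t. q (\<phi> t)) holomorphic_on UNIV"
    using PF_holomorphic_on \<phi>(4) p q by blast+
  \<comment> \<open>Along the curve \<open>p\<close> is nonzero near 0, so \<open>q\<close> vanishes
    on a neighbourhood of 0 and, by the identity theorem, also at 1, where it was chosen
    nonzero.\<close>
  define U where "U = {t. p (\<phi> t) \<noteq> 0}"
  have "open U" unfolding U_def using holomorphic_on_imp_continuous_on[OF hp]
    by (intro open_Collect_neq) auto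
  moreover have "0 \<in> U" using xy \<phi> by (simp add: U_def)
  ultimately have "0 islimpt U" by (simp add: interior_limit_point interior_open)
  have "q (\<phi> 1) = 0"
  proof (rule analytic_continuation[OF hq open_UNIV connected_UNIV])
    show "0 islimpt U" by fact
    show "q (\<phi> t) = 0" if "t \<in> U" for t
      using that pq \<phi>(3) by (auto simp: U_def)
  qed auto
  then show False using xy \<phi> by simp
qed

lemma domain_on_closure:
  assumes "domain_on C S" "S \<subseteq> Z" "\<And>p. p \<in> PF C \<Longrightarrow> (\<And>x. x \<in> S \<Longrightarrow> p x = 0) \<Longrightarrow> \<forall>x\<in>Z. p x = 0"
  shows "domain_on C Z"
  unfolding domain_on_def
proof (intro ballI impI)
  fix p q assume "p \<in> PF C" "q \<in> PF C" "\<forall>x\<in>Z. p x * q x = 0"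
  then have "(\<forall>x\<in>S. p x = 0) \<or> (\<forall>x\<in>S. q x = 0)"
    using assms(1,2) unfolding domain_on_def by blast
  then show "(\<forall>x\<in>Z. p x = 0) \<or> (\<forall>x\<in>Z. q x = 0)"
    using assms(3)[OF \<open>p \<in> PF C\<close>] assms(3)[OF \<open>q \<in> PF C\<close>] by blast
qed

text \<open>The identity theorem for polynomials, obtained from the flag of coordinate subspaces:
  each new coordinate vanishes on the previous subspace but not on the next, and any two points of a
  subspace lie on a line.\<close>

lemma alg_indep_coordinates:
  assumes "finite I"
  shows "alg_indep I (\<lambda>i x. x i) (UNIV :: ('i \<Rightarrow> complex) set)"
proof -
  define Z :: "'i set \<Rightarrow> ('i \<Rightarrow> complex) set" where "Z J = {x. \<forall>j. j \<notin> J \<longrightarrow> x j = 0}" for J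
  define C :: "(('i \<Rightarrow> complex) \<Rightarrow> complex) set" where "C = range (\<lambda>j x. x j)"
  have dom: "domain_on C (Z J)" for J
  proof (rule entire_connected_domain_on, unfold entire_connected_def, intro ballI)
    fix x y assume "x \<in> Z J" "y \<in> Z J"
    then show "\<exists>\<phi>. \<phi> 0 = x \<and> \<phi> 1 = y \<and> range \<phi> \<subseteq> Z J \<and> (\<forall>c\<in>C. (\<lambda>t. c (\<phi> t)) holomorphic_on UNIV)"
      by (intro exI[of _ "\<lambda>t j. x j + t * (y j - x j)"])
        (auto simp: Z_def C_def intro!: holomorphic_intros)
  qed
  from assms have "alg_indep I (\<lambda>i x. x i) (Z I)"
  proof (induction I rule: finite_induct)
    case empty
    have "(\<lambda>_. 0) \<in> Z {}" by (simp add: Z_def)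
    then show ?case by (intro alg_indep_empty) blast
  next
    case (insert i I)
    show ?case
    proof (rule alg_indep_insert[OF insert.hyps(1,2) insert.IH _ dom])
      have "(\<lambda>j. if j = i then 1 else 0) \<in> Z (insert i I)" by (auto simp: Z_def)
      then show "\<not> (\<forall>x\<in>Z (insert i I). x i = 0)" by fastforce
    qed (use insert.hyps in \<open>auto simp: Z_def C_def intro: PF_intros\<close>)
  qed
  then show ?thesis unfolding alg_indep_def by blast
qed

lemma monomial_sum_nonzero:
  assumes "finite I" "\<beta> \<in> exponents I D" "b \<beta> \<noteq> 0"
  shows "\<exists>a. (\<Sum>\<beta>\<in>exponents I D. b \<beta> * (\<Prod>i\<in>I. a i ^ \<beta> i)) \<noteq> (0 :: complex)"
proof (rule ccontr)
  assume "\<not> ?thesis"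
  then have "b \<beta> = 0"
    by (intro alg_indepD[OF alg_indep_coordinates[OF assms(1)] _ assms(2)]) (simp add: monom_fun_def)
  with assms(3) show False by simp
qed

subsection \<open>Generic Noether normalisation\<close>

text \<open>Counting again: the products of monomials number (D+1)^(card T + card S) and lie in a
  space of dimension at most (E D + 1)^(card I). The two exponents are kept apart so that the result
  reads as a relation among the \<open>z\<close> with coefficients that are polynomials in the
  \<open>\<Phi>\<close>.\<close>

lemma dependent_monomials:
  assumes fin: "finite I" "finite T" "finite S" and card: "card I < card T + card S"
    and \<Phi>: "\<And>t. t \<in> T \<Longrightarrow> \<Phi> t \<in> PF (g ` I)" and z: "\<And>s. s \<in> S \<Longrightarrow> z s \<in> PF (g ` I)"
  shows "\<exists>D c. (\<exists>\<alpha>\<in>exponents T D. \<exists>\<beta>\<in>exponents S D. c \<alpha> \<beta> \<noteq> 0) \<and>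
     (\<forall>x. (\<Sum>\<beta>\<in>exponents S D. (\<Sum>\<alpha>\<in>exponents T D. c \<alpha> \<beta> * monom_fun T \<Phi> \<alpha> x) * monom_fun S z \<beta> x) = 0)"
proof -
  let ?C = "g ` I"
  obtain e1 where e1: "\<And>t. t \<in> T \<Longrightarrow> bounded_degree ?C e1 (\<Phi> t)"
    using PF_bounded_degree_uniform[of T \<Phi> ?C] fin \<Phi> by blast
  obtain e2 where e2: "\<And>s. s \<in> S \<Longrightarrow> bounded_degree ?C e2 (z s)"
    using PF_bounded_degree_uniform[of S z ?C] fin z by blast
  define E where "E = e1 * card T + e2 * card S"
  \<comment> \<open>This value turns (E+1)^(card I) (D+1)^(card I) into D (D+1)^(card I).\<close>
  define D where "D = (E + 1) ^ card I"
  define G where "G = monom_fun I g ` exponents I (E * D)"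
  define J where "J = exponents T D \<times> exponents S D"
  have "card G \<le> (E * D + 1) ^ card I" unfolding G_def using fin(1) by (rule card_monom_image_le)
  also have "\<dots> \<le> (E + 1) ^ card I * (D + 1) ^ card I" by (rule growth_scale)
  also have "\<dots> = D * (D + 1) ^ card I" by (simp add: D_def)
  also have "\<dots> < (D + 1) ^ Suc (card I)" by simp
  also have "\<dots> \<le> (D + 1) ^ (card T + card S)" using card by (intro power_increasing) auto
  also have "\<dots> = card J" using fin by (simp add: J_def card_exponents power_add)
  finally have "card G < card J" .
  moreover have "finite G" "finite J" unfolding G_def J_def using fin by auto
  moreover have "(\<lambda>(\<alpha>, \<beta>) x. monom_fun T \<Phi> \<alpha> x * monom_fun S z \<beta> x) j \<in> lspan G UNIV" if jJ: "j \<in> J" for j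
  proof -
    obtain \<alpha> \<beta> where j: "j = (\<alpha>, \<beta>)" "\<alpha> \<in> exponents T D" "\<beta> \<in> exponents S D"
      using jJ unfolding J_def by auto
    have "bounded_degree ?C (e1 * D * card T + e2 * D * card S) (\<lambda>x. monom_fun T \<Phi> \<alpha> x * monom_fun S z \<beta> x)"
      using j fin e1 e2 by (intro bounded_degree_mult bounded_degree_monom) auto
    then have "bounded_degree ?C (E * D) (\<lambda>x. monom_fun T \<Phi> \<alpha> x * monom_fun S z \<beta> x)"
      by (simp add: E_def algebra_simps)
    from bounded_degree_in_lspan[OF fin(1) this] show ?thesis by (simp add: j G_def)
  qed
  ultimately have "\<exists>c. (\<exists>j\<in>J. c j \<noteq> 0) \<and>
    (\<forall>x\<in>UNIV. (\<Sum>j\<in>J. c j * (\<lambda>(\<alpha>, \<beta>) x. monom_fun T \<Phi> \<alpha> x * monom_fun S z \<beta> x) j x) = 0)"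
    by (intro lspan_dependent)
  then obtain c where c: "\<exists>j\<in>J. c j \<noteq> 0"
    "\<forall>x\<in>UNIV. (\<Sum>j\<in>J. c j * (\<lambda>(\<alpha>, \<beta>) x. monom_fun T \<Phi> \<alpha> x * monom_fun S z \<beta> x) j x) = 0" by blast
  have "(\<Sum>\<beta>\<in>exponents S D. (\<Sum>\<alpha>\<in>exponents T D. c (\<alpha>, \<beta>) * monom_fun T \<Phi> \<alpha> x) * monom_fun S z \<beta> x) = 0" for x
  proof -
    have "(\<Sum>\<beta>\<in>exponents S D. (\<Sum>\<alpha>\<in>exponents T D. c (\<alpha>, \<beta>) * monom_fun T \<Phi> \<alpha> x) * monom_fun S z \<beta> x) =
      (\<Sum>\<alpha>\<in>exponents T D. \<Sum>\<beta>\<in>exponents S D. c (\<alpha>, \<beta>) * (monom_fun T \<Phi> \<alpha> x * monom_fun S z \<beta> x))"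
      by (subst sum.swap) (simp add: sum_distrib_right mult.assoc)
    also have "\<dots> = (\<Sum>j\<in>J. c j * (\<lambda>(\<alpha>, \<beta>) x. monom_fun T \<Phi> \<alpha> x * monom_fun S z \<beta> x) j x)"
      unfolding J_def sum.cartesian_product by (simp add: case_prod_unfold)
    finally show ?thesis using c(2) by simp
  qed
  moreover have "\<exists>\<alpha>\<in>exponents T D. \<exists>\<beta>\<in>exponents S D. c (\<alpha>, \<beta>) \<noteq> 0"
    using c(1) unfolding J_def by auto
  ultimately show ?thesis by (intro exI[of _ D] exI[of _ "\<lambda>\<alpha> \<beta>. c (\<alpha>, \<beta>)"]) auto
qed

text \<open>A polynomial in \<open>z\<close> over \<open>PF C\<close> whose coefficient at z^m is a
  constant, possibly 0. Constancy is what later permits division by it.\<close>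

definition expands :: "('a \<Rightarrow> complex) set \<Rightarrow> ('a \<Rightarrow> complex) \<Rightarrow> nat \<Rightarrow> complex \<Rightarrow> ('a \<Rightarrow> complex) \<Rightarrow> bool" where
  "expands C z m a p \<longleftrightarrow> (\<exists>q. (\<forall>l. q l \<in> PF C) \<and> (\<forall>x. p x = (\<Sum>l<m. q l x * z x ^ l) + a * z x ^ m))"

lemma expands_linear_mult:
  assumes "expands C z m a p" "w \<in> PF C"
  shows "expands C z (Suc m) (b * a) (\<lambda>x. (w x + b * z x) * p x)"
proof -
  obtain q where q: "\<And>l. q l \<in> PF C" "\<And>x. p x = (\<Sum>l<m. q l x * z x ^ l) + a * z x ^ m"
    using assms(1) unfolding expands_def by blast
  define r where "r l x = w x * (if l < m then q l x else a) + b * (if l = 0 then 0 else q (l - 1) x)" for l x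
  have "r l \<in> PF C" for l
  proof -
    have "(\<lambda>x. if l < m then q l x else a) \<in> PF C" "(\<lambda>x. if l = 0 then 0 else q (l - 1) x) \<in> PF C"
      by (intro PF_if q(1) polynomial_functions.const)+
    then show ?thesis unfolding r_def[abs_def]
      by (intro polynomial_functions.add polynomial_functions.mult polynomial_functions.const assms(2))
  qed
  moreover have "(w x + b * z x) * p x = (\<Sum>l<Suc m. r l x * z x ^ l) + b * a * z x ^ Suc m" for x
  proof -
    have "(\<Sum>l<Suc m. r l x * z x ^ l) = w x * (\<Sum>l<Suc m. (if l < m then q l x else a) * z x ^ l)
        + b * (\<Sum>l<Suc m. (if l = 0 then 0 else q (l - 1) x) * z x ^ l)"
      unfolding r_def by (simp only: sum_distrib_left sum.distrib distrib_right mult.assoc)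
    also have "(\<Sum>l<Suc m. (if l < m then q l x else a) * z x ^ l) = p x"
      by (simp add: q(2))
    also have "(\<Sum>l<Suc m. (if l = 0 then 0 else q (l - 1) x) * z x ^ l) = (\<Sum>l<m. q l x * z x ^ l) * z x"
      by (subst sum.lessThan_Suc_shift) (simp add: sum_distrib_left ac_simps)
    finally show ?thesis using q(2)[of x] by (simp add: algebra_simps)
  qed
  ultimately show ?thesis unfolding expands_def by blast
qed

lemma expands_power_mult:
  assumes "expands C z m a p" "w \<in> PF C"
  shows "expands C z (m + e) (b ^ e * a) (\<lambda>x. (w x + b * z x) ^ e * p x)"
proof (induction e)
  case 0
  then show ?case using assms(1) by simp
next
  case (Suc e)
  from expands_linear_mult[OF this assms(2), of b] show ?case by (simp add: mult.assoc)
qed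

lemma expands_monom:
  assumes "finite S" "\<And>j. j \<in> S \<Longrightarrow> w j \<in> PF C"
  shows "expands C z (\<Sum>j\<in>S. \<beta> j) (\<Prod>j\<in>S. a j ^ \<beta> j) (\<lambda>x. \<Prod>j\<in>S. (w j x + a j * z x) ^ \<beta> j)"
  using assms
proof (induction S rule: finite_induct)
  case empty
  then show ?case unfolding expands_def
    by (simp add: exI[of _ "\<lambda>_ _. 0"] polynomial_functions.const)
next
  case (insert j S)
  then have "expands C z (\<Sum>j\<in>S. \<beta> j) (\<Prod>j\<in>S. a j ^ \<beta> j) (\<lambda>x. \<Prod>j\<in>S. (w j x + a j * z x) ^ \<beta> j)" by simp
  from expands_power_mult[OF this, of "w j" "\<beta> j" "a j"] insert show ?case
    by (simp add: add.commute)
qed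

lemma expands_pad:
  assumes "expands C z m a p" "m < m'"
  shows "expands C z m' 0 p"
proof -
  obtain q where q: "\<And>l. q l \<in> PF C" "\<And>x. p x = (\<Sum>l<m. q l x * z x ^ l) + a * z x ^ m"
    using assms(1) unfolding expands_def by blast
  define r where "r l x = (if l < m then q l x else if l = m then a else 0)" for l x
  have "r l \<in> PF C" for l
    unfolding r_def[abs_def] by (intro PF_if q(1) polynomial_functions.const)
  moreover have "p x = (\<Sum>l<m'. r l x * z x ^ l)" for x
  proof -
    have "(\<Sum>l<m'. r l x * z x ^ l) = (\<Sum>l<Suc m. r l x * z x ^ l)"
      using assms(2) by (intro sum.mono_neutral_right) (auto simp: r_def)
    then show ?thesis by (simp add: q(2) r_def)
  qed
  ultimately show ?thesis unfolding expands_def by auto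
qed

text \<open>The step of Noether normalisation. Substituting z_j = w_j + a_j z_i turns the relation
  of degree at most m into a polynomial in z_i whose coefficient at z_i^m is the top form evaluated
  at \<open>a\<close>. By assumption this constant is nonzero, so z_i is integral over the w_j, and
  w_i = 0 because a_i = 1.\<close>

lemma growth_le_linear_change:
  fixes z :: "'s \<Rightarrow> 'a \<Rightarrow> complex"
  assumes S: "finite S" "i \<in> S" and a: "a i = 1"
    and rel: "\<And>x. x \<in> Y \<Longrightarrow> (\<Sum>\<beta>\<in>exponents S D. b \<beta> * monom_fun S z \<beta> x) = 0"
    and m: "\<And>\<beta>. \<beta> \<in> exponents S D \<Longrightarrow> b \<beta> \<noteq> 0 \<Longrightarrow> (\<Sum>j\<in>S. \<beta> j) \<le> m"
    and s: "(\<Sum>\<beta>\<in>exponents S D. (if (\<Sum>j\<in>S. \<beta> j) = m then b \<beta> else 0) * (\<Prod>j\<in>S. a j ^ \<beta> j)) \<noteq> 0"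
    and gr: "growth_le ((\<lambda>j x. z j x - a j * z i x) ` (S - {i})) Y t"
  shows "growth_le (z ` S) Y t"
proof -
  define w where "w j x = z j x - a j * z i x" for j x
  define C where "C = w ` (S - {i})"
  have w: "w j \<in> PF C" if "j \<in> S" for j
  proof (cases "j = i")
    case True
    then have "w j = (\<lambda>x. 0)" by (simp add: w_def[abs_def] a)
    then show ?thesis by (simp add: polynomial_functions.const)
  next
    case False
    then show ?thesis using that by (auto simp: C_def intro: polynomial_functions.coord)
  qed
  have zw: "z j = (\<lambda>x. w j x + a j * z i x)" for j by (simp add: w_def)
  define lead where "lead \<beta> = (if (\<Sum>j\<in>S. \<beta> j) = m then \<Prod>j\<in>S. a j ^ \<beta> j else 0)" for \<beta> :: "'s \<Rightarrow> nat"
  have "expands C (z i) m (lead \<beta>) (monom_fun S z \<beta>)" if \<beta>: "\<beta> \<in> exponents S D" "b \<beta> \<noteq> 0" for \<beta>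
  proof -
    have "expands C (z i) (\<Sum>j\<in>S. \<beta> j) (\<Prod>j\<in>S. a j ^ \<beta> j) (monom_fun S z \<beta>)"
    proof -
      have "(\<lambda>x. \<Prod>j\<in>S. (w j x + a j * z i x) ^ \<beta> j) = monom_fun S z \<beta>"
        by (simp add: monom_fun_def w_def fun_eq_iff)
      then show ?thesis using expands_monom[OF S(1) w, of "\<lambda>j. j" "z i" \<beta> a] by simp
    qed
    then show ?thesis using m[OF \<beta>] expands_pad[of C "z i" "\<Sum>j\<in>S. \<beta> j" _ _ m]
      by (cases "(\<Sum>j\<in>S. \<beta> j) = m") (auto simp: lead_def)
  qed
  then have "\<forall>\<beta>. \<exists>q. \<beta> \<in> exponents S D \<and> b \<beta> \<noteq> 0 \<longrightarrow> (\<forall>l. q l \<in> PF C) \<and>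
      (\<forall>x. monom_fun S z \<beta> x = (\<Sum>l<m. q l x * z i x ^ l) + lead \<beta> * z i x ^ m)"
    unfolding expands_def by blast
  then obtain q where "\<forall>\<beta>. \<beta> \<in> exponents S D \<and> b \<beta> \<noteq> 0 \<longrightarrow> (\<forall>l. q \<beta> l \<in> PF C) \<and>
      (\<forall>x. monom_fun S z \<beta> x = (\<Sum>l<m. q \<beta> l x * z i x ^ l) + lead \<beta> * z i x ^ m)"
    by (rule choice[THEN exE])
  then have q: "\<And>\<beta> l. \<beta> \<in> exponents S D \<Longrightarrow> b \<beta> \<noteq> 0 \<Longrightarrow> q \<beta> l \<in> PF C"
    "\<And>\<beta> x. \<beta> \<in> exponents S D \<Longrightarrow> b \<beta> \<noteq> 0 \<Longrightarrow>
       monom_fun S z \<beta> x = (\<Sum>l<m. q \<beta> l x * z i x ^ l) + lead \<beta> * z i x ^ m" by auto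
  \<comment> \<open>The constant coefficient of z_i^m; dividing by - s0 solves the relation for
    z_i^m.\<close>
  define s0 where "s0 = (\<Sum>\<beta>\<in>exponents S D. b \<beta> * lead \<beta>)"
  have s0: "s0 \<noteq> 0"
  proof -
    have "s0 = (\<Sum>\<beta>\<in>exponents S D. (if (\<Sum>j\<in>S. \<beta> j) = m then b \<beta> else 0) * (\<Prod>j\<in>S. a j ^ \<beta> j))"
      unfolding s0_def lead_def by (intro sum.cong) auto
    then show ?thesis using s by simp
  qed
  define Q where "Q l x = (- 1 / s0) * (\<Sum>\<beta>\<in>exponents S D. b \<beta> * q \<beta> l x)" for l x
  have "Q l \<in> PF C" for l
  proof -
    have "(\<lambda>x. b \<beta> * q \<beta> l x) \<in> PF C" if "\<beta> \<in> exponents S D" for \<beta>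
      using q(1)[OF that] by (cases "b \<beta> = 0") (auto intro: PF_cmult polynomial_functions.const)
    then show ?thesis unfolding Q_def[abs_def] by (intro PF_cmult[of _ C "- 1 / s0"] PF_sum)
  qed
  moreover have "z i x ^ m = (\<Sum>l<m. Q l x * z i x ^ l)" if x: "x \<in> Y" for x
  proof -
    have "0 = (\<Sum>\<beta>\<in>exponents S D. b \<beta> * monom_fun S z \<beta> x)" using rel[OF x] by simp
    also have "\<dots> = (\<Sum>\<beta>\<in>exponents S D. b \<beta> * (\<Sum>l<m. q \<beta> l x * z i x ^ l) + b \<beta> * lead \<beta> * z i x ^ m)"
      using q(2) by (intro sum.cong refl) (metis (no_types, lifting) distrib_left mult.assoc mult_zero_left add_0)
    also have "\<dots> = (\<Sum>\<beta>\<in>exponents S D. \<Sum>l<m. b \<beta> * q \<beta> l x * z i x ^ l) + s0 * z i x ^ m"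
      by (simp add: sum.distrib s0_def sum_distrib_left sum_distrib_right mult.assoc)
    also have "(\<Sum>\<beta>\<in>exponents S D. \<Sum>l<m. b \<beta> * q \<beta> l x * z i x ^ l)
        = (\<Sum>l<m. (\<Sum>\<beta>\<in>exponents S D. b \<beta> * q \<beta> l x) * z i x ^ l)"
      by (subst sum.swap) (simp add: sum_distrib_right)
    also have "\<dots> = - s0 * (\<Sum>l<m. Q l x * z i x ^ l)"
    proof -
      have "(\<Sum>\<beta>\<in>exponents S D. b \<beta> * q \<beta> l x) = - s0 * Q l x" for l
        unfolding Q_def using s0 by simp
      then show ?thesis by (simp add: sum_distrib_left mult.assoc)
    qed
    finally have "s0 * (z i x ^ m - (\<Sum>l<m. Q l x * z i x ^ l)) = 0" by (simp add: right_diff_distrib)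
    then show ?thesis using s0 by simp
  qed
  moreover have "growth_le C Y t" using gr by (simp add: C_def w_def[abs_def])
  ultimately have gr': "growth_le (insert (z i) C) Y t" by (intro growth_le_integral[of C Y t m Q "z i"])
  have sub: "z ` S \<subseteq> PF (insert (z i) C)"
  proof
    fix f assume "f \<in> z ` S"
    then obtain j where j: "j \<in> S" "f = z j" by blast
    have "w j \<in> PF (insert (z i) C)" using w[OF j(1)] PF_mono[of C "insert (z i) C"] by blast
    then have "(\<lambda>x. w j x + a j * z i x) \<in> PF (insert (z i) C)"
      by (intro polynomial_functions.add PF_cmult polynomial_functions.coord[of "z i"]) auto
    then show "f \<in> PF (insert (z i) C)" unfolding j(2) by (subst zw)
  qed
  show ?thesis by (rule growth_le_subst[OF gr' _ sub]) (use S in simp)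
qed

text \<open>While \<open>card S\<close> exceeds card I - card T, counting yields a relation among
  the \<open>z\<close> whose coefficients depend on \<pi> x only, hence are numbers on each fibre.
  Where its top form does not vanish at a fixed direction \<open>a\<close>, one of the
  \<open>z\<close> is integral over linear combinations of the others. The exceptional conditions
  are multiplied into \<open>s\<close>, which stays nonzero on \<open>X\<close> because functions
  there form a domain. The family \<open>z\<close> is arbitrary because each step replaces it by a
  sheared one.\<close>

lemma generic_fibre_growth:
  fixes \<pi> :: "'a \<Rightarrow> 'f" and g :: "'i \<Rightarrow> 'a \<Rightarrow> complex" and \<psi> :: "'t \<Rightarrow> 'f \<Rightarrow> complex" and z :: "'s \<Rightarrow> 'a \<Rightarrow> complex"
  assumes fin: "finite I" "finite T" "finite S" and \<psi>: "\<And>t. t \<in> T \<Longrightarrow> \<psi> t \<in> PF C'"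
    and \<psi>\<pi>: "\<And>t. t \<in> T \<Longrightarrow> (\<lambda>x. \<psi> t (\<pi> x)) \<in> PF (g ` I)"
    and ind: "alg_indep T (\<lambda>t x. \<psi> t (\<pi> x)) X" and dom: "domain_on (g ` I) X"
    and z: "\<And>s. s \<in> S \<Longrightarrow> z s \<in> PF (g ` I)"
  shows "\<exists>s\<in>PF C'. (\<lambda>x. s (\<pi> x)) \<in> PF (g ` I) \<and> \<not> (\<forall>x\<in>X. s (\<pi> x) = 0) \<and>
     (\<forall>f. s f \<noteq> 0 \<longrightarrow> growth_le (z ` S) {x \<in> X. \<pi> x = f} (card I - card T))"
  using fin(3) z
proof (induction "card S" arbitrary: S z rule: less_induct)
  case less
  have Xne: "X \<noteq> {}"
  proof
    assume "X = {}"
    then have "(1::complex) = 0" using alg_indepD[OF ind, of "\<lambda>_. 1" 0 "\<lambda>t\<in>T. 0"] by (auto simp: exponents_def)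
    then show False by simp
  qed
  show ?case
  proof (cases "card S \<le> card I - card T")
    case True
    then have "growth_le (z ` S) Y (card I - card T)" for Y
      using less.prems(1) by (intro growth_le_card)
    then show ?thesis using Xne by (intro bexI[of _ "\<lambda>_. 1"]) (auto intro: polynomial_functions.const)
  next
    case False
    then have "card I < card T + card S" by simp
    have "\<exists>D c. (\<exists>\<alpha>\<in>exponents T D. \<exists>\<beta>\<in>exponents S D. c \<alpha> \<beta> \<noteq> 0) \<and>
      (\<forall>x. (\<Sum>\<beta>\<in>exponents S D. (\<Sum>\<alpha>\<in>exponents T D. c \<alpha> \<beta> * monom_fun T (\<lambda>t x. \<psi> t (\<pi> x)) \<alpha> x)
        * monom_fun S z \<beta> x) = 0)"
      by (intro dependent_monomials[OF fin(1,2) less.prems(1) \<open>card I < _\<close>]) (auto intro: \<psi>\<pi> less.prems(2))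
    then obtain D c where c: "\<exists>\<alpha>\<in>exponents T D. \<exists>\<beta>\<in>exponents S D. c \<alpha> \<beta> \<noteq> 0"
      "\<And>x. (\<Sum>\<beta>\<in>exponents S D. (\<Sum>\<alpha>\<in>exponents T D. c \<alpha> \<beta> * monom_fun T (\<lambda>t x. \<psi> t (\<pi> x)) \<alpha> x) * monom_fun S z \<beta> x) = 0"
      by blast
    define B where "B \<beta> f = (\<Sum>\<alpha>\<in>exponents T D. c \<alpha> \<beta> * monom_fun T \<psi> \<alpha> f)" for \<beta> f
    have BPF: "B \<beta> \<in> PF C'" for \<beta>
      unfolding B_def[abs_def] using \<psi> by (intro PF_sum PF_cmult monom_fun_PF) auto
    have mon\<pi>: "monom_fun T \<psi> \<alpha> (\<pi> x) = monom_fun T (\<lambda>t x. \<psi> t (\<pi> x)) \<alpha> x" for \<alpha> x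
      by (simp add: monom_fun_def)
    have B\<pi>PF: "(\<lambda>x. B \<beta> (\<pi> x)) \<in> PF (g ` I)" for \<beta>
      unfolding B_def mon\<pi> using \<psi>\<pi> by (intro PF_sum PF_cmult monom_fun_PF) auto
    have rel: "(\<Sum>\<beta>\<in>exponents S D. B \<beta> (\<pi> x) * monom_fun S z \<beta> x) = 0" for x
      using c(2)[of x] by (simp add: B_def mon\<pi>)
    \<comment> \<open>The terms that really occur on \<open>X\<close>. Independence of the \<psi>
      \<circ> \<pi> makes this set nonempty; its maximal total degree becomes the degree of the
      integral equation.\<close>
    define N where "N = {\<beta> \<in> exponents S D. \<not> (\<forall>x\<in>X. B \<beta> (\<pi> x) = 0)}"
    have "N \<noteq> {}"
    proof
      assume N: "N = {}"
      from c(1) obtain \<alpha> \<beta> where ab: "\<alpha> \<in> exponents T D" "\<beta> \<in> exponents S D" "c \<alpha> \<beta> \<noteq> 0" by blast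
      have "(\<Sum>\<alpha>\<in>exponents T D. c \<alpha> \<beta> * monom_fun T (\<lambda>t x. \<psi> t (\<pi> x)) \<alpha> x) = 0" if "x \<in> X" for x
        using that N ab(2) by (auto simp: N_def B_def mon\<pi>)
      from alg_indepD[OF ind this ab(1)] ab(3) show False by simp
    qed
    moreover have "finite N" using less.prems(1) by (simp add: N_def)
    ultimately obtain \<beta>0 where \<beta>0: "\<beta>0 \<in> N" and max: "\<And>\<beta>. \<beta> \<in> N \<Longrightarrow> (\<Sum>j\<in>S. \<beta> j) \<le> (\<Sum>j\<in>S. \<beta>0 j)"
      using Max_in[of "(\<lambda>\<beta>. \<Sum>j\<in>S. \<beta> j) ` N"] Max_ge[of "(\<lambda>\<beta>. \<Sum>j\<in>S. \<beta> j) ` N"] by fastforce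
    define m where "m = (\<Sum>j\<in>S. \<beta>0 j)"
    define top where "top f \<beta> = (if (\<Sum>j\<in>S. \<beta> j) = m then B \<beta> f else 0)" for f \<beta>
    obtain x0 where x0: "x0 \<in> X" "B \<beta>0 (\<pi> x0) \<noteq> 0" using \<beta>0 by (auto simp: N_def)
    have "\<exists>a. (\<Sum>\<beta>\<in>exponents S D. top (\<pi> x0) \<beta> * (\<Prod>j\<in>S. a j ^ \<beta> j)) \<noteq> 0"
      using \<beta>0 x0 less.prems(1) by (intro monomial_sum_nonzero[of S \<beta>0]) (auto simp: N_def top_def m_def)
    then obtain a where a: "(\<Sum>\<beta>\<in>exponents S D. top (\<pi> x0) \<beta> * (\<Prod>j\<in>S. a j ^ \<beta> j)) \<noteq> 0" by blast
    \<comment> \<open>At a = 0 a form of positive degree vanishes, so m would be 0. The relation on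
      \<open>X\<close> would then consist of the single coefficient of the constant monomial, which
      is nonzero at \<open>x0\<close>.\<close>
    have "\<exists>i\<in>S. a i \<noteq> 0"
    proof (rule ccontr)
      assume no: "\<not> ?thesis"
      have m0: "m = 0"
      proof (rule ccontr)
        assume "m \<noteq> 0"
        have "top (\<pi> x0) \<beta> * (\<Prod>j\<in>S. a j ^ \<beta> j) = 0" if "\<beta> \<in> exponents S D" for \<beta>
        proof (cases "(\<Sum>j\<in>S. \<beta> j) = m")
          case True
          then obtain j where "j \<in> S" "\<beta> j \<noteq> 0" using \<open>m \<noteq> 0\<close> by (metis sum.neutral)
          then have "a j ^ \<beta> j = 0" using no by simp
          then show ?thesis using \<open>j \<in> S\<close> less.prems(1) by (metis mult_zero_right prod_zero)
        qed (simp add: top_def)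
        then show False using a by (simp add: sum.neutral)
      qed
      then have z0: "\<beta> = (\<lambda>j\<in>S. 0)" if "\<beta> \<in> N" for \<beta>
        using max[OF that] that less.prems(1) by (auto simp: N_def m_def exponents_def PiE_iff extensional_def fun_eq_iff)
      have "(\<Sum>\<beta>\<in>exponents S D. B \<beta> (\<pi> x0) * monom_fun S z \<beta> x0) = (\<Sum>\<beta>\<in>{\<beta>0}. B \<beta> (\<pi> x0) * monom_fun S z \<beta> x0)"
      proof (intro sum.mono_neutral_right ballI)
        show "finite (exponents S D)" "{\<beta>0} \<subseteq> exponents S D" using \<beta>0 less.prems(1) by (auto simp: N_def)
        fix \<beta> assume "\<beta> \<in> exponents S D - {\<beta>0}"
        then have "\<beta> \<notin> N" using z0 \<beta>0 by blast
        then show "B \<beta> (\<pi> x0) * monom_fun S z \<beta> x0 = 0"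
          using x0(1) \<open>\<beta> \<in> exponents S D - {\<beta>0}\<close> by (auto simp: N_def)
      qed
      then have "B \<beta>0 (\<pi> x0) = 0" using rel[of x0] z0[OF \<beta>0] by (simp add: monom_fun_def)
      with x0 show False by simp
    qed
    then obtain i where i: "i \<in> S" "a i \<noteq> 0" by blast
    \<comment> \<open>Normalisation to a' i = 1. The top form is homogeneous of degree m, so its
      value only changes by the factor 1 / a_i^m.\<close>
    define a' where "a' j = a j / a i" for j
    have scale: "top f \<beta> * (\<Prod>j\<in>S. a' j ^ \<beta> j) = (top f \<beta> * (\<Prod>j\<in>S. a j ^ \<beta> j)) / a i ^ m" for f \<beta>
      by (simp add: top_def a'_def power_divide prod_dividef flip: power_sum)
    define s1 where "s1 f = (\<Sum>\<beta>\<in>exponents S D. top f \<beta> * (\<Prod>j\<in>S. a' j ^ \<beta> j))" for f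
    have "s1 (\<pi> x0) = (\<Sum>\<beta>\<in>exponents S D. top (\<pi> x0) \<beta> * (\<Prod>j\<in>S. a j ^ \<beta> j)) / a i ^ m"
      unfolding s1_def scale by (simp add: sum_divide_distrib)
    then have s1_x0: "s1 (\<pi> x0) \<noteq> 0" using a i(2) by simp
    have "(\<lambda>f. top f \<beta>) \<in> PF C'" "(\<lambda>x. top (\<pi> x) \<beta>) \<in> PF (g ` I)" for \<beta>
      unfolding top_def by (intro PF_if BPF B\<pi>PF polynomial_functions.const)+
    then have s1PF: "s1 \<in> PF C'" "(\<lambda>x. s1 (\<pi> x)) \<in> PF (g ` I)" unfolding s1_def[abs_def]
      by (intro PF_sum polynomial_functions.mult polynomial_functions.const; simp)+
    define z' where "z' j x = z j x - a' j * z i x" for j x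
    have z'PF: "z' j \<in> PF (g ` I)" if "j \<in> S - {i}" for j
      unfolding z'_def[abs_def] using that i less.prems(2) by (intro PF_diff PF_cmult) auto
    have cardS: "card (S - {i}) < card S" using i less.prems(1) by (meson card_Diff1_less)
    have "finite (S - {i})" using less.prems(1) by simp
    from less.hyps[of "S - {i}" z', OF cardS this z'PF] obtain s2 where s2: "s2 \<in> PF C'" "(\<lambda>x. s2 (\<pi> x)) \<in> PF (g ` I)" "\<not> (\<forall>x\<in>X. s2 (\<pi> x) = 0)"
      "\<And>f. s2 f \<noteq> 0 \<Longrightarrow> growth_le (z' ` (S - {i})) {x \<in> X. \<pi> x = f} (card I - card T)"
      by blast
    show ?thesis
    proof (intro bexI[of _ "\<lambda>f. s1 f * s2 f"] conjI allI impI)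
      show "(\<lambda>f. s1 f * s2 f) \<in> PF C'" using s1PF s2 by (intro polynomial_functions.mult)
      show "(\<lambda>x. s1 (\<pi> x) * s2 (\<pi> x)) \<in> PF (g ` I)" using s1PF s2 by (intro polynomial_functions.mult)
      show "\<not> (\<forall>x\<in>X. s1 (\<pi> x) * s2 (\<pi> x) = 0)"
      proof
        assume "\<forall>x\<in>X. s1 (\<pi> x) * s2 (\<pi> x) = 0"
        then have "\<forall>x\<in>X. s2 (\<pi> x) = 0"
          using domain_onD[OF dom s1PF(2) s2(2)] s1_x0 x0(1) by blast
        with s2(3) show False by simp
      qed
      fix f assume "s1 f * s2 f \<noteq> 0"
      then have f: "s1 f \<noteq> 0" "s2 f \<noteq> 0" by auto
      show "growth_le (z ` S) {x \<in> X. \<pi> x = f} (card I - card T)"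
      proof (cases "f \<in> \<pi> ` X")
        case True
        then obtain x1 where x1: "x1 \<in> X" "f = \<pi> x1" by blast
        show ?thesis
        proof (rule growth_le_linear_change[OF less.prems(1) i(1), where a = a' and b = "\<lambda>\<beta>. B \<beta> f" and D = D and m = m])
          show "a' i = 1" using i by (simp add: a'_def)
          show "(\<Sum>\<beta>\<in>exponents S D. B \<beta> f * monom_fun S z \<beta> x) = 0" if "x \<in> {x \<in> X. \<pi> x = f}" for x
            using rel[of x] that by simp
          show "(\<Sum>j\<in>S. \<beta> j) \<le> m" if "\<beta> \<in> exponents S D" "B \<beta> f \<noteq> 0" for \<beta>
            using that x1 max[of \<beta>] by (auto simp: N_def m_def)
          show "(\<Sum>\<beta>\<in>exponents S D. (if (\<Sum>j\<in>S. \<beta> j) = m then B \<beta> f else 0) * (\<Prod>j\<in>S. a' j ^ \<beta> j)) \<noteq> 0"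
            using f(1) by (simp add: s1_def top_def)
          show "growth_le ((\<lambda>j x. z j x - a' j * z i x) ` (S - {i})) {x \<in> X. \<pi> x = f} (card I - card T)"
            using s2(4)[OF f(2)] by (simp add: z'_def[abs_def])
        qed
      next
        \<comment> \<open>Off the image of \<pi> the coefficients outside \<open>N\<close> need not
          vanish and the degree bound may fail, but there the fibre is empty.\<close>
        case False
        then have "{x \<in> X. \<pi> x = f} = {}" by blast
        moreover have "growth_le (z ` S) {} t" for t
          unfolding growth_le_def lspan_def by (intro exI[of _ 0] allI exI[of _ "{}"]) auto
        ultimately show ?thesis by (simp only:)
      qed
    qed
  qed
qed

subsection \<open>Images of dominant maps\<close>

definition coords :: "'i set \<Rightarrow> (('i \<Rightarrow> complex) \<Rightarrow> complex) set" where
  "coords J = (\<lambda>j w. w j) ` J"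

text \<open>The closure of the projection of \<open>E\<close> to the coordinates in
  \<open>J\<close>. Points keep all their coordinates, with those outside \<open>J\<close>
  arbitrary, so that lifting a point by one coordinate is a function update.\<close>

definition zariski_closure :: "'i set \<Rightarrow> ('i \<Rightarrow> complex) set \<Rightarrow> ('i \<Rightarrow> complex) set" where
  "zariski_closure J E = {w. \<forall>p\<in>PF (coords J). (\<forall>x\<in>E. p x = 0) \<longrightarrow> p w = 0}"

definition upoly :: "'i set \<Rightarrow> 'i \<Rightarrow> nat \<Rightarrow> (('i \<Rightarrow> complex) \<Rightarrow> complex) set" where
  "upoly J i m = {q. \<exists>c. (\<forall>j. c j \<in> PF (coords J)) \<and> (\<forall>w. q w = (\<Sum>j\<le>m. c j w * w i ^ j))}"

lemma coords_mono: "J \<subseteq> K \<Longrightarrow> PF (coords J) \<subseteq> PF (coords K)"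
  unfolding coords_def by (intro PF_mono image_mono)

lemma PF_coords_cong:
  assumes "p \<in> PF (coords J)" "\<And>j. j \<in> J \<Longrightarrow> w j = w' j"
  shows "p w = p w'"
  using assms by (induction rule: polynomial_functions.induct) (auto simp: coords_def)

lemma PF_coords_upd: "p \<in> PF (coords J) \<Longrightarrow> i \<notin> J \<Longrightarrow> p (w(i := \<tau>)) = p w"
  by (rule PF_coords_cong[of p J]) auto

lemma upoly_mono:
  assumes "q \<in> upoly J i m" "m \<le> m'"
  shows "q \<in> upoly J i m'"
proof -
  obtain c where c: "\<And>j. c j \<in> PF (coords J)" "\<And>w. q w = (\<Sum>j\<le>m. c j w * w i ^ j)"
    using assms(1) unfolding upoly_def by blast
  define d where "d j w = (if j \<le> m then c j w else 0)" for j w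
  have "d j \<in> PF (coords J)" for j
    unfolding d_def[abs_def] by (intro PF_if c polynomial_functions.const)
  moreover have "q w = (\<Sum>j\<le>m'. d j w * w i ^ j)" for w
  proof -
    have "(\<Sum>j\<le>m'. d j w * w i ^ j) = (\<Sum>j\<le>m. d j w * w i ^ j)"
      using assms(2) by (intro sum.mono_neutral_right) (auto simp: d_def)
    then show ?thesis by (simp add: c d_def)
  qed
  ultimately show ?thesis unfolding upoly_def by blast
qed

lemma upoly_add:
  assumes "p \<in> upoly J i m" "q \<in> upoly J i m"
  shows "(\<lambda>w. p w + q w) \<in> upoly J i m"
proof -
  obtain c where c: "\<And>j. c j \<in> PF (coords J)" "\<And>w. p w = (\<Sum>j\<le>m. c j w * w i ^ j)"
    using assms(1) unfolding upoly_def by blast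
  obtain d where d: "\<And>j. d j \<in> PF (coords J)" "\<And>w. q w = (\<Sum>j\<le>m. d j w * w i ^ j)"
    using assms(2) unfolding upoly_def by blast
  show ?thesis unfolding upoly_def
    by (intro CollectI exI[of _ "\<lambda>j w. c j w + d j w"])
      (auto simp: c(2) d(2) sum.distrib distrib_right intro: polynomial_functions.add c d)
qed

lemma upoly_cmult:
  assumes "q \<in> upoly J i m" "b \<in> PF (coords J)"
  shows "(\<lambda>w. b w * q w) \<in> upoly J i m"
proof -
  obtain c where c: "\<And>j. c j \<in> PF (coords J)" "\<And>w. q w = (\<Sum>j\<le>m. c j w * w i ^ j)"
    using assms(1) unfolding upoly_def by blast
  show ?thesis unfolding upoly_def
    by (intro CollectI exI[of _ "\<lambda>j w. b w * c j w"])
      (auto simp: c(2) sum_distrib_left mult.assoc intro: polynomial_functions.mult c assms(2))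
qed

lemma upoly_shift:
  assumes "q \<in> upoly J i m"
  shows "(\<lambda>w. w i * q w) \<in> upoly J i (Suc m)"
proof -
  obtain c where c: "\<And>j. c j \<in> PF (coords J)" "\<And>w. q w = (\<Sum>j\<le>m. c j w * w i ^ j)"
    using assms(1) unfolding upoly_def by blast
  define d where "d j w = (if j = 0 then 0 else c (j - 1) w)" for j w
  have "d j \<in> PF (coords J)" for j
    unfolding d_def[abs_def] by (intro PF_if c polynomial_functions.const)
  moreover have "w i * q w = (\<Sum>j\<le>Suc m. d j w * w i ^ j)" for w
    unfolding c(2) by (subst sum.atMost_Suc_shift) (simp add: d_def sum_distrib_left ac_simps)
  ultimately show ?thesis unfolding upoly_def by blast
qed

lemma upoly_const: "b \<in> PF (coords J) \<Longrightarrow> b \<in> upoly J i 0"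
  unfolding upoly_def by (intro CollectI exI[of _ "\<lambda>_. b"]) auto

lemma upoly_monom:
  assumes "b \<in> PF (coords J)"
  shows "(\<lambda>w. b w * w i ^ j) \<in> upoly J i j"
proof (induction j)
  case 0
  then show ?case using upoly_const[OF assms] by simp
next
  case (Suc j)
  from upoly_shift[OF this] show ?case by (simp add: mult.left_commute)
qed

lemma upoly_PF:
  assumes "q \<in> upoly J i m"
  shows "q \<in> PF (coords (insert i J))"
proof -
  obtain c where c: "\<And>j. c j \<in> PF (coords J)" "\<And>w. q w = (\<Sum>j\<le>m. c j w * w i ^ j)"
    using assms(1) unfolding upoly_def by blast
  have "(\<lambda>w. \<Sum>j\<le>m. c j w * w i ^ j) \<in> PF (coords (insert i J))"
    using c(1) coords_mono[of J "insert i J"]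
    by (intro PF_sum polynomial_functions.mult PF_power) (auto simp: coords_def intro: polynomial_functions.coord)
  moreover have "q = (\<lambda>w. \<Sum>j\<le>m. c j w * w i ^ j)" by (rule ext) (rule c(2))
  ultimately show ?thesis by simp
qed

lemma PF_upoly:
  assumes "p \<in> PF (coords (insert i J))"
  shows "\<exists>m. p \<in> upoly J i m"
proof -
  \<comment> \<open>The induction is about multiplication by \<open>p\<close> as an operator: the
    product case becomes composition, and two sums never have to be multiplied out.\<close>
  have "\<exists>m. (\<lambda>w. p w * q w) \<in> upoly J i m" if "q \<in> upoly J i l" for q l
    using assms that
  proof (induction arbitrary: q l rule: polynomial_functions.induct)
    case (const c)
    then show ?case using upoly_cmult[of q J i l "\<lambda>_. c"] by (auto intro: polynomial_functions.const)
  next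
    case (coord p)
    then consider "p = (\<lambda>w. w i)" | "p \<in> coords J" by (auto simp: coords_def)
    then show ?case
    proof cases
      case 1
      then show ?thesis using upoly_shift[OF coord(2)] by auto
    next
      case 2
      then show ?thesis using upoly_cmult[OF coord(2)] by (auto intro: polynomial_functions.coord)
    qed
  next
    case (add p p')
    obtain m m' where "(\<lambda>w. p w * q w) \<in> upoly J i m" "(\<lambda>w. p' w * q w) \<in> upoly J i m'"
      using add.IH add.prems by blast
    then have "(\<lambda>w. p w * q w + p' w * q w) \<in> upoly J i (max m m')"
      by (intro upoly_add; elim upoly_mono) auto
    then show ?case by (auto simp: distrib_right)
  next
    case (mult p p')
    obtain m where "(\<lambda>w. p' w * q w) \<in> upoly J i m" using mult.IH(2) mult.prems by blast
    from mult.IH(1)[OF this] show ?case by (simp add: mult.assoc)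
  qed
  from this[OF upoly_const[of "\<lambda>_. 1"]] show ?thesis by (auto intro: polynomial_functions.const)
qed

text \<open>Division with remainder over a ring where the leading coefficient cannot be inverted,
  hence the power \<open>gc m ^ e\<close>. Here \<open>m\<close> is a formal degree, as
  \<open>gc m\<close> may vanish at points; for m' < m the quotient is 0.\<close>

lemma upoly_pseudo_division:
  assumes m: "m \<ge> 1" and gc: "\<And>j. gc j \<in> PF (coords J)" and q: "q \<in> upoly J i m'"
  shows "\<exists>e u r. u \<in> upoly J i (m' - m) \<and> r \<in> upoly J i (m - 1) \<and>
    (\<forall>w. gc m w ^ e * q w = (\<Sum>j\<le>m. gc j w * w i ^ j) * u w + r w)"
  using q
proof (induction m' arbitrary: q)
  case 0
  have "q \<in> upoly J i (m - 1)" using 0 by (rule upoly_mono) simp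
  moreover have "(\<lambda>_. 0) \<in> upoly J i (0 - m)" using upoly_const[of "\<lambda>_. 0" J i] by (auto intro: polynomial_functions.const)
  ultimately show ?case by (intro exI[of _ 0] exI[of _ "\<lambda>_. 0"] exI[of _ q]) auto
next
  case (Suc k)
  show ?case
  proof (cases "Suc k < m")
    case True
    have "q \<in> upoly J i (m - 1)" using Suc.prems by (rule upoly_mono) (use True in simp)
    moreover have "(\<lambda>_. 0) \<in> upoly J i (Suc k - m)"
      using upoly_mono[OF upoly_const[of "\<lambda>_. 0" J i]] by (auto intro: polynomial_functions.const)
    ultimately show ?thesis by (intro exI[of _ 0] exI[of _ "\<lambda>_. 0"] exI[of _ q]) auto
  next
    case False
    define s where "s = Suc k - m"
    have s: "s + m = Suc k" using False by (simp add: s_def)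
    obtain c where c: "\<And>j. c j \<in> PF (coords J)" "\<And>w. q w = (\<Sum>j\<le>Suc k. c j w * w i ^ j)"
      using Suc.prems unfolding upoly_def by blast
    let ?g = "\<lambda>w. \<Sum>j\<le>m. gc j w * w i ^ j"
    let ?a = "gc m"
    \<comment> \<open>Cross-multiplied so that the terms of degree \<open>Suc k\<close> cancel
      without division.\<close>
    let ?q1 = "\<lambda>w. ?a w * q w - c (Suc k) w * w i ^ s * ?g w"
    define d where "d j w = ?a w * c j w - c (Suc k) w * (if s \<le> j then gc (j - s) w else 0)" for j w
    have dPF: "d j \<in> PF (coords J)" for j
      unfolding d_def[abs_def]
      by (intro PF_diff polynomial_functions.mult gc c PF_if polynomial_functions.const)
    have sg: "w i ^ s * ?g w = (\<Sum>j\<le>Suc k. (if s \<le> j then gc (j - s) w else 0) * w i ^ j)" for w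
    proof -
      have "w i ^ s * ?g w = (\<Sum>j\<in>{0..m}. gc j w * w i ^ (j + s))"
        by (simp add: sum_distrib_left power_add ac_simps atMost_atLeast0)
      also have "\<dots> = (\<Sum>j\<in>{0+s..m+s}. gc (j - s) w * w i ^ j)"
        by (subst sum.shift_bounds_cl_nat_ivl) simp
      also have "\<dots> = (\<Sum>j\<in>{s..Suc k}. (if s \<le> j then gc (j - s) w else 0) * w i ^ j)"
        using s by (intro sum.cong) auto
      also have "\<dots> = (\<Sum>j\<le>Suc k. (if s \<le> j then gc (j - s) w else 0) * w i ^ j)"
        by (intro sum.mono_neutral_left) auto
      finally show ?thesis .
    qed
    have "?q1 w = (\<Sum>j\<le>k. d j w * w i ^ j)" for w
    proof -
      have "?q1 w = ?a w * (\<Sum>j\<le>Suc k. c j w * w i ^ j)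
          - c (Suc k) w * (\<Sum>j\<le>Suc k. (if s \<le> j then gc (j - s) w else 0) * w i ^ j)"
        by (simp only: c(2) mult.assoc sg)
      also have "\<dots> = (\<Sum>j\<le>Suc k. d j w * w i ^ j)"
        unfolding d_def by (simp only: sum_distrib_left left_diff_distrib sum_subtractf mult.assoc)
      also have "\<dots> = (\<Sum>j\<le>k. d j w * w i ^ j)"
      proof -
        have "Suc k - s = m" "s \<le> Suc k" using s by auto
        then have "d (Suc k) w = 0" by (simp add: d_def mult.commute)
        then show ?thesis by simp
      qed
      finally show ?thesis .
    qed
    with dPF have "?q1 \<in> upoly J i k" unfolding upoly_def by blast
    from Suc.IH[OF this] obtain e u r where IH: "u \<in> upoly J i (k - m)" "r \<in> upoly J i (m - 1)"
      "\<And>w. ?a w ^ e * ?q1 w = ?g w * u w + r w" by blast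
    let ?u = "\<lambda>w. u w + (?a w ^ e * c (Suc k) w) * w i ^ s"
    have "u \<in> upoly J i s" using IH(1) by (rule upoly_mono) (simp add: s_def)
    moreover have "(\<lambda>w. (?a w ^ e * c (Suc k) w) * w i ^ s) \<in> upoly J i s"
      by (intro upoly_monom polynomial_functions.mult PF_power gc c)
    ultimately have "?u \<in> upoly J i (Suc k - m)" unfolding s_def[symmetric] by (rule upoly_add)
    moreover have "?a w ^ Suc e * q w = ?g w * ?u w + r w" for w
      using IH(3)[of w] by (simp add: algebra_simps)
    ultimately show ?thesis using IH(2) by blast
  qed
qed

lemma complex_polynomial_root:
  fixes c :: "nat \<Rightarrow> complex"
  assumes "m \<ge> 1" "c m \<noteq> 0"
  shows "\<exists>\<tau>. (\<Sum>j\<le>m. c j * \<tau> ^ j) = 0"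
proof -
  define P where "P = (\<Sum>j\<le>m. monom (c j) j)"
  have P: "poly P \<tau> = (\<Sum>j\<le>m. c j * \<tau> ^ j)" for \<tau>
    by (simp add: P_def poly_sum poly_monom)
  have "coeff P m = c m" by (simp add: P_def coeff_sum)
  then have "degree P \<ge> m" using assms(2) by (intro le_degree) simp
  then have "\<not> constant (poly P)" using assms(1) by (simp add: constant_degree)
  from fundamental_theorem_of_algebra[OF this] show ?thesis by (simp add: P)
qed

text \<open>Holding for every \<open>l\<close>, this says that coordinate \<open>i\<close> is
  transcendental over those in \<open>J\<close> on \<open>E\<close>; otherwise the least
  \<open>l\<close> where it fails is the degree of a minimal relation.\<close>

definition no_relation :: "'i set \<Rightarrow> ('i \<Rightarrow> complex) set \<Rightarrow> 'i \<Rightarrow> nat \<Rightarrow> bool" where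
  "no_relation J E i l \<longleftrightarrow> (\<forall>c. (\<forall>j. c j \<in> PF (coords J)) \<longrightarrow>
      (\<forall>x\<in>E. (\<Sum>j\<le>l. c j x * x i ^ j) = 0) \<longrightarrow> (\<forall>x\<in>E. c l x = 0))"

lemma upoly_coeffs_vanish:
  assumes "\<And>l. l \<le> m \<Longrightarrow> no_relation J E i l"
    and "\<forall>j. c j \<in> PF (coords J)" "\<forall>x\<in>E. (\<Sum>j\<le>m. c j x * x i ^ j) = 0"
    and "j \<le> m" "x \<in> E"
  shows "c j x = 0"
  using assms
proof (induction m)
  case 0
  then show ?case by simp
next
  case (Suc m)
  have top: "\<forall>x\<in>E. c (Suc m) x = 0"
    using Suc.prems(1)[of "Suc m"] Suc.prems(2,3) unfolding no_relation_def by blast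
  show ?case
  proof (cases "j = Suc m")
    case True
    then show ?thesis using top Suc.prems(5) by simp
  next
    case False
    show ?thesis
    proof (rule Suc.IH)
      show "no_relation J E i l" if "l \<le> m" for l
        using Suc.prems(1) that by simp
      show "\<forall>x\<in>E. (\<Sum>j\<le>m. c j x * x i ^ j) = 0"
        using Suc.prems(3) top by simp
    qed (use False Suc.prems in auto)
  qed
qed

text \<open>If no degree up to \<open>m\<close> carries a relation, all coefficients of
  \<open>r\<close> vanish on \<open>E\<close> and therefore on the closure. They do not involve
  coordinate \<open>i\<close>, so its value can be replaced freely.\<close>

lemma upoly_vanish_on_closure:
  assumes i: "i \<notin> J" and lead: "\<And>l. l \<le> m \<Longrightarrow> no_relation J E i l"
    and r: "r \<in> upoly J i m" "\<forall>x\<in>E. r x = 0"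
    and w: "w \<in> E \<or> w \<in> zariski_closure J E"
  shows "r (w(i := \<tau>)) = 0"
proof -
  obtain c where c: "\<forall>j. c j \<in> PF (coords J)" "\<And>w. r w = (\<Sum>j\<le>m. c j w * w i ^ j)"
    using r(1) unfolding upoly_def by blast
  have "\<forall>x\<in>E. (\<Sum>j\<le>m. c j x * x i ^ j) = 0" using r(2) by (simp add: c(2))
  from upoly_coeffs_vanish[OF lead c(1) this] have "\<forall>x\<in>E. c j x = 0" if "j \<le> m" for j
    using that by blast
  then have "c j w = 0" if "j \<le> m" for j
    using that w c(1) unfolding zariski_closure_def by blast
  then show ?thesis using PF_coords_upd[OF c(1)[rule_format] i] by (simp add: c(2))
qed

text \<open>
  Extending a point of the closure by one coordinate: if the new coordinate is algebraic over the
  old ones, a relation \<open>p\<close> of minimal degree generates all relations up to a power of its leading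
  coefficient, and a Bezout relation between \<open>p\<close> and \<open>v\<close> keeps \<open>v\<close> away from \<open>0\<close>.
\<close>

lemma closure_extend_coordinate:
  assumes dom: "domain_on (coords UNIV) E" and i: "i \<notin> J"
    and v: "v \<in> PF (coords (insert i J))" "\<not> (\<forall>x\<in>E. v x = 0)"
  shows "\<exists>s\<in>PF (coords J). \<not> (\<forall>x\<in>E. s x = 0) \<and>
    (\<forall>w\<in>zariski_closure J E. s w \<noteq> 0 \<longrightarrow>
      (\<exists>\<tau>. w(i := \<tau>) \<in> zariski_closure (insert i J) E \<and> v (w(i := \<tau>)) \<noteq> 0))"
proof -
  obtain mv where mv: "v \<in> upoly J i mv" using PF_upoly[OF v(1)] by blast
  have UNIVI: "p \<in> PF (coords UNIV)" if "p \<in> PF (coords K)" for p and K :: "'a set"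
    using that coords_mono[of K UNIV] by blast
  note prod0 = domain_onD[OF dom UNIVI UNIVI]
  show ?thesis
  proof (cases "\<forall>l. no_relation J E i l")
    case True
    \<comment> \<open>Transcendental case: every value \<tau> stays in the closure. Only
      \<open>v\<close> restricts it, and a coefficient of \<open>v\<close> that is not identically
      zero on \<open>E\<close> serves as \<open>s\<close>.\<close>
    then have nolead: "no_relation J E i l" for l by blast
    obtain c where c: "\<And>j. c j \<in> PF (coords J)" "\<And>w. v w = (\<Sum>j\<le>mv. c j w * w i ^ j)"
      using mv unfolding upoly_def by blast
    have "\<exists>j\<le>mv. \<not> (\<forall>x\<in>E. c j x = 0)"
    proof (rule ccontr)
      assume "\<not> ?thesis"
      then have "v x = 0" if "x \<in> E" for x using that by (simp add: c(2))
      with v(2) show False by blast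
    qed
    then obtain j where j: "j \<le> mv" "\<not> (\<forall>x\<in>E. c j x = 0)" by blast
    show ?thesis
    proof (intro bexI[of _ "c j"] conjI ballI impI)
      fix w assume w: "w \<in> zariski_closure J E" "c j w \<noteq> 0"
      obtain \<tau> where \<tau>: "(\<Sum>l\<le>mv. c l w * \<tau> ^ l) \<noteq> 0"
        using polyfun_eq_0[of "\<lambda>l. c l w" mv] j(1) w(2) by blast
      have "q (w(i := \<tau>)) = 0" if q: "q \<in> PF (coords (insert i J))" "\<forall>x\<in>E. q x = 0" for q
      proof -
        obtain m where "q \<in> upoly J i m" using PF_upoly[OF q(1)] by blast
        then show ?thesis
          by (rule upoly_vanish_on_closure[OF i nolead]) (use q(2) w(1) in auto)
      qed
      moreover have "v (w(i := \<tau>)) \<noteq> 0"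
        using \<tau> PF_coords_upd[OF c(1) i] by (simp add: c(2))
      ultimately show "\<exists>\<tau>. w(i := \<tau>) \<in> zariski_closure (insert i J) E \<and> v (w(i := \<tau>)) \<noteq> 0"
        unfolding zariski_closure_def by blast
    qed (use c j in auto)
  next
    case False
    \<comment> \<open>Algebraic case, with a relation of least degree \<open>m\<close>: whatever
      vanishes on \<open>E\<close> and has smaller degree vanishes coefficient by
      coefficient.\<close>
    define m where "m = (LEAST l. \<not> no_relation J E i l)"
    have "\<not> no_relation J E i m"
      unfolding m_def by (rule LeastI_ex[of "\<lambda>l. \<not> no_relation J E i l"]) (use False in simp)
    then have "\<exists>c. (\<forall>j. c j \<in> PF (coords J)) \<and> (\<forall>x\<in>E. (\<Sum>j\<le>m. c j x * x i ^ j) = 0) \<and> \<not> (\<forall>x\<in>E. c m x = 0)"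
      unfolding no_relation_def by simp
    then obtain pc where pc: "\<And>j. pc j \<in> PF (coords J)" "\<And>x. x \<in> E \<Longrightarrow> (\<Sum>j\<le>m. pc j x * x i ^ j) = 0"
      "\<not> (\<forall>x\<in>E. pc m x = 0)" by blast
    have nolead: "no_relation J E i l" if "l < m" for l
      using that not_less_Least[of l "\<lambda>l. \<not> no_relation J E i l"] unfolding m_def by blast
    have m1: "m \<ge> 1"
    proof (rule ccontr)
      assume "\<not> m \<ge> 1"
      then have "m = 0" by simp
      then have "\<forall>x\<in>E. pc m x = 0" using pc(2) by simp
      with pc(3) show False by simp
    qed
    define p where "p w = (\<Sum>j\<le>m. pc j w * w i ^ j)" for w
    have p: "p \<in> upoly J i m" unfolding upoly_def p_def using pc(1) by blast
    have small: "r (w(i := \<tau>)) = 0" if "r \<in> upoly J i l" "l < m" "\<forall>x\<in>E. r x = 0"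
      "w \<in> E \<or> w \<in> zariski_closure J E" for r l w \<tau>
      by (rule upoly_vanish_on_closure[OF i nolead that(1,3,4)]) (use that(2) in auto)
    \<comment> \<open>The multiples of \<open>v\<close> that agree on \<open>E\<close> with a
      polynomial of degree at most \<open>l\<close> in coordinate \<open>i\<close> and are not zero
      there. The least such degree \<open>L\<close> plays the part of the degree of a gcd of
      \<open>p\<close> and \<open>v\<close>; the aim is L = 0.\<close>
    define bez where "bez l gc B \<longleftrightarrow> (\<forall>j. gc j \<in> PF (coords J)) \<and> B \<in> PF (coords (insert i J)) \<and>
      \<not> (\<forall>x\<in>E. (\<Sum>j\<le>l. gc j x * x i ^ j) = 0) \<and> (\<forall>x\<in>E. (\<Sum>j\<le>l. gc j x * x i ^ j) = B x * v x)"
      for l and gc :: "nat \<Rightarrow> ('a \<Rightarrow> complex) \<Rightarrow> complex" and B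
    have bezI: "\<exists>gc B. bez l gc B" if r: "r \<in> upoly J i l" and B: "B \<in> PF (coords (insert i J))"
      and nv: "\<not> (\<forall>x\<in>E. r x = 0)" and eq: "\<And>x. x \<in> E \<Longrightarrow> r x = B x * v x" for l r B
    proof -
      obtain c where c: "\<And>j. c j \<in> PF (coords J)" "\<And>w. r w = (\<Sum>j\<le>l. c j w * w i ^ j)"
        using r unfolding upoly_def by blast
      then have "bez l c B" unfolding bez_def using B nv eq by simp
      then show ?thesis by blast
    qed
    define L where "L = (LEAST l. \<exists>gc B. bez l gc B)"
    have "\<exists>l gc B. bez l gc B"
      using bezI[OF mv, of "\<lambda>_. 1"] v(2) by (auto intro: polynomial_functions.const)
    then have "\<exists>gc B. bez L gc B" unfolding L_def by (rule LeastI_ex)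
    then obtain gc B where "bez L gc B" by blast
    then have gc: "\<And>j. gc j \<in> PF (coords J)" and B: "B \<in> PF (coords (insert i J))"
      and gnv: "\<not> (\<forall>x\<in>E. (\<Sum>j\<le>L. gc j x * x i ^ j) = 0)"
      and geq: "\<And>x. x \<in> E \<Longrightarrow> (\<Sum>j\<le>L. gc j x * x i ^ j) = B x * v x"
      unfolding bez_def by blast+
    have Lmin: "L \<le> l" if "bez l gc B" for l gc B
      unfolding L_def by (rule Least_le) (use that in blast)
    have L0: "L = 0"
    proof (rule ccontr)
      assume "L \<noteq> 0"
      then have L1: "L \<ge> 1" by simp
      have lc: "\<not> (\<forall>x\<in>E. gc L x = 0)"
      proof
        assume z: "\<forall>x\<in>E. gc L x = 0"
        have eq: "(\<Sum>j\<le>L - 1. gc j x * x i ^ j) = (\<Sum>j\<le>L. gc j x * x i ^ j)" if "x \<in> E" for x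
        proof -
          obtain L' where "L = Suc L'" using L1 by (cases L) auto
          then show ?thesis using z that by simp
        qed
        have "bez (L - 1) gc B" unfolding bez_def using gc B gnv geq eq by simp
        from Lmin[OF this] L1 show False by simp
      qed
      have Lm: "L < m"
      proof -
        \<comment> \<open>The remainder of \<open>v\<close> modulo \<open>p\<close> is a multiple of
          \<open>v\<close> on \<open>E\<close> of degree below \<open>m\<close>.\<close>
        obtain e u r where eur: "r \<in> upoly J i (m - 1)" "\<And>w. pc m w ^ e * v w = p w * u w + r w"
          using upoly_pseudo_division[where gc = pc, OF m1 pc(1) mv] unfolding p_def by blast
        have r: "r x = pc m x ^ e * v x" if "x \<in> E" for x
          using eur(2)[of x] pc(2)[OF that] by (simp add: p_def)
        have PFe: "(\<lambda>w. pc m w ^ e) \<in> PF (coords J)" by (intro PF_power pc)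
        then have "(\<lambda>w. pc m w ^ e) \<in> PF (coords (insert i J))" using coords_mono[of J "insert i J"] by blast
        moreover have "\<not> (\<forall>x\<in>E. r x = 0)"
        proof
          assume "\<forall>x\<in>E. r x = 0"
          then have "\<forall>x\<in>E. v x = 0"
            by (intro prod0[OF PFe v(1)]) (use r pc(3) in auto)
          with v(2) show False by simp
        qed
        ultimately have "\<exists>gc B. bez (m - 1) gc B" using bezI[OF eur(1)] r by blast
        then have "L \<le> m - 1" using Lmin by blast
        then show ?thesis using m1 by simp
      qed
      define g where "g w = (\<Sum>j\<le>L. gc j w * w i ^ j)" for w
      \<comment> \<open>Euclid's step: the remainder of \<open>p\<close> modulo \<open>g\<close> is
        again a multiple of \<open>v\<close> on \<open>E\<close>, of degree below \<open>L\<close>,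
        so minimality makes it zero on \<open>E\<close>. As \<open>p\<close> vanishes on
        \<open>E\<close> too, so does the quotient \<open>u\<close>.\<close>
      obtain e u r where eur: "u \<in> upoly J i (m - L)" "r \<in> upoly J i (L - 1)"
        "\<And>w. gc L w ^ e * p w = g w * u w + r w"
        using upoly_pseudo_division[where gc = gc, OF L1 gc p] unfolding g_def by blast
      have g: "g \<in> upoly J i L" unfolding upoly_def g_def using gc by blast
      have gu: "g x * u x + r x = 0" if "x \<in> E" for x
        using eur(3)[of x] pc(2)[OF that] by (simp add: p_def)
      have r0: "\<forall>x\<in>E. r x = 0"
      proof (rule ccontr)
        assume nv: "\<not> ?thesis"
        have "(\<lambda>x. -1 * (B x * u x)) \<in> PF (coords (insert i J))"
          by (intro PF_cmult polynomial_functions.mult B upoly_PF[OF eur(1)])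
        moreover have "r x = - 1 * (B x * u x) * v x" if "x \<in> E" for x
        proof -
          have "r x = - (g x * u x)" using gu[OF that] by (simp add: eq_neg_iff_add_eq_0 add.commute)
          also have "g x = B x * v x" using geq[OF that] by (simp add: g_def)
          finally show ?thesis by simp
        qed
        ultimately have "\<exists>gc B. bez (L - 1) gc B" using bezI[OF eur(2) _ nv] by blast
        then have "L \<le> L - 1" using Lmin by blast
        then show False using L1 by simp
      qed
      have u0: "\<forall>x\<in>E. u x = 0"
        by (rule prod0[OF upoly_PF[OF g] upoly_PF[OF eur(1)]]) (use gu r0 gnv in \<open>auto simp: g_def\<close>)
      \<comment> \<open>Both \<open>u\<close> and \<open>r\<close> have degree below
        \<open>m\<close>, so they vanish on the whole line through \<open>x\<close> in direction
        \<open>i\<close>. Hence so does \<open>gc L ^ e * p\<close>, and its leading coefficient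
        must be 0.\<close>
      have "gc L x ^ e * pc m x = 0" if x: "x \<in> E" for x
      proof -
        have "(\<Sum>j\<le>m. (gc L x ^ e * pc j x) * \<tau> ^ j) = 0" for \<tau>
        proof -
          let ?w = "x(i := \<tau>)"
          have "u ?w = 0" by (rule small[OF eur(1)]) (use Lm L1 u0 x in auto)
          moreover have "r ?w = 0" by (rule small[OF eur(2)]) (use Lm L1 r0 x in auto)
          ultimately have "gc L ?w ^ e * p ?w = 0" using eur(3) by simp
          then show ?thesis unfolding p_def
            using PF_coords_upd[OF gc i] PF_coords_upd[OF pc(1) i] by (simp add: mult.assoc flip: sum_distrib_left)
        qed
        then show ?thesis using polyfun_eq_0[of "\<lambda>j. gc L x ^ e * pc j x" m] by blast
      qed
      then have "\<forall>x\<in>E. pc m x = 0"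
        by (intro prod0[OF PF_power[OF gc] pc(1)]) (use lc in auto)
      with pc(3) show False by simp
    qed
    define c where "c = gc 0"
    have c: "c \<in> PF (coords J)" "\<not> (\<forall>x\<in>E. c x = 0)" "\<And>x. x \<in> E \<Longrightarrow> c x = B x * v x"
      using gc gnv geq unfolding L0 by (auto simp: c_def)
    \<comment> \<open>In the witness, the factor \<open>pc m\<close> provides a root \<tau> and lets
      division by \<open>p\<close> be undone at the new point, while \<open>c\<close>, a multiple of
      \<open>v\<close> on \<open>E\<close>, keeps \<open>v\<close> from vanishing there.\<close>
    show ?thesis
    proof (intro bexI[of _ "\<lambda>w. pc m w * c w"] conjI ballI impI)
      show "(\<lambda>w. pc m w * c w) \<in> PF (coords J)" by (intro polynomial_functions.mult pc c)
      show "\<not> (\<forall>x\<in>E. pc m x * c x = 0)"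
      proof
        assume "\<forall>x\<in>E. pc m x * c x = 0"
        then have "\<forall>x\<in>E. c x = 0" by (intro prod0[OF pc(1) c(1)]) (use pc(3) in auto)
        with c(2) show False by simp
      qed
      fix w assume w: "w \<in> zariski_closure J E" "pc m w * c w \<noteq> 0"
      obtain \<tau> where \<tau>: "(\<Sum>j\<le>m. pc j w * \<tau> ^ j) = 0"
        using complex_polynomial_root[OF m1, of "\<lambda>j. pc j w"] w(2) by auto
      let ?w = "w(i := \<tau>)"
      have pw: "p ?w = 0" unfolding p_def using \<tau> PF_coords_upd[OF pc(1) i] by simp
      have cl: "q ?w = 0" if q: "q \<in> PF (coords (insert i J))" "\<forall>x\<in>E. q x = 0" for q
      proof -
        obtain mq where mq: "q \<in> upoly J i mq" using PF_upoly[OF q(1)] by blast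
        obtain e u r where eur: "r \<in> upoly J i (m - 1)" "\<And>w. pc m w ^ e * q w = p w * u w + r w"
          using upoly_pseudo_division[where gc = pc, OF m1 pc(1) mq] unfolding p_def by blast
        have "\<forall>x\<in>E. r x = 0"
        proof
          fix x assume "x \<in> E"
          then show "r x = 0" using eur(2)[of x] pc(2) q(2) by (simp add: p_def)
        qed
        then have "r ?w = 0" by (intro small[OF eur(1)]) (use m1 w in auto)
        then have "pc m ?w ^ e * q ?w = 0" using eur(2)[of ?w] pw by simp
        then show ?thesis using PF_coords_upd[OF pc(1) i] w(2) by simp
      qed
      have "(\<lambda>x. c x - B x * v x) \<in> PF (coords (insert i J))"
        using c(1) coords_mono[of J "insert i J"] B v(1) by (intro PF_diff polynomial_functions.mult) auto
      from cl[OF this] have "c ?w - B ?w * v ?w = 0" using c(3) by simp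
      then have "v ?w \<noteq> 0" using PF_coords_upd[OF c(1) i] w(2) by auto
      then show "\<exists>\<tau>. w(i := \<tau>) \<in> zariski_closure (insert i J) E \<and> v (w(i := \<tau>)) \<noteq> 0"
        using cl unfolding zariski_closure_def by blast
    qed
  qed
qed

text \<open>Chevalley's theorem for a projection, in the form needed: an open part of the closure of
  the image lifts to the closure of \<open>E\<close>. The condition \<open>v\<close> is arbitrary
  because the one found for the last coordinate becomes the condition to be respected when lifting
  the preceding ones.\<close>

lemma closure_extend_coordinates:
  assumes dom: "domain_on (coords UNIV) E" and K: "finite K" "J \<inter> K = {}"
    and v: "v \<in> PF (coords (J \<union> K))" "\<not> (\<forall>x\<in>E. v x = 0)"
  shows "\<exists>s\<in>PF (coords J). \<not> (\<forall>x\<in>E. s x = 0) \<and>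
    (\<forall>w\<in>zariski_closure J E. s w \<noteq> 0 \<longrightarrow>
      (\<exists>w'\<in>zariski_closure (J \<union> K) E. (\<forall>j\<in>J. w' j = w j) \<and> v w' \<noteq> 0))"
  using K v
proof (induction K arbitrary: v rule: finite_induct)
  case empty
  then show ?case by (intro bexI[of _ v]) auto
next
  case (insert i K)
  have i: "i \<notin> J \<union> K" using insert.prems(1) insert.hyps(2) by blast
  have v: "v \<in> PF (coords (insert i (J \<union> K)))" using insert.prems(2) by simp
  obtain s' where s': "s' \<in> PF (coords (J \<union> K))" "\<not> (\<forall>x\<in>E. s' x = 0)"
    "\<And>w. w \<in> zariski_closure (J \<union> K) E \<Longrightarrow> s' w \<noteq> 0 \<Longrightarrow>
      \<exists>\<tau>. w(i := \<tau>) \<in> zariski_closure (insert i (J \<union> K)) E \<and> v (w(i := \<tau>)) \<noteq> 0"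
    using closure_extend_coordinate[OF dom i v insert.prems(3)] by blast
  have "J \<inter> K = {}" using insert.prems(1) by blast
  from insert.IH[OF this s'(1,2)] obtain s where s: "s \<in> PF (coords J)" "\<not> (\<forall>x\<in>E. s x = 0)"
    "\<And>w. w \<in> zariski_closure J E \<Longrightarrow> s w \<noteq> 0 \<Longrightarrow>
      \<exists>w'\<in>zariski_closure (J \<union> K) E. (\<forall>j\<in>J. w' j = w j) \<and> s' w' \<noteq> 0" by blast
  show ?case
  proof (intro bexI[of _ s] conjI ballI impI)
    fix w assume "w \<in> zariski_closure J E" "s w \<noteq> 0"
    from s(3)[OF this] obtain w' where w': "w' \<in> zariski_closure (J \<union> K) E" "\<forall>j\<in>J. w' j = w j" "s' w' \<noteq> 0"
      by blast
    obtain \<tau> where \<tau>: "w'(i := \<tau>) \<in> zariski_closure (insert i (J \<union> K)) E" "v (w'(i := \<tau>)) \<noteq> 0"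
      using s'(3)[OF w'(1,3)] by blast
    show "\<exists>w'\<in>zariski_closure (J \<union> insert i K) E. (\<forall>j\<in>J. w' j = w j) \<and> v w' \<noteq> 0"
      using \<tau> w'(2) i by (intro bexI[of _ "w'(i := \<tau>)"]) auto
  qed (use s in auto)
qed

subsection \<open>Forms and their coefficients\<close>

lemma finite_monomials_of_degree: "finite (monomials_of_degree n m)"
proof -
  let ?r = "\<lambda>\<alpha>. restrict (Poly_Mapping.lookup \<alpha>) {0..n}"
  have "?r ` monomials_of_degree n m \<subseteq> {0..n} \<rightarrow>\<^sub>E {..m}"
  proof
    fix h assume "h \<in> ?r ` monomials_of_degree n m"
    then obtain \<alpha> where \<alpha>: "(\<Sum>i=0..n. Poly_Mapping.lookup \<alpha> i) = m" "h = ?r \<alpha>"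
      by (auto simp: monomials_of_degree_def)
    have "Poly_Mapping.lookup \<alpha> i \<le> m" if "i \<in> {0..n}" for i
      unfolding \<alpha>(1)[symmetric] by (rule member_le_sum) (use that in auto)
    then show "h \<in> {0..n} \<rightarrow>\<^sub>E {..m}" unfolding \<alpha>(2) by (simp add: restrict_PiE_iff)
  qed
  moreover have "finite ({0..n} \<rightarrow>\<^sub>E {..m})" by (intro finite_PiE) auto
  ultimately have "finite (?r ` monomials_of_degree n m)" by (rule finite_subset)
  moreover have "inj_on ?r (monomials_of_degree n m)"
  proof (rule inj_onI, rule poly_mapping_eqI)
    fix \<alpha> \<beta> i
    assume ab: "\<alpha> \<in> monomials_of_degree n m" "\<beta> \<in> monomials_of_degree n m" "?r \<alpha> = ?r \<beta>"
    show "Poly_Mapping.lookup \<alpha> i = Poly_Mapping.lookup \<beta> i"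
    proof (cases "i \<in> {0..n}")
      case True
      then show ?thesis using fun_cong[OF ab(3), of i] by simp
    next
      case False
      then have "i \<notin> Poly_Mapping.keys \<alpha>" "i \<notin> Poly_Mapping.keys \<beta>"
        using ab(1,2) by (auto simp: monomials_of_degree_def)
      then show ?thesis by (simp add: in_keys_iff)
    qed
  qed
  ultimately show ?thesis by (rule finite_imageD)
qed

lemma monomials_of_degree_add:
  assumes "\<alpha> \<in> monomials_of_degree n a" "\<beta> \<in> monomials_of_degree n b"
  shows "\<alpha> + \<beta> \<in> monomials_of_degree n (a + b)"
  using assms Poly_Mapping.keys_add[of \<alpha> \<beta>]
  by (auto simp: monomials_of_degree_def lookup_add sum.distrib)

lemma Sym_iff: "f \<in> Sym n m \<longleftrightarrow> (\<forall>\<alpha>. \<alpha> \<notin> monomials_of_degree n m \<longrightarrow> Poly_Mapping.lookup f \<alpha> = 0)"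
  by (auto simp: Sym_def in_keys_iff)

lemma poly_mapping_sum_single:
  assumes "finite A" "Poly_Mapping.keys f \<subseteq> A"
  shows "f = (\<Sum>\<alpha>\<in>A. Poly_Mapping.single \<alpha> (Poly_Mapping.lookup f \<alpha>))"
proof (rule poly_mapping_eqI)
  fix \<beta>
  have "Poly_Mapping.lookup (\<Sum>\<alpha>\<in>A. Poly_Mapping.single \<alpha> (Poly_Mapping.lookup f \<alpha>)) \<beta>
      = (\<Sum>\<alpha>\<in>A. if \<alpha> = \<beta> then Poly_Mapping.lookup f \<alpha> else 0)"
    by (simp add: lookup_sum lookup_single when_def)
  also have "\<dots> = Poly_Mapping.lookup f \<beta>"
    using assms by (auto simp: sum.delta in_keys_iff)
  finally show "Poly_Mapping.lookup f \<beta> = Poly_Mapping.lookup (\<Sum>\<alpha>\<in>A. Poly_Mapping.single \<alpha> (Poly_Mapping.lookup f \<alpha>)) \<beta>"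
    by simp
qed

text \<open>The summation ranges may exceed the supports, so that all forms of one degree can be
  multiplied over the same index set.\<close>

lemma lookup_times:
  fixes f g :: cpoly
  assumes A: "finite A" "Poly_Mapping.keys f \<subseteq> A" and B: "finite B" "Poly_Mapping.keys g \<subseteq> B"
  shows "Poly_Mapping.lookup (f * g) \<tau> =
    (\<Sum>\<alpha>\<in>A. \<Sum>\<beta>\<in>B. if \<alpha> + \<beta> = \<tau> then Poly_Mapping.lookup f \<alpha> * Poly_Mapping.lookup g \<beta> else 0)"
proof -
  have "f * g = (\<Sum>\<alpha>\<in>A. Poly_Mapping.single \<alpha> (Poly_Mapping.lookup f \<alpha>)) *
      (\<Sum>\<beta>\<in>B. Poly_Mapping.single \<beta> (Poly_Mapping.lookup g \<beta>))"
    using poly_mapping_sum_single[OF A] poly_mapping_sum_single[OF B] by simp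
  also have "\<dots> = (\<Sum>\<alpha>\<in>A. \<Sum>\<beta>\<in>B. Poly_Mapping.single (\<alpha> + \<beta>) (Poly_Mapping.lookup f \<alpha> * Poly_Mapping.lookup g \<beta>))"
    by (simp add: sum_product mult_single)
  finally show ?thesis by (simp add: lookup_sum lookup_single when_def)
qed

lemma Sym_add: "f \<in> Sym n m \<Longrightarrow> g \<in> Sym n m \<Longrightarrow> f + g \<in> Sym n m"
  by (simp add: Sym_iff lookup_add)

lemma Sym_sum: "(\<And>i. i \<in> A \<Longrightarrow> f i \<in> Sym n m) \<Longrightarrow> (\<Sum>i\<in>A. f i) \<in> Sym n m"
  by (simp add: Sym_iff lookup_sum)

lemma Sym_times:
  assumes "f \<in> Sym n a" "g \<in> Sym n b"
  shows "f * g \<in> Sym n (a + b)"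
  unfolding Sym_iff
proof (intro allI impI)
  fix \<tau> assume "\<tau> \<notin> monomials_of_degree n (a + b)"
  then have "\<alpha> + \<beta> \<noteq> \<tau>" if "\<alpha> \<in> monomials_of_degree n a" "\<beta> \<in> monomials_of_degree n b" for \<alpha> \<beta>
    using monomials_of_degree_add[OF that] by blast
  then show "Poly_Mapping.lookup (f * g) \<tau> = 0"
    using lookup_times[OF finite_monomials_of_degree _ finite_monomials_of_degree, of f n a g n b \<tau>] assms
    by (simp add: Sym_def)
qed

text \<open>Scalars act as constant polynomials, which makes identities with scalars accessible to
  the ring laws.\<close>

definition scale_form :: "complex \<Rightarrow> cpoly \<Rightarrow> cpoly" where
  "scale_form a f = Poly_Mapping.single 0 a * f"

lemma lookup_scale_form [simp]: "Poly_Mapping.lookup (scale_form a f) \<alpha> = a * Poly_Mapping.lookup f \<alpha>"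
proof -
  have "Poly_Mapping.lookup (scale_form a f) \<alpha> = (\<Sum>\<gamma>\<in>{0}. \<Sum>\<beta>\<in>insert \<alpha> (Poly_Mapping.keys f).
      if \<gamma> + \<beta> = \<alpha> then Poly_Mapping.lookup (Poly_Mapping.single 0 a) \<gamma> * Poly_Mapping.lookup f \<beta> else 0)"
    unfolding scale_form_def by (rule lookup_times) auto
  then show ?thesis by (simp add: sum.delta)
qed

lemma Sym_scale_form: "f \<in> Sym n m \<Longrightarrow> scale_form a f \<in> Sym n m"
  by (simp add: Sym_iff)

lemma Sym_tuples_iff: "F \<in> Sym_tuples k n m \<longleftrightarrow> (\<forall>i\<in>{1..k}. F i \<in> Sym n m) \<and> (\<forall>i. i \<notin> {1..k} \<longrightarrow> F i = undefined)"
  by (auto simp: Sym_tuples_def PiE_iff extensional_def)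

definition tuple_coords :: "nat \<Rightarrow> nat \<Rightarrow> nat \<Rightarrow> ((nat \<Rightarrow> cpoly) \<Rightarrow> complex) set" where
  "tuple_coords k n m = {\<lambda>F. Poly_Mapping.lookup (F i) \<alpha> | i \<alpha>. i \<in> {1..k} \<and> \<alpha> \<in> monomials_of_degree n m}"

subsection \<open>Rotations\<close>

text \<open>A rotation in the plane of the entries \<open>p\<close> and \<open>Suc p\<close>. The
  angle is complex, so that the tuple depends on it by entire functions.\<close>

definition rotate_tuple :: "nat \<Rightarrow> complex \<Rightarrow> (nat \<Rightarrow> cpoly) \<Rightarrow> nat \<Rightarrow> cpoly" where
  "rotate_tuple p \<theta> G = G(p := scale_form (cos \<theta>) (G p) + scale_form (- sin \<theta>) (G (Suc p)),
     Suc p := scale_form (sin \<theta>) (G p) + scale_form (cos \<theta>) (G (Suc p)))"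

definition rotations :: "nat \<Rightarrow> (nat \<Rightarrow> cpoly) set \<Rightarrow> (nat \<Rightarrow> cpoly) set" where
  "rotations p S = {rotate_tuple p \<theta> G | \<theta> G. G \<in> S}"

lemma rotate_tuple_sum_squares:
  assumes "1 \<le> p" "p < k"
  shows "(\<Sum>i=1..k. (rotate_tuple p \<theta> G i)\<^sup>2) = (\<Sum>i=1..k. (G i)\<^sup>2)"
proof -
  define c s where "c = Poly_Mapping.single (0 :: nat \<Rightarrow>\<^sub>0 nat) (cos \<theta>)" and "s = Poly_Mapping.single (0 :: nat \<Rightarrow>\<^sub>0 nat) (sin \<theta>)"
  have cs: "c * c + s * s = 1"
  proof -
    have "cos \<theta> * cos \<theta> + sin \<theta> * sin \<theta> = 1" using sin_cos_squared_add[of \<theta>] by (simp add: power2_eq_square)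
    then show ?thesis by (simp add: c_def s_def mult_single flip: single_add)
  qed
  have ms: "Poly_Mapping.single 0 (- sin \<theta>) = - s" by (simp add: s_def single_uminus)
  let ?R = "rotate_tuple p \<theta> G"
  have split: "(\<Sum>i=1..k. (H i)\<^sup>2) = (H p)\<^sup>2 + (H (Suc p))\<^sup>2 + (\<Sum>i\<in>{1..k} - {p} - {Suc p}. (H i)\<^sup>2)"
    for H :: "nat \<Rightarrow> cpoly"
    using assms sum.remove[of "{1..k}" p "\<lambda>i. (H i)\<^sup>2"] sum.remove[of "{1..k} - {p}" "Suc p" "\<lambda>i. (H i)\<^sup>2"]
    by (simp add: add.assoc)
  have "(\<Sum>i\<in>{1..k} - {p} - {Suc p}. (?R i)\<^sup>2) = (\<Sum>i\<in>{1..k} - {p} - {Suc p}. (G i)\<^sup>2)"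
    by (rule sum.cong) (auto simp: rotate_tuple_def)
  moreover have "(?R p)\<^sup>2 + (?R (Suc p))\<^sup>2 = (G p)\<^sup>2 + (G (Suc p))\<^sup>2"
  proof -
    have "(?R p)\<^sup>2 + (?R (Suc p))\<^sup>2 = (c * G p + (- s) * G (Suc p))\<^sup>2 + (s * G p + c * G (Suc p))\<^sup>2"
      by (simp add: rotate_tuple_def scale_form_def ms c_def s_def)
    also have "\<dots> = (c * c + s * s) * ((G p)\<^sup>2 + (G (Suc p))\<^sup>2)"
      by (simp add: power2_eq_square algebra_simps)
    finally show ?thesis by (simp add: cs)
  qed
  ultimately show ?thesis by (simp only: split)
qed

lemma rotate_tuple_decomposition:
  assumes "1 \<le> p" "p < k" "G \<in> SOS_decompositions n d k f"
  shows "rotate_tuple p \<theta> G \<in> SOS_decompositions n d k f"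
proof -
  have "rotate_tuple p \<theta> G \<in> Sym_tuples k n d"
    using assms by (auto simp: SOS_decompositions_def Sym_tuples_iff rotate_tuple_def intro!: Sym_add Sym_scale_form)
  then show ?thesis using assms by (simp add: SOS_decompositions_def rotate_tuple_sum_squares del: One_nat_def)
qed

lemma rotate_tuple_0 [simp]: "rotate_tuple p 0 G = G"
  by (auto simp: rotate_tuple_def fun_eq_iff intro!: poly_mapping_eqI simp: lookup_add)

lemma rotations_superset: "S \<subseteq> rotations p S"
  unfolding rotations_def using rotate_tuple_0 by (metis (mono_tags, lifting) mem_Collect_eq subsetI)

text \<open>The angle moves affinely while the base point follows its own curve; the composite is
  entire because sine and cosine are.\<close>

lemma entire_connected_rotations:
  assumes S: "entire_connected (tuple_coords k n d) S" and p: "1 \<le> p" "p < k"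
  shows "entire_connected (tuple_coords k n d) (rotations p S)"
  unfolding entire_connected_def
proof (intro ballI)
  fix x y assume "x \<in> rotations p S" "y \<in> rotations p S"
  then obtain \<theta> \<theta>' G G' where G: "G \<in> S" "G' \<in> S" and xy: "x = rotate_tuple p \<theta> G" "y = rotate_tuple p \<theta>' G'"
    unfolding rotations_def by blast
  obtain \<phi> where \<phi>: "\<phi> 0 = G" "\<phi> 1 = G'" "range \<phi> \<subseteq> S"
    "\<forall>c\<in>tuple_coords k n d. (\<lambda>t. c (\<phi> t)) holomorphic_on UNIV"
    using S[unfolded entire_connected_def, rule_format, OF G] by blast
  have hol: "(\<lambda>t. Poly_Mapping.lookup (\<phi> t i) \<alpha>) holomorphic_on UNIV"
    if "i \<in> {1..k}" "\<alpha> \<in> monomials_of_degree n d" for i \<alpha>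
  proof -
    have "(\<lambda>F. Poly_Mapping.lookup (F i) \<alpha>) \<in> tuple_coords k n d"
      using that unfolding tuple_coords_def by blast
    from \<phi>(4)[rule_format, OF this] show ?thesis .
  qed
  define \<psi> where "\<psi> t = rotate_tuple p (\<theta> + t * (\<theta>' - \<theta>)) (\<phi> t)" for t
  have "(\<lambda>t. c (\<psi> t)) holomorphic_on UNIV" if c: "c \<in> tuple_coords k n d" for c
  proof -
    obtain i \<alpha> where i: "i \<in> {1..k}" "\<alpha> \<in> monomials_of_degree n d" "c = (\<lambda>F. Poly_Mapping.lookup (F i) \<alpha>)"
      using c unfolding tuple_coords_def by blast
    have "p \<in> {1..k}" "Suc p \<in> {1..k}" using p by auto
    then show ?thesis using i(1,2) unfolding i(3) \<psi>_def rotate_tuple_def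
      by (cases "i = p"; cases "i = Suc p") (auto simp: lookup_add intro!: holomorphic_intros hol)
  qed
  moreover have "range \<psi> \<subseteq> rotations p S"
    using \<phi>(3) unfolding \<psi>_def rotations_def by blast
  moreover have "\<psi> 0 = x" "\<psi> 1 = y" by (auto simp: \<psi>_def \<phi> xy)
  ultimately show "\<exists>\<phi>. \<phi> 0 = x \<and> \<phi> 1 = y \<and> range \<phi> \<subseteq> rotations p S \<and>
      (\<forall>c\<in>tuple_coords k n d. (\<lambda>t. c (\<phi> t)) holomorphic_on UNIV)" by blast
qed

section \<open>Linear functionals on forms and chains of rotated sets\<close>

definition dual_form :: "nat \<Rightarrow> nat \<Rightarrow> ((nat \<Rightarrow>\<^sub>0 nat) \<Rightarrow> complex) \<Rightarrow> cpoly \<Rightarrow> complex" where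
  "dual_form n d a f = (\<Sum>\<alpha>\<in>monomials_of_degree n d. a \<alpha> * Poly_Mapping.lookup f \<alpha>)"

lemma dual_form_add: "dual_form n d a (f + g) = dual_form n d a f + dual_form n d a g"
  by (simp add: dual_form_def lookup_add distrib_left sum.distrib)

lemma dual_form_scale_form: "dual_form n d a (scale_form b f) = b * dual_form n d a f"
  by (simp add: dual_form_def sum_distrib_left mult.left_commute)

lemma dual_form_PF: "i \<in> {1..k} \<Longrightarrow> (\<lambda>F. dual_form n d a (F i)) \<in> PF (tuple_coords k n d)"
  unfolding dual_form_def
  by (intro PF_sum PF_cmult polynomial_functions.coord) (auto simp: tuple_coords_def)

text \<open>The conditions on \<open>a c\<close> guarantee that the closure grows strictly: this
  functional vanishes on entry \<open>p\<close> throughout \<open>S\<close>, hence on the closure of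
  \<open>S\<close>, while a rotation brings a nonzero value from entry \<open>Suc p\<close> into
  entry \<open>p\<close>.\<close>

inductive rotation_chain ::
  "nat \<Rightarrow> nat \<Rightarrow> nat \<Rightarrow> (nat \<Rightarrow> (nat \<Rightarrow>\<^sub>0 nat) \<Rightarrow> complex) \<Rightarrow> (nat \<Rightarrow> cpoly) \<Rightarrow> nat \<Rightarrow> (nat \<Rightarrow> cpoly) set \<Rightarrow> bool"
  for n d k a F where
  base: "rotation_chain n d k a F 0 {F}"
| step: "rotation_chain n d k a F l S \<Longrightarrow> 1 \<le> p \<Longrightarrow> p < k \<Longrightarrow>
    (\<And>G. G \<in> S \<Longrightarrow> dual_form n d (a c) (G p) = 0) \<Longrightarrow> G \<in> S \<Longrightarrow> dual_form n d (a c) (G (Suc p)) \<noteq> 0 \<Longrightarrow>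
    rotation_chain n d k a F (Suc l) (rotations p S)"

lemma rotation_chain_subset:
  assumes "rotation_chain n d k a F l S" "F \<in> SOS_decompositions n d k f"
  shows "S \<subseteq> SOS_decompositions n d k f \<and> S \<noteq> {} \<and> entire_connected (tuple_coords k n d) S"
  using assms
proof (induction rule: rotation_chain.induct)
  case base
  have "entire_connected (tuple_coords k n d) {F}"
    unfolding entire_connected_def by (auto intro!: exI[of _ "\<lambda>_. F"])
  then show ?case using base by auto
next
  case (step l S p c G)
  then show ?case
    using entire_connected_rotations[of k n d S p] rotations_superset[of S p]
    by (auto simp: rotations_def intro!: rotate_tuple_decomposition)
qed

definition closure_in :: "('a \<Rightarrow> complex) set \<Rightarrow> 'a set \<Rightarrow> 'a set \<Rightarrow> 'a set" where
  "closure_in C Y S = zero_locus Y {p \<in> PF C. \<forall>x\<in>S. p x = 0}"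

lemma closure_in_subset: "S \<subseteq> Y \<Longrightarrow> S \<subseteq> closure_in C Y S"
  by (auto simp: closure_in_def zero_locus_def)

lemma closure_inD:
  assumes "x \<in> closure_in C Y S" "p \<in> PF C" "\<And>x. x \<in> S \<Longrightarrow> p x = 0"
  shows "p x = 0"
  using assms by (auto simp: closure_in_def zero_locus_def)

lemma closedin_closure_in: "closedin (zariski C Y) (closure_in C Y S)"
  unfolding closedin_zariski closure_in_def
  by (rule exI[of _ "{p \<in> PF C. \<forall>x\<in>S. p x = 0}"]) simp

lemma closure_in_mono: "S \<subseteq> T \<Longrightarrow> closure_in C Y S \<subseteq> closure_in C Y T"
  by (auto simp: closure_in_def zero_locus_def)

lemma irreducible_closure_in:
  assumes "S \<subseteq> Y" "S \<noteq> {}" "entire_connected C S"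
  shows "irreducible_space (subtopology (zariski C Y) (closure_in C Y S))"
proof -
  have Y: "closure_in C Y S \<subseteq> Y" by (auto simp: closure_in_def zero_locus_def)
  have "domain_on C (closure_in C Y S)"
    by (rule domain_on_closure[OF entire_connected_domain_on[OF assms(3)] closure_in_subset[OF assms(1)]])
      (auto simp: closure_in_def zero_locus_def)
  then show ?thesis
    using closure_in_subset[OF assms(1), of C] assms(2)
    by (auto simp: subtopology_zariski[OF Y] irreducible_zariski_iff)
qed

lemma rotation_chain_irreducible_chain:
  assumes "rotation_chain n d k a F l S" "F \<in> SOS_decompositions n d k f"
  defines "C \<equiv> tuple_coords k n d" and "Y \<equiv> SOS_decompositions n d k f"
  shows "\<exists>Z. Z l = closure_in C Y S \<and>
    (\<forall>i\<le>l. closedin (zariski C Y) (Z i) \<and> irreducible_space (subtopology (zariski C Y) (Z i))) \<and>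
    (\<forall>i<l. Z i \<subset> Z (Suc i))"
  using assms(1)
proof (induction rule: rotation_chain.induct)
  case base
  have "irreducible_space (subtopology (zariski C Y) (closure_in C Y {F}))"
    using rotation_chain_subset[OF rotation_chain.base assms(2)] unfolding C_def Y_def
    by (intro irreducible_closure_in) blast+
  then show ?case by (intro exI[of _ "\<lambda>_. closure_in C Y {F}"]) (auto intro: closedin_closure_in)
next
  case (step l S p c G)
  then obtain Z where Z: "Z l = closure_in C Y S"
    "\<And>i. i \<le> l \<Longrightarrow> closedin (zariski C Y) (Z i) \<and> irreducible_space (subtopology (zariski C Y) (Z i))"
    "\<And>i. i < l \<Longrightarrow> Z i \<subset> Z (Suc i)" by blast
  let ?T = "rotations p S"
  have chain: "rotation_chain n d k a F (Suc l) ?T" using step.hyps by (rule rotation_chain.step)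
  note T = rotation_chain_subset[OF chain assms(2)]
  let ?\<mu> = "\<lambda>F. dual_form n d (a c) (F p)"
  have \<mu>: "?\<mu> \<in> PF C" unfolding C_def using step.hyps by (intro dual_form_PF) auto
  \<comment> \<open>A quarter turn puts the negative of entry \<open>Suc p\<close> into position
    \<open>p\<close>.\<close>
  let ?G = "rotate_tuple p (of_real (pi / 2)) G"
  have "?\<mu> ?G \<noteq> 0"
    using step.hyps by (simp add: rotate_tuple_def dual_form_add dual_form_scale_form sin_of_real cos_of_real del: of_real_divide)
  moreover have "?G \<in> closure_in C Y ?T"
    using closure_in_subset[of ?T Y C] T step.hyps unfolding Y_def rotations_def by blast
  moreover have "?\<mu> x = 0" if "x \<in> closure_in C Y S" for x
    by (rule closure_inD[of x C Y S ?\<mu>]) (use that \<mu> step.hyps(4) in auto)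
  ultimately have "closure_in C Y S \<subset> closure_in C Y ?T"
    using closure_in_mono[OF rotations_superset[of S p], of C Y] by blast
  moreover have "irreducible_space (subtopology (zariski C Y) (closure_in C Y ?T))"
    using T unfolding C_def Y_def by (intro irreducible_closure_in) blast+
  ultimately show ?case using Z
    by (intro exI[of _ "Z(Suc l := closure_in C Y ?T)"]) (auto simp: le_Suc_eq less_Suc_eq closedin_closure_in)
qed

lemma krull_dim_ge_rotation_chain:
  assumes "rotation_chain n d k a F l S" "F \<in> SOS_decompositions n d k f"
  shows "ereal (real l) \<le> krull_dim (zariski (tuple_coords k n d) (SOS_decompositions n d k f))"
  unfolding krull_dim_def
  by (rule Sup_upper) (use rotation_chain_irreducible_chain[OF assms] in blast)

lemma dual_form_rotate:
  "dual_form n d b (rotate_tuple p \<theta> G m) =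
    (if m = p then cos \<theta> * dual_form n d b (G p) - sin \<theta> * dual_form n d b (G (Suc p))
     else if m = Suc p then sin \<theta> * dual_form n d b (G p) + cos \<theta> * dual_form n d b (G (Suc p))
     else dual_form n d b (G m))"
  by (simp add: rotate_tuple_def dual_form_add dual_form_scale_form)

text \<open>
  At level \<open>j\<close> the rotations in the planes \<open>(j, j+1), \<dots>, (1, 2)\<close> move the coordinate \<open>j + 1\<close>, which
  all previous rotations fixed, into successively larger spans; altogether these are
  \<open>1 + \<dots> + (k - 1)\<close> rotations.
\<close>

lemma rotation_chain_exists:
  assumes k: "1 \<le> k"
    and a: "\<And>c m. c \<in> {1..k} \<Longrightarrow> m \<in> {1..k} \<Longrightarrow> dual_form n d (a c) (F m) = (if c = m then 1 else 0)"
  shows "\<exists>S. rotation_chain n d k a F (k choose 2) S"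
proof -
  let ?D = "\<lambda>c. dual_form n d (a c)"
  \<comment> \<open>The functionals beyond \<open>j\<close> still see the original tuple, because
    the rotations up to this level mix only the entries 1, ..., j.\<close>
  have "\<exists>S. rotation_chain n d k a F (j choose 2) S \<and> S \<noteq> {} \<and>
      (\<forall>c\<in>{j<..k}. \<forall>G\<in>S. \<forall>m\<in>{1..k}. ?D c (G m) = (if c = m then 1 else 0))" if "1 \<le> j" "j \<le> k" for j
    using that
  proof (induction j rule: nat_induct_at_least)
    case base
    have "Suc 0 choose 2 = 0" by (simp add: numeral_2_eq_2)
    then have "rotation_chain n d k a F (1 choose 2) {F}"
      using rotation_chain.base[of n d k a F] by (simp only: One_nat_def)
    then show ?case using a by (intro exI[of _ "{F}"] conjI) auto
  next
    case (Suc j)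
    then have "j \<le> k" by simp
    from Suc.IH[OF this] obtain S where S: "rotation_chain n d k a F (j choose 2) S" "S \<noteq> {}"
      "\<forall>c\<in>{j<..k}. \<forall>G\<in>S. \<forall>m\<in>{1..k}. ?D c (G m) = (if c = m then 1 else 0)" by blast
    \<comment> \<open>After \<open>i\<close> rotations of this level the functional
      \<open>a (Suc j)\<close> still vanishes on the entries up to j - i, but is nonzero on the next
      entry for some member: exactly what a rotation in the plane of the entries j - i and j - i + 1
      requires.\<close>
    have "\<exists>T. rotation_chain n d k a F ((j choose 2) + i) T \<and>
        (\<forall>c\<in>{Suc j<..k}. \<forall>G\<in>T. \<forall>m\<in>{1..k}. ?D c (G m) = (if c = m then 1 else 0)) \<and>
        (\<forall>G\<in>T. \<forall>m\<in>{1..j-i}. ?D (Suc j) (G m) = 0) \<and> (\<exists>G\<in>T. ?D (Suc j) (G (Suc j - i)) \<noteq> 0)"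
      if "i \<le> j" for i
      using that
    proof (induction i)
      case 0
      then show ?case using S Suc.prems by (intro exI[of _ S]) auto
    next
      case (Suc i)
      then have "i \<le> j" by simp
      from Suc.IH[OF this] obtain T G where T: "rotation_chain n d k a F ((j choose 2) + i) T"
        "\<forall>c\<in>{Suc j<..k}. \<forall>G\<in>T. \<forall>m\<in>{1..k}. ?D c (G m) = (if c = m then 1 else 0)"
        "\<forall>G\<in>T. \<forall>m\<in>{1..j-i}. ?D (Suc j) (G m) = 0"
        "G \<in> T" "?D (Suc j) (G (Suc j - i)) \<noteq> 0" by blast
      define p where "p = j - i"
      have p: "1 \<le> p" "p < k" "Suc j - i = Suc p" "j - Suc i = p - 1" "Suc j - Suc i = p" "p \<le> j"
        using Suc.prems \<open>Suc j \<le> k\<close> by (auto simp: p_def)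
      have "rotation_chain n d k a F (Suc ((j choose 2) + i)) (rotations p T)"
        by (rule rotation_chain.step[OF T(1) p(1,2), of "Suc j" G]) (use T p in \<open>auto simp: p_def\<close>)
      moreover have "?D c (H m) = (if c = m then 1 else 0)"
        if c: "c \<in> {Suc j<..k}" and H: "H \<in> rotations p T" and m: "m \<in> {1..k}" for c H m
      proof -
        obtain \<theta> G' where "G' \<in> T" "H = rotate_tuple p \<theta> G'" using H unfolding rotations_def by blast
        then show ?thesis
          using T(2)[rule_format, OF c, of G' p] T(2)[rule_format, OF c, of G' "Suc p"]
            T(2)[rule_format, OF c _ m, of G'] c m p by (cases "c = m") (auto simp: dual_form_rotate)
      qed
      moreover have "?D (Suc j) (H m) = 0" if H: "H \<in> rotations p T" and m: "m \<in> {1..j - Suc i}" for H m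
      proof -
        obtain \<theta> G' where "G' \<in> T" "H = rotate_tuple p \<theta> G'" using H unfolding rotations_def by blast
        moreover have m': "1 \<le> m" "m \<le> p - 1" using m unfolding p(4) by (simp_all only: atLeastAtMost_iff)
        then have "m \<noteq> p" "m \<noteq> Suc p" "m \<le> p" using p(1) by linarith+
        moreover from this m' have "m \<in> {1..j-i}" unfolding p_def[symmetric] by (simp only: atLeastAtMost_iff)
        ultimately show ?thesis using T(3) by (simp add: dual_form_rotate)
      qed
      moreover have "?D (Suc j) (rotate_tuple p (of_real (pi / 2)) G p) \<noteq> 0"
        using T(5) p by (simp add: dual_form_rotate sin_of_real cos_of_real del: of_real_divide)
      then have "\<exists>H\<in>rotations p T. ?D (Suc j) (H (Suc j - Suc i)) \<noteq> 0"
        unfolding p(5) rotations_def using T(4) by blast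
      ultimately show ?case by (intro exI[of _ "rotations p T"]) auto
    qed
    from this[OF order.refl] obtain T G where T: "rotation_chain n d k a F ((j choose 2) + j) T" "G \<in> T"
      "\<forall>c\<in>{Suc j<..k}. \<forall>G\<in>T. \<forall>m\<in>{1..k}. ?D c (G m) = (if c = m then 1 else 0)" by blast
    have "Suc j choose 2 = (j choose 2) + j" by (simp add: numeral_2_eq_2)
    then show ?case using T by (intro exI[of _ T]) auto
  qed
  then show ?thesis using k by blast
qed

section \<open>Determinants, and vanishing along curves\<close>

lemma PF_det:
  assumes "\<And>r c. r < k \<Longrightarrow> c < k \<Longrightarrow> f r c \<in> PF C"
  shows "(\<lambda>x. det (mat k k (\<lambda>(r, c). f r c x))) \<in> PF C"
proof -
  have "det (mat k k (\<lambda>(r, c). f r c x)) = (\<Sum>\<sigma> | \<sigma> permutes {0..<k}. signof \<sigma> * (\<Prod>r = 0..<k. f r (\<sigma> r) x))" for x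
  proof -
    have "det (mat k k (\<lambda>(r, c). f r c x)) = (\<Sum>\<sigma> | \<sigma> permutes {0..<k}.
        signof \<sigma> * (\<Prod>r = 0..<k. mat k k (\<lambda>(r, c). f r c x) $$ (r, \<sigma> r)))"
      by (rule det_def') simp
    also have "\<dots> = (\<Sum>\<sigma> | \<sigma> permutes {0..<k}. signof \<sigma> * (\<Prod>r = 0..<k. f r (\<sigma> r) x))"
    proof (intro sum.cong refl arg_cong2[of _ _ _ _ "(*)"] prod.cong)
      fix \<sigma> r assume "\<sigma> \<in> {\<sigma>. \<sigma> permutes {0..<k}}" "r \<in> {0..<k}"
      then have "\<sigma> r < k" using permutes_in_image[of \<sigma> "{0..<k}" r] by simp
      then show "mat k k (\<lambda>(r, c). f r c x) $$ (r, \<sigma> r) = f r (\<sigma> r) x"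
        using \<open>r \<in> {0..<k}\<close> by simp
    qed
    finally show ?thesis .
  qed
  moreover have "(\<lambda>x. \<Sum>\<sigma> | \<sigma> permutes {0..<k}. signof \<sigma> * (\<Prod>r = 0..<k. f r (\<sigma> r) x)) \<in> PF C"
  proof (intro PF_sum PF_cmult PF_prod)
    fix \<sigma> r assume "\<sigma> \<in> {\<sigma>. \<sigma> permutes {0..<k}}" "r \<in> {0..<k}"
    then show "f r (\<sigma> r) \<in> PF C"
      using permutes_in_image[of \<sigma> "{0..<k}" r] by (intro assms) auto
  qed
  ultimately show ?thesis by simp
qed

text \<open>The rows of the inverse will be the functionals dual to linearly independent
  forms.\<close>

lemma det_nonzero_left_inverse:
  fixes f :: "nat \<Rightarrow> nat \<Rightarrow> complex"
  assumes "det (mat k k (\<lambda>(r, c). f r c)) \<noteq> 0"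
  shows "\<exists>b. \<forall>r<k. \<forall>c<k. (\<Sum>l<k. b r l * f l c) = (if r = c then 1 else 0)"
proof -
  let ?A = "mat k k (\<lambda>(r, c). f r c)"
  have "?A \<in> Units (ring_mat TYPE(complex) k ())"
    by (rule det_non_zero_imp_unit[OF _ assms]) simp
  then obtain B where B: "B \<in> carrier_mat k k" "B * ?A = 1\<^sub>m k"
    unfolding Units_def by (auto simp: ring_mat_simps)
  have "(\<Sum>l<k. B $$ (r, l) * f l c) = (if r = c then 1 else 0)" if "r < k" "c < k" for r c
  proof -
    have "(B * ?A) $$ (r, c) = (\<Sum>l = 0..<k. B $$ (r, l) * f l c)"
      using B(1) that by (auto simp: scalar_prod_def)
    then show ?thesis using B(2) that by (simp add: lessThan_atLeast0)
  qed
  then show ?thesis by (intro exI[of _ "\<lambda>r l. B $$ (r, l)"]) auto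
qed

text \<open>
  A polynomial \<open>p\<close> vanishing on a family of parametrised curves through \<open>\<eta>\<close> in all directions \<open>u\<close>
  is zero: the lowest homogeneous part of \<open>p\<close> at \<open>\<eta>\<close> would vanish at every \<open>u\<close>.
\<close>

lemma PF_zero_if_vanishing_on_curves:
  fixes p :: "('t \<Rightarrow> complex) \<Rightarrow> complex"
  assumes p: "p \<in> PF (coords T)"
    and curve: "\<And>u. \<exists>Q. \<forall>\<epsilon>. p (\<lambda>t. \<eta> t + \<epsilon> * (u t + \<epsilon> * Q t)) = 0"
  shows "p x = 0"
proof -
  \<comment> \<open>The Taylor expansion at \<eta>: \<open>None\<close> carries the parameter
    \<epsilon> and \<open>Some t\<close> the direction, so the coefficients of the powers of
    \<epsilon> are functions of the direction alone.\<close>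
  define p' :: "('t option \<Rightarrow> complex) \<Rightarrow> complex" where
    "p' w = p (\<lambda>t. \<eta> t + w None * w (Some t))" for w
  have "(\<lambda>w. \<eta> t + w None * w (Some t)) \<in> PF (coords (insert None (Some ` T)))" if "t \<in> T" for t
    using that by (intro PF_intros) (auto simp: coords_def)
  then have "p' \<in> PF (coords (insert None (Some ` T)))"
    unfolding p'_def[abs_def] by (intro PF_compose[OF p]) (auto simp: coords_def)
  from PF_upoly[OF this] obtain m where "p' \<in> upoly (Some ` T) None m" by blast
  then obtain c where c: "\<forall>e. c e \<in> PF (coords (Some ` T))" "\<forall>w. p' w = (\<Sum>e\<le>m. c e w * w None ^ e)"
    unfolding upoly_def by blast
  have C0: "c e w = 0" if "e \<le> m" for e w
    using that
  proof (induction e arbitrary: w rule: less_induct)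
    case (less e)
    define u where "u t = w (Some t)" for t
    obtain Q where Q: "\<forall>\<epsilon>. p (\<lambda>t. \<eta> t + \<epsilon> * (u t + \<epsilon> * Q t)) = 0" using curve by blast
    \<comment> \<open>The curve is read as a straight line whose direction u + \<epsilon> Q varies
      with \<epsilon> and equals \<open>u\<close> at \<epsilon> = 0.\<close>
    define W where "W \<epsilon> j = (case j of None \<Rightarrow> \<epsilon> | Some t \<Rightarrow> u t + \<epsilon> * Q t)" for \<epsilon> :: complex and j
    \<comment> \<open>The expansion with \<epsilon>^e split off. Since polynomials in \<epsilon>
      form a domain, \<open>h\<close> vanishes at \<epsilon> = 0 as well, and \<open>h 0\<close> is
      the coefficient of order \<open>e\<close> in direction \<open>u\<close>.\<close>
    define h where "h \<epsilon> = (\<Sum>e'\<in>{e..m}. c e' (W \<epsilon>) * \<epsilon> ^ (e' - e))" for \<epsilon>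
    let ?C = "{\<lambda>\<epsilon>::complex. \<epsilon>}"
    have id: "(\<lambda>\<epsilon>. \<epsilon>) \<in> PF ?C" by (rule polynomial_functions.coord) simp
    have "(\<lambda>\<epsilon>. u t + \<epsilon> * Q t) \<in> PF ?C" for t
      by (rule polynomial_functions.add[OF polynomial_functions.const
            polynomial_functions.mult[OF id polynomial_functions.const]])
    then have "(\<lambda>\<epsilon>. W \<epsilon> j) \<in> PF ?C" for j
      using id by (cases j) (simp_all add: W_def)
    then have cW: "(\<lambda>\<epsilon>. c e' (W \<epsilon>)) \<in> PF ?C" for e'
      by (intro PF_compose[OF c(1)[rule_format]]) (auto simp: coords_def)
    have h: "h \<in> PF ?C" unfolding h_def[abs_def]
      by (intro PF_sum polynomial_functions.mult PF_power[OF id] cW)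
    have eh: "\<epsilon> ^ e * h \<epsilon> = 0" for \<epsilon>
    proof -
      have "0 = p' (W \<epsilon>)" using Q by (simp add: p'_def W_def)
      also have "\<dots> = (\<Sum>e'\<le>m. c e' (W \<epsilon>) * \<epsilon> ^ e')" using c(2) by (simp add: W_def)
      also have "\<dots> = (\<Sum>e'\<in>{e..m}. c e' (W \<epsilon>) * \<epsilon> ^ e')"
        using less by (intro sum.mono_neutral_right) auto
      also have "\<dots> = \<epsilon> ^ e * h \<epsilon>"
        unfolding h_def sum_distrib_left
      proof (rule sum.cong)
        fix e' assume "e' \<in> {e..m}"
        then have "\<epsilon> ^ e' = \<epsilon> ^ e * \<epsilon> ^ (e' - e)" by (simp flip: power_add)
        then show "c e' (W \<epsilon>) * \<epsilon> ^ e' = \<epsilon> ^ e * (c e' (W \<epsilon>) * \<epsilon> ^ (e' - e))" by simp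
      qed simp
      finally show ?thesis by simp
    qed
    have "entire_connected ?C UNIV" unfolding entire_connected_def
    proof (intro ballI)
      fix x y :: complex
      show "\<exists>\<phi>. \<phi> 0 = x \<and> \<phi> 1 = y \<and> range \<phi> \<subseteq> UNIV \<and> (\<forall>c\<in>?C. (\<lambda>t. c (\<phi> t)) holomorphic_on UNIV)"
        by (intro exI[of _ "\<lambda>t. x + t * (y - x)"]) (auto intro!: holomorphic_intros)
    qed
    then have "domain_on ?C UNIV" by (rule entire_connected_domain_on)
    then have "\<forall>\<epsilon>\<in>UNIV. h \<epsilon> = 0"
    proof (rule domain_onD[where p = "\<lambda>\<epsilon>. \<epsilon> ^ e"])
      show "\<not> (\<forall>x\<in>(UNIV :: complex set). x ^ e = 0)" by (intro notI) (metis UNIV_I power_one zero_neq_one)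
    qed (use eh h PF_power[OF id, of e] in auto)
    then have "h 0 = 0" by simp
    moreover have "h 0 = (\<Sum>e'\<in>{e}. c e' (W 0) * 0 ^ (e' - e))"
      unfolding h_def using less.prems by (intro sum.mono_neutral_right) auto
    ultimately have "c e (W 0) = 0" by simp
    moreover have "c e w = c e (W 0)"
      by (rule PF_coords_cong[OF c(1)[rule_format]]) (auto simp: W_def u_def)
    ultimately show ?case by simp
  qed
  \<comment> \<open>The parameter \<epsilon> = 1 in direction x - \<eta> leads from \<eta> to
    \<open>x\<close>.\<close>
  have "p x = p' (\<lambda>j. case j of None \<Rightarrow> 1 | Some t \<Rightarrow> x t - \<eta> t)" by (simp add: p'_def)
  also have "\<dots> = 0" using c(2) C0 by simp
  finally show ?thesis .
qed

subsection \<open>Coefficients of sums of squares\<close>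

text \<open>Written out so as to be a polynomial function of the tuple coordinates for every
  \<open>F\<close>; it is the true coefficient once \<open>F\<close> is a tuple of forms.\<close>

definition square_coeff :: "nat \<Rightarrow> nat \<Rightarrow> nat \<Rightarrow> (nat \<Rightarrow> cpoly) \<Rightarrow> (nat \<Rightarrow>\<^sub>0 nat) \<Rightarrow> complex" where
  "square_coeff k n d F \<tau> = (\<Sum>i\<in>{1..k}. \<Sum>\<alpha>\<in>monomials_of_degree n d. \<Sum>\<beta>\<in>monomials_of_degree n d.
     if \<alpha> + \<beta> = \<tau> then Poly_Mapping.lookup (F i) \<alpha> * Poly_Mapping.lookup (F i) \<beta> else 0)"

lemma square_coeff_PF: "(\<lambda>F. square_coeff k n d F \<tau>) \<in> PF (tuple_coords k n d)"
  unfolding square_coeff_def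
  by (intro PF_sum PF_if polynomial_functions.mult polynomial_functions.const polynomial_functions.coord)
    (auto simp: tuple_coords_def)

lemma lookup_sum_squares:
  assumes "F \<in> Sym_tuples k n d"
  shows "Poly_Mapping.lookup (\<Sum>i=1..k. (F i)\<^sup>2) = square_coeff k n d F"
proof
  fix \<tau>
  have "Poly_Mapping.lookup ((F i)\<^sup>2) \<tau> = (\<Sum>\<alpha>\<in>monomials_of_degree n d. \<Sum>\<beta>\<in>monomials_of_degree n d.
     if \<alpha> + \<beta> = \<tau> then Poly_Mapping.lookup (F i) \<alpha> * Poly_Mapping.lookup (F i) \<beta> else 0)"
    if "i \<in> {1..k}" for i
  proof -
    have "Poly_Mapping.keys (F i) \<subseteq> monomials_of_degree n d"
      using assms that by (auto simp: Sym_tuples_iff Sym_def)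
    then show ?thesis unfolding power2_eq_square
      by (intro lookup_times finite_monomials_of_degree)
  qed
  then show "Poly_Mapping.lookup (\<Sum>i=1..k. (F i)\<^sup>2) \<tau> = square_coeff k n d F \<tau>"
    unfolding lookup_sum square_coeff_def by (intro sum.cong) auto
qed

lemma sum_squares_Sym:
  assumes "F \<in> Sym_tuples k n d"
  shows "(\<Sum>i=1..k. (F i)\<^sup>2) \<in> Sym n (2 * d)"
proof (rule Sym_sum)
  fix i assume "i \<in> {1..k}"
  then have "F i \<in> Sym n d" using assms by (simp add: Sym_tuples_iff)
  then show "(F i)\<^sup>2 \<in> Sym n (2 * d)" using Sym_times[of "F i" n d "F i" d] by (simp add: power2_eq_square mult_2)
qed

lemma SOS_decompositions_eq:
  "SOS_decompositions n d k f = {F \<in> Sym_tuples k n d. square_coeff k n d F = Poly_Mapping.lookup f}"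
  unfolding SOS_decompositions_def
  by (auto simp: lookup_sum_squares[symmetric] lookup_inject)

lemma domain_on_Sym_tuples: "domain_on (tuple_coords k n d) (Sym_tuples k n d)"
proof (rule entire_connected_domain_on, unfold entire_connected_def, intro ballI)
  fix F G assume FG: "F \<in> Sym_tuples k n d" "G \<in> Sym_tuples k n d"
  define \<phi> where "\<phi> t i = (if i \<in> {1..k} then scale_form (1 - t) (F i) + scale_form t (G i) else undefined)" for t i
  have "\<phi> t \<in> Sym_tuples k n d" for t
    using FG by (auto simp: Sym_tuples_iff \<phi>_def intro!: Sym_add Sym_scale_form)
  moreover have "\<phi> 0 = F" "\<phi> 1 = G"
    using FG by (auto simp: \<phi>_def Sym_tuples_iff fun_eq_iff intro!: poly_mapping_eqI simp: lookup_add)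
  moreover have "(\<lambda>t. c (\<phi> t)) holomorphic_on UNIV" if "c \<in> tuple_coords k n d" for c
    using that by (auto simp: tuple_coords_def \<phi>_def lookup_add intro!: holomorphic_intros)
  ultimately show "\<exists>\<phi>. \<phi> 0 = F \<and> \<phi> 1 = G \<and> range \<phi> \<subseteq> Sym_tuples k n d \<and>
      (\<forall>c\<in>tuple_coords k n d. (\<lambda>t. c (\<phi> t)) holomorphic_on UNIV)"
    by (intro exI[of _ \<phi>]) auto
qed

lemma pure_power_monomial: "i \<le> n \<Longrightarrow> Poly_Mapping.single i d \<in> monomials_of_degree n d"
  by (auto simp: monomials_of_degree_def lookup_single when_def split: if_splits)

lemma monomial_eq_pure_power:
  assumes "\<alpha> \<in> monomials_of_degree n d" "j \<le> n" "d \<le> Poly_Mapping.lookup \<alpha> j"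
  shows "\<alpha> = Poly_Mapping.single j d"
proof (rule poly_mapping_eqI)
  fix i
  have sum: "(\<Sum>i=0..n. Poly_Mapping.lookup \<alpha> i) = d" and keys: "Poly_Mapping.keys \<alpha> \<subseteq> {0..n}"
    using assms(1) by (auto simp: monomials_of_degree_def)
  have s: "(\<Sum>i=0..n. Poly_Mapping.lookup \<alpha> i) = Poly_Mapping.lookup \<alpha> j + (\<Sum>i\<in>{0..n} - {j}. Poly_Mapping.lookup \<alpha> i)"
    using assms(2) by (intro sum.remove) auto
  then have "Poly_Mapping.lookup \<alpha> j = d" "(\<Sum>i\<in>{0..n} - {j}. Poly_Mapping.lookup \<alpha> i) = 0"
    using sum assms(3) by linarith+
  moreover have "Poly_Mapping.lookup \<alpha> i = 0" if "i \<notin> {0..n}" using keys that by (auto simp: in_keys_iff)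
  ultimately show "Poly_Mapping.lookup \<alpha> i = Poly_Mapping.lookup (Poly_Mapping.single j d) i"
    by (cases "i = j"; cases "i \<in> {0..n}") (auto simp: lookup_single)
qed

text \<open>
  The differential of the sum of squares at \<open>(x\<^sub>1\<^sup>d, \<dots>, x\<^sub>k\<^sup>d)\<close> has rank the number of distinct
  monomials \<open>x\<^sub>i\<^sup>d m\<close>. They are indexed by the pairs \<open>(i, m)\<close>, where of the two pairs
  \<open>(i, x\<^sub>j\<^sup>d)\<close> and \<open>(j, x\<^sub>i\<^sup>d)\<close> only the one with smaller first entry is kept.
\<close>

definition tangent_index :: "nat \<Rightarrow> nat \<Rightarrow> nat \<Rightarrow> (nat \<times> (nat \<Rightarrow>\<^sub>0 nat)) set" where
  "tangent_index k n d = {1..k} \<times> monomials_of_degree n d -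
     (\<lambda>(i, j). (i, Poly_Mapping.single j d)) ` (SIGMA i:{1..k}. {1..<i})"

text \<open>The pairs removed from the full index set are the image of the pairs j < i in {1..k}, of
  which there are k choose 2.\<close>

lemma card_tangent_index:
  "card ({1..k} \<times> monomials_of_degree n d) - card (tangent_index k n d) \<le> k choose 2"
proof -
  let ?I = "{1..k} \<times> monomials_of_degree n d" and ?P = "SIGMA i:{1..k}. {1..<i}"
  let ?R = "(\<lambda>(i, j). (i, Poly_Mapping.single j d)) ` ?P :: (nat \<times> (nat \<Rightarrow>\<^sub>0 nat)) set"
  have fin: "finite ?P" by auto
  have "(\<Sum>i=1..k. i - 1) = k choose 2"
    by (induction k) (auto simp: numeral_2_eq_2)
  then have "card ?P = k choose 2" by (simp add: card_SigmaI)
  then have "card ?R \<le> k choose 2" using card_image_le[OF fin] by metis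
  moreover have "card ?I - card ?R \<le> card (?I - ?R)"
    using fin by (intro diff_card_le_card_Diff) auto
  ultimately show ?thesis by (simp add: tangent_index_def)
qed

text \<open>If x_i^d \<alpha> = x_j^d \<beta> with i \<noteq> j, then \<alpha> is divisible by x_j^d
  and \<beta> by x_i^d; as both have degree d they equal these powers, and one of the two pairs has
  been removed.\<close>

lemma tangent_index_inj:
  assumes "k \<le> n" "(i, \<alpha>) \<in> tangent_index k n d" "(j, \<beta>) \<in> tangent_index k n d"
    and eq: "Poly_Mapping.single i d + \<alpha> = Poly_Mapping.single j d + \<beta>"
  shows "i = j \<and> \<alpha> = \<beta>"
proof (cases "i = j")
  case True
  then show ?thesis using eq by simp
next
  case False
  have \<alpha>: "i \<in> {1..k}" "\<alpha> \<in> monomials_of_degree n d" and \<beta>: "j \<in> {1..k}" "\<beta> \<in> monomials_of_degree n d"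
    using assms(2,3) by (auto simp: tangent_index_def)
  have "Poly_Mapping.lookup \<alpha> j = d + Poly_Mapping.lookup \<beta> j" "d + Poly_Mapping.lookup \<alpha> i = Poly_Mapping.lookup \<beta> i"
    using arg_cong[OF eq, of "\<lambda>f. Poly_Mapping.lookup f j"] arg_cong[OF eq, of "\<lambda>f. Poly_Mapping.lookup f i"] False
    by (simp_all add: lookup_add lookup_single)
  then have "d \<le> Poly_Mapping.lookup \<alpha> j" "d \<le> Poly_Mapping.lookup \<beta> i" by linarith+
  then have "\<alpha> = Poly_Mapping.single j d" "\<beta> = Poly_Mapping.single i d"
    using \<alpha> \<beta> assms(1) by (auto intro!: monomial_eq_pure_power)
  then have "\<not> j < i" "\<not> i < j" using assms(2,3) \<alpha> \<beta> unfolding tangent_index_def by force+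
  then show ?thesis using False by simp
qed

lemma scale_form_square: "(f + scale_form \<epsilon> g)\<^sup>2 = f\<^sup>2 + scale_form (2 * \<epsilon>) (f * g) + scale_form (\<epsilon> * \<epsilon>) (g\<^sup>2)"
proof -
  define c where "c = Poly_Mapping.single (0 :: nat \<Rightarrow>\<^sub>0 nat) \<epsilon>"
  have 1: "Poly_Mapping.single 0 (\<epsilon> * \<epsilon>) = c * c" by (simp add: c_def mult_single)
  have 2: "Poly_Mapping.single 0 (2 * \<epsilon>) = c + c" by (simp only: c_def mult_2 single_add)
  show ?thesis unfolding scale_form_def 1 2 c_def[symmetric]
    by (simp add: power2_eq_square algebra_simps)
qed

text \<open>An algebraic relation would vanish along the image of every line through (x_1^d, ...,
  x_k^d). The velocities of these images fill the whole coordinate space of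
  \<open>tangent_index\<close>, so the relation is the zero polynomial.\<close>

lemma alg_indep_square_coeffs:
  assumes "k \<le> n"
  shows "alg_indep (tangent_index k n d)
    (\<lambda>(i, m) F. square_coeff k n d F (Poly_Mapping.single i d + m)) (Sym_tuples k n d)"
  unfolding alg_indep_def
proof (intro allI impI)
  let ?T = "tangent_index k n d"
  define \<tau> where "\<tau> = (\<lambda>(i, m). Poly_Mapping.single i d + m :: nat \<Rightarrow>\<^sub>0 nat)"
  fix D c
  assume rel: "\<forall>x\<in>Sym_tuples k n d. (\<Sum>\<alpha>\<in>exponents ?T D. c \<alpha> *
    monom_fun ?T (\<lambda>(i, m) F. square_coeff k n d F (Poly_Mapping.single i d + m)) \<alpha> x) = 0"
  have finT: "finite ?T" by (simp add: tangent_index_def finite_monomials_of_degree)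
  define p where "p w = (\<Sum>\<alpha>\<in>exponents ?T D. c \<alpha> * monom_fun ?T (\<lambda>t w. w t) \<alpha> w)" for w
  have pPF: "p \<in> PF (coords ?T)" unfolding p_def[abs_def]
    by (intro PF_sum PF_cmult monom_fun_PF polynomial_functions.coord) (auto simp: coords_def)
  have pX: "p (\<lambda>t. square_coeff k n d F (\<tau> t)) = 0" if "F \<in> Sym_tuples k n d" for F
    using rel that by (simp add: p_def monom_fun_def \<tau>_def case_prod_unfold)
  define F0 :: "nat \<Rightarrow> cpoly" where
    "F0 i = (if i \<in> {1..k} then Poly_Mapping.single (Poly_Mapping.single i d) 1 else undefined)" for i
  have F0: "F0 \<in> Sym_tuples k n d"
    using assms by (auto simp: F0_def Sym_tuples_iff Sym_def intro!: pure_power_monomial)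
  have "p x = 0" for x
  proof (rule PF_zero_if_vanishing_on_curves[OF pPF, where \<eta> = "\<lambda>t. square_coeff k n d F0 (\<tau> t)"])
    fix u :: "nat \<times> (nat \<Rightarrow>\<^sub>0 nat) \<Rightarrow> complex"
    \<comment> \<open>The direction that realises the velocity \<open>u\<close>; the halves cancel
      the factor 2 from differentiating squares.\<close>
    define G :: "nat \<Rightarrow> cpoly" where
      "G i = (if i \<in> {1..k} then (\<Sum>m | (i, m) \<in> ?T. Poly_Mapping.single m (u (i, m) / 2)) else undefined)" for i
    have finTi: "finite {m. (i, m) \<in> ?T}" for i
      using finite_monomials_of_degree[of n d] by (rule finite_subset[rotated]) (auto simp: tangent_index_def)
    have lookupG: "Poly_Mapping.lookup (G i) m = (if (i, m) \<in> ?T then u (i, m) / 2 else 0)" if "i \<in> {1..k}" for i m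
      using that finTi[of i] by (simp add: G_def lookup_sum lookup_single when_def sum.delta')
    have GSym: "G i \<in> Sym n d" if "i \<in> {1..k}" for i
      using lookupG[OF that] by (auto simp: Sym_iff tangent_index_def)
    have G: "G \<in> Sym_tuples k n d"
      unfolding Sym_tuples_iff
    proof (intro conjI ballI allI impI GSym)
      show "G i = undefined" if "i \<notin> {1..k}" for i unfolding G_def using that by (rule if_not_P)
    qed
    define L where "L = (\<Sum>i=1..k. F0 i * G i)"
    have L: "2 * Poly_Mapping.lookup L (\<tau> t) = u t" if t: "t \<in> ?T" for t
    proof -
      have "Poly_Mapping.lookup (F0 i * G i) (\<tau> t) =
          (\<Sum>m\<in>monomials_of_degree n d. if (i, m) = t then u t / 2 else 0)" if i: "i \<in> {1..k}" for i
      proof -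
        have "Poly_Mapping.lookup (F0 i * G i) (\<tau> t) = (\<Sum>\<alpha>\<in>{Poly_Mapping.single i d}. \<Sum>m\<in>monomials_of_degree n d.
            if \<alpha> + m = \<tau> t then Poly_Mapping.lookup (F0 i) \<alpha> * Poly_Mapping.lookup (G i) m else 0)"
          using GSym[OF i] i by (intro lookup_times finite_monomials_of_degree) (auto simp: Sym_def F0_def)
        also have "\<dots> = (\<Sum>m\<in>monomials_of_degree n d. if \<tau> (i, m) = \<tau> t then Poly_Mapping.lookup (G i) m else 0)"
        proof -
          have "Poly_Mapping.lookup (F0 i) (Poly_Mapping.single i d) = 1"
            unfolding F0_def if_P[OF i] by simp
          then show ?thesis by (simp add: \<tau>_def cong: if_cong)
        qed
        also have "\<dots> = (\<Sum>m\<in>monomials_of_degree n d. if (i, m) = t then u t / 2 else 0)"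
        proof (rule sum.cong)
          fix m assume "m \<in> monomials_of_degree n d"
          show "(if \<tau> (i, m) = \<tau> t then Poly_Mapping.lookup (G i) m else 0) = (if (i, m) = t then u t / 2 else 0)"
          proof (cases "(i, m) \<in> ?T")
            case True
            then have "\<tau> (i, m) = \<tau> t \<longleftrightarrow> (i, m) = t"
              using tangent_index_inj[OF assms, of i m d "fst t" "snd t"] t by (auto simp: \<tau>_def case_prod_unfold)
            then show ?thesis using True lookupG[OF i] by auto
          next
            case False
            then show ?thesis using t lookupG[OF i] by auto
          qed
        qed simp
        finally show ?thesis .
      qed
      then have "Poly_Mapping.lookup L (\<tau> t) = (\<Sum>i\<in>{1..k}. \<Sum>m\<in>monomials_of_degree n d. if (i, m) = t then u t / 2 else 0)"
        unfolding L_def lookup_sum by (intro sum.cong) auto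
      also have "\<dots> = (\<Sum>s\<in>{1..k} \<times> monomials_of_degree n d. if s = t then u t / 2 else 0)"
        by (simp add: sum.cartesian_product case_prod_unfold)
      also have "\<dots> = u t / 2"
        using t finite_monomials_of_degree[of n d] by (subst sum.delta) (auto simp: tangent_index_def)
      finally show ?thesis by (simp add: mult.commute)
    qed
    \<comment> \<open>Expanding the squares of \<open>F0\<close> + \<epsilon> \<open>G\<close> stops
      at order two: the linear term is \<open>u\<close>, and the quadratic one, the sum of squares
      of \<open>G\<close>, is the required \<open>Q\<close>.\<close>
    show "\<exists>Q. \<forall>\<epsilon>. p (\<lambda>t. square_coeff k n d F0 (\<tau> t) + \<epsilon> * (u t + \<epsilon> * Q t)) = 0"
    proof (intro exI[of _ "\<lambda>t. square_coeff k n d G (\<tau> t)"] allI)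
      fix \<epsilon>
      define H where "H i = (if i \<in> {1..k} then F0 i + scale_form \<epsilon> (G i) else undefined)" for i
      have H: "H \<in> Sym_tuples k n d"
        using F0 G by (auto simp: Sym_tuples_iff H_def intro!: Sym_add Sym_scale_form)
      have "(\<Sum>i=1..k. (H i)\<^sup>2) = (\<Sum>i=1..k. (F0 i)\<^sup>2 + scale_form (2 * \<epsilon>) (F0 i * G i) + scale_form (\<epsilon> * \<epsilon>) ((G i)\<^sup>2))"
        by (intro sum.cong) (auto simp: H_def scale_form_square)
      then have Hc: "square_coeff k n d H \<sigma> = square_coeff k n d F0 \<sigma> +
          \<epsilon> * (2 * Poly_Mapping.lookup L \<sigma> + \<epsilon> * square_coeff k n d G \<sigma>)" for \<sigma>
        unfolding lookup_sum_squares[OF H, symmetric] lookup_sum_squares[OF F0, symmetric]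
          lookup_sum_squares[OF G, symmetric] L_def
        by (simp add: lookup_sum lookup_add sum.distrib sum_distrib_left algebra_simps)
      have "p (\<lambda>t. square_coeff k n d F0 (\<tau> t) + \<epsilon> * (u t + \<epsilon> * square_coeff k n d G (\<tau> t))) =
          p (\<lambda>t. square_coeff k n d H (\<tau> t))"
        by (rule PF_coords_cong[OF pPF]) (simp add: Hc L)
      then show "p (\<lambda>t. square_coeff k n d F0 (\<tau> t) + \<epsilon> * (u t + \<epsilon> * square_coeff k n d G (\<tau> t))) = 0"
        using pX[OF H] by simp
    qed
  qed
  then show "\<forall>\<alpha>\<in>exponents ?T D. c \<alpha> = 0"
    using alg_indepD[OF alg_indep_coordinates[OF finT], of c D] unfolding p_def by simp
qed

subsection \<open>Generic sums of squares\<close>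

definition form_coords :: "nat \<Rightarrow> nat \<Rightarrow> (cpoly \<Rightarrow> complex) set" where
  "form_coords n m = {\<lambda>f. Poly_Mapping.lookup f \<alpha> | \<alpha>. \<alpha> \<in> monomials_of_degree n m}"

lemma zariski_Sym_eq: "zariski_Sym n m = zariski (form_coords n m) (Sym n m)"
  by (simp add: zariski_Sym_def form_coords_def)

lemma PF_form_coords:
  assumes "p \<in> PF (coords (monomials_of_degree n m))"
  shows "(\<lambda>f. p (Poly_Mapping.lookup f)) \<in> PF (form_coords n m)"
  by (rule PF_compose[OF assms]) (auto simp: coords_def form_coords_def intro!: polynomial_functions.coord)

lemma PF_form_coordsE:
  assumes "q \<in> PF (form_coords n m)"
  obtains p where "p \<in> PF (coords (monomials_of_degree n m))" "\<And>f. q f = p (Poly_Mapping.lookup f)"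
proof -
  have "\<exists>p\<in>PF (coords (monomials_of_degree n m)). \<forall>f. q f = p (Poly_Mapping.lookup f)"
    using assms
  proof (induction rule: polynomial_functions.induct)
    case (const c)
    show ?case by (rule bexI[of _ "\<lambda>_. c"]) (auto intro: polynomial_functions.const)
  next
    case (coord q)
    then obtain \<alpha> where "\<alpha> \<in> monomials_of_degree n m" "q = (\<lambda>f. Poly_Mapping.lookup f \<alpha>)"
      by (auto simp: form_coords_def)
    then show ?case
      by (intro bexI[of _ "\<lambda>w. w \<alpha>"]) (auto simp: coords_def intro!: polynomial_functions.coord)
  next
    case (add p q)
    then obtain p' q' where "p' \<in> PF (coords (monomials_of_degree n m))" "\<forall>f. p f = p' (Poly_Mapping.lookup f)"
      "q' \<in> PF (coords (monomials_of_degree n m))" "\<forall>f. q f = q' (Poly_Mapping.lookup f)" by blast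
    then show ?case by (intro bexI[of _ "\<lambda>w. p' w + q' w"]) (auto intro: polynomial_functions.add)
  next
    case (mult p q)
    then obtain p' q' where "p' \<in> PF (coords (monomials_of_degree n m))" "\<forall>f. p f = p' (Poly_Mapping.lookup f)"
      "q' \<in> PF (coords (monomials_of_degree n m))" "\<forall>f. q f = q' (Poly_Mapping.lookup f)" by blast
    then show ?case by (intro bexI[of _ "\<lambda>w. p' w * q' w"]) (auto intro: polynomial_functions.mult)
  qed
  then show ?thesis using that by blast
qed

lemma SOS_subset: "SOS n d k \<subseteq> Sym n (2 * d)"
  using closure_of_subset_topspace[of "zariski_Sym n (2 * d)"] by (simp add: SOS_def zariski_Sym_eq)

lemma sum_squares_in_SOS:
  assumes "F \<in> Sym_tuples k n d"
  shows "(\<Sum>i=1..k. (F i)\<^sup>2) \<in> SOS n d k"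
proof -
  let ?S = "{\<Sum>i=1..k. (F i)\<^sup>2 | F. F \<in> Sym_tuples k n d}"
  have "?S \<subseteq> topspace (zariski_Sym n (2 * d))"
    using sum_squares_Sym by (auto simp: zariski_Sym_eq)
  from closure_of_subset[OF this] show ?thesis using assms unfolding SOS_def by blast
qed

text \<open>Turns membership in the closure into equations: zero loci are closed, so an identity
  valid for all sums of squares holds on \<open>SOS\<close>.\<close>

lemma SOS_vanish:
  assumes q: "q \<in> PF (form_coords n (2 * d))" and f: "f \<in> SOS n d k"
    and van: "\<And>F. F \<in> Sym_tuples k n d \<Longrightarrow> q (\<Sum>i=1..k. (F i)\<^sup>2) = 0"
  shows "q f = 0"
proof -
  let ?S = "{\<Sum>i=1..k. (F i)\<^sup>2 | F. F \<in> Sym_tuples k n d}" and ?Z = "zero_locus (Sym n (2 * d)) {q}"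
  have "?S \<subseteq> ?Z" using van sum_squares_Sym by (auto simp: zero_locus_def)
  moreover have "closedin (zariski_Sym n (2 * d)) ?Z"
    unfolding zariski_Sym_eq closedin_zariski using q by (intro exI[of _ "{q}"]) simp
  ultimately have "SOS n d k \<subseteq> ?Z" unfolding SOS_def by (rule closure_of_minimal)
  then show ?thesis using f by (auto simp: zero_locus_def)
qed

text \<open>Applied to the graph \<open>E\<close> of the sum of squares map: \<open>J\<close> holds
  the coefficients of the sum, \<open>K\<close> those of the tuple. A generic f lifts to the closure
  of the graph, and the polynomial equations of the graph hold there as well, so the lift is a
  genuine decomposition. The determinant \<open>v\<close> passes through the lifting and makes its
  entries independent.\<close>

lemma SOS_generic_decomposition:
  assumes d: "d \<ge> 1" and kn: "k \<le> n"
  shows "\<exists>s\<in>PF (coords (monomials_of_degree n (2 * d))).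
    \<not> (\<forall>F\<in>Sym_tuples k n d. s (square_coeff k n d F) = 0) \<and>
    (\<forall>f\<in>SOS n d k. s (Poly_Mapping.lookup f) \<noteq> 0 \<longrightarrow> (\<exists>F\<in>SOS_decompositions n d k f. \<exists>a.
       \<forall>c\<in>{1..k}. \<forall>m\<in>{1..k}. dual_form n d (a c) (F m) = (if c = m then 1 else 0)))"
proof -
  let ?X = "Sym_tuples k n d" and ?A = "monomials_of_degree n d" and ?M = "monomials_of_degree n (2 * d)"
  let ?I = "{1..k} \<times> ?A"
  define J :: "((nat \<Rightarrow>\<^sub>0 nat) + nat \<times> (nat \<Rightarrow>\<^sub>0 nat)) set" where "J = Inl ` ?M"
  define K :: "((nat \<Rightarrow>\<^sub>0 nat) + nat \<times> (nat \<Rightarrow>\<^sub>0 nat)) set" where "K = Inr ` ?I"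
  define y :: "(nat \<Rightarrow> cpoly) \<Rightarrow> (nat \<Rightarrow>\<^sub>0 nat) + nat \<times> (nat \<Rightarrow>\<^sub>0 nat) \<Rightarrow> complex" where
    "y F j = (case j of Inl \<tau> \<Rightarrow> square_coeff k n d F \<tau>
       | Inr (i, \<alpha>) \<Rightarrow> if (i, \<alpha>) \<in> ?I then Poly_Mapping.lookup (F i) \<alpha> else 0)" for F j
  define E where "E = y ` ?X"
  \<comment> \<open>The monomials x_1^d, ..., x_k^d, shifted because matrix rows count from 0 and
    tuple entries from 1. They are distinct because d \<ge> 1.\<close>
  define e :: "nat \<Rightarrow> nat \<Rightarrow>\<^sub>0 nat" where "e r = Poly_Mapping.single (Suc r) d" for r
  have e: "e r \<in> ?A" if "r < k" for r unfolding e_def using that kn by (intro pure_power_monomial) simp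
  have e_inj: "e r = e c \<longleftrightarrow> r = c" for r c
  proof
    assume "e r = e c"
    then have "Poly_Mapping.lookup (e r) (Suc r) = Poly_Mapping.lookup (e c) (Suc r)" by simp
    then show "r = c" using d by (simp add: e_def lookup_single when_def split: if_splits)
  qed simp
  have yPF: "(\<lambda>F. y F j) \<in> PF (tuple_coords k n d)" for j
  proof (cases j)
    case (Inl \<tau>)
    then show ?thesis using square_coeff_PF by (simp add: y_def)
  next
    case (Inr ia)
    obtain i \<alpha> where ia: "ia = (i, \<alpha>)" by (cases ia)
    have "(\<lambda>F. Poly_Mapping.lookup (F i) \<alpha>) \<in> PF (tuple_coords k n d)" if "(i, \<alpha>) \<in> ?I"
      by (rule polynomial_functions.coord) (use that in \<open>auto simp: tuple_coords_def\<close>)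
    then show ?thesis unfolding Inr ia y_def
      by (cases "(i, \<alpha>) \<in> ?I") (auto intro: polynomial_functions.const)
  qed
  have yPF': "(\<lambda>F. p (y F)) \<in> PF (tuple_coords k n d)" if "p \<in> PF (coords UNIV)" for p
    by (rule PF_compose[OF that]) (use yPF in \<open>auto simp: coords_def\<close>)
  have dom: "domain_on (coords UNIV) E"
    unfolding domain_on_def
  proof (intro ballI impI)
    fix p q assume pq: "p \<in> PF (coords UNIV)" "q \<in> PF (coords UNIV)" "\<forall>x\<in>E. p x * q x = 0"
    show "(\<forall>x\<in>E. p x = 0) \<or> (\<forall>x\<in>E. q x = 0)"
      using domain_onD[OF domain_on_Sym_tuples yPF'[OF pq(1)] yPF'[OF pq(2)]] pq(3) unfolding E_def by blast
  qed
  \<comment> \<open>The minor of the coefficient matrix of the tuple at these monomials; at the pure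
    powers it is the determinant of the identity.\<close>
  define v :: "((nat \<Rightarrow>\<^sub>0 nat) + nat \<times> (nat \<Rightarrow>\<^sub>0 nat) \<Rightarrow> complex) \<Rightarrow> complex" where
    "v w = det (mat k k (\<lambda>(r, c). w (Inr (Suc c, e r))))" for w
  have v: "v \<in> PF (coords (J \<union> K))" unfolding v_def
    by (intro PF_det polynomial_functions.coord) (use e in \<open>auto simp: coords_def K_def\<close>)
  define F0 :: "nat \<Rightarrow> cpoly" where
    "F0 i = (if i \<in> {1..k} then Poly_Mapping.single (Poly_Mapping.single i d) 1 else undefined)" for i
  have F0: "F0 \<in> ?X"
    using kn by (auto simp: F0_def Sym_tuples_iff Sym_def intro!: pure_power_monomial)
  have "v (y F0) = det (1\<^sub>m k)"
    unfolding v_def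
  proof (intro arg_cong[of _ _ det] eq_matI)
    fix r c assume rc: "r < dim_row (1\<^sub>m k :: complex mat)" "c < dim_col (1\<^sub>m k :: complex mat)"
    have "F0 (Suc c) = Poly_Mapping.single (e c) 1" using rc by (simp add: F0_def e_def)
    then show "mat k k (\<lambda>(r, c). y F0 (Inr (Suc c, e r))) $$ (r, c) = 1\<^sub>m k $$ (r, c)"
      using rc e[of r] e_inj[of c r] by (auto simp: y_def lookup_single when_def)
  qed auto
  then have "v (y F0) \<noteq> 0" by simp
  then have vE: "\<not> (\<forall>x\<in>E. v x = 0)" using F0 unfolding E_def by blast
  have finK: "finite K" by (simp add: K_def finite_monomials_of_degree)
  have JK: "J \<inter> K = {}" by (auto simp: J_def K_def)
  obtain s' where s': "s' \<in> PF (coords J)" "\<not> (\<forall>x\<in>E. s' x = 0)"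
    "\<And>w. w \<in> zariski_closure J E \<Longrightarrow> s' w \<noteq> 0 \<Longrightarrow>
      \<exists>w'\<in>zariski_closure (J \<union> K) E. (\<forall>j\<in>J. w' j = w j) \<and> v w' \<noteq> 0"
    using closure_extend_coordinates[OF dom finK JK v vE] by blast
  define lift :: "((nat \<Rightarrow>\<^sub>0 nat) \<Rightarrow> complex) \<Rightarrow> (nat \<Rightarrow>\<^sub>0 nat) + nat \<times> (nat \<Rightarrow>\<^sub>0 nat) \<Rightarrow> complex" where
    "lift g j = (case j of Inl \<tau> \<Rightarrow> g \<tau> | Inr _ \<Rightarrow> 0)" for g j
  have lift_PF: "(\<lambda>g. p (lift g)) \<in> PF (coords ?M)" if "p \<in> PF (coords J)" for p
    by (rule PF_compose[OF that])
      (auto simp: coords_def J_def lift_def intro!: polynomial_functions.coord)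
  have lift_y: "p (lift (square_coeff k n d F)) = p (y F)" if "p \<in> PF (coords J)" for p F
    by (rule PF_coords_cong[OF that]) (auto simp: J_def lift_def y_def)
  show ?thesis
  proof (intro bexI[of _ "\<lambda>g. s' (lift g)"] conjI ballI impI)
    show "(\<lambda>g. s' (lift g)) \<in> PF (coords ?M)" by (rule lift_PF[OF s'(1)])
    show "\<not> (\<forall>F\<in>?X. s' (lift (square_coeff k n d F)) = 0)"
      using s'(2) lift_y[OF s'(1)] unfolding E_def by simp
    fix f assume f: "f \<in> SOS n d k" "s' (lift (Poly_Mapping.lookup f)) \<noteq> 0"
    \<comment> \<open>A function of the \<open>J\<close> coordinates that vanishes on
      \<open>E\<close> vanishes on all sums of squares, hence at f.\<close>
    have "lift (Poly_Mapping.lookup f) \<in> zariski_closure J E"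
      unfolding zariski_closure_def
    proof (intro CollectI ballI impI)
      fix p assume p: "p \<in> PF (coords J)" "\<forall>x\<in>E. p x = 0"
      show "p (lift (Poly_Mapping.lookup f)) = 0"
      proof (rule SOS_vanish[OF PF_form_coords[OF lift_PF[OF p(1)]] f(1)])
        fix F assume "F \<in> ?X"
        then show "p (lift (Poly_Mapping.lookup (\<Sum>i=1..k. (F i)\<^sup>2))) = 0"
          using p(2) by (simp add: lookup_sum_squares lift_y[OF p(1)] E_def del: One_nat_def)
      qed
    qed
    from s'(3)[OF this f(2)] obtain w where w: "w \<in> zariski_closure (J \<union> K) E"
      "\<forall>j\<in>J. w j = lift (Poly_Mapping.lookup f) j" "v w \<noteq> 0" by blast
    define F :: "nat \<Rightarrow> cpoly" where
      "F i = (if i \<in> {1..k} then (\<Sum>\<alpha>\<in>?A. Poly_Mapping.single \<alpha> (w (Inr (i, \<alpha>)))) else undefined)" for i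
    have lookupF: "Poly_Mapping.lookup (F i) \<alpha> = (if \<alpha> \<in> ?A then w (Inr (i, \<alpha>)) else 0)" if i: "i \<in> {1..k}" for i \<alpha>
      unfolding F_def if_P[OF i]
      by (simp add: lookup_sum lookup_single when_def sum.delta' finite_monomials_of_degree)
    have F: "F \<in> ?X"
      unfolding Sym_tuples_iff
    proof (intro conjI ballI allI impI)
      show "F i \<in> Sym n d" if "i \<in> {1..k}" for i using lookupF[OF that] by (simp add: Sym_iff)
      show "F i = undefined" if "i \<notin> {1..k}" for i unfolding F_def using that by (rule if_not_P)
    qed
    have "square_coeff k n d F \<tau> = Poly_Mapping.lookup f \<tau>" for \<tau>
    proof (cases "\<tau> \<in> ?M")
      case True
      \<comment> \<open>The graph equation for the coefficient at \<tau>, which persists on the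
        closure of the graph.\<close>
      define p where "p w = w (Inl \<tau>) - (\<Sum>i\<in>{1..k}. \<Sum>\<alpha>\<in>?A. \<Sum>\<beta>\<in>?A.
        if \<alpha> + \<beta> = \<tau> then w (Inr (i, \<alpha>)) * w (Inr (i, \<beta>)) else 0)"
        for w :: "(nat \<Rightarrow>\<^sub>0 nat) + nat \<times> (nat \<Rightarrow>\<^sub>0 nat) \<Rightarrow> complex"
      have cPF: "(\<lambda>w. w j) \<in> PF (coords (J \<union> K))" if "j \<in> J \<union> K" for j
        by (rule polynomial_functions.coord) (use that in \<open>auto simp: coords_def\<close>)
      have "p \<in> PF (coords (J \<union> K))" unfolding p_def[abs_def]
        by (intro PF_diff PF_sum PF_if polynomial_functions.mult polynomial_functions.const cPF)
          (use True in \<open>auto simp: J_def K_def\<close>)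
      moreover have "p x = 0" if "x \<in> E" for x
      proof -
        obtain G where G: "x = y G" using \<open>x \<in> E\<close> unfolding E_def by blast
        have "(\<Sum>i\<in>{1..k}. \<Sum>\<alpha>\<in>?A. \<Sum>\<beta>\<in>?A. if \<alpha> + \<beta> = \<tau> then y G (Inr (i, \<alpha>)) * y G (Inr (i, \<beta>)) else 0)
            = square_coeff k n d G \<tau>"
          unfolding square_coeff_def by (intro sum.cong refl if_cong) (auto simp: y_def)
        then show ?thesis unfolding p_def G by (simp add: y_def)
      qed
      ultimately have "p w = 0" using w(1) unfolding zariski_closure_def by blast
      then have "w (Inl \<tau>) = (\<Sum>i\<in>{1..k}. \<Sum>\<alpha>\<in>?A. \<Sum>\<beta>\<in>?A.
        if \<alpha> + \<beta> = \<tau> then w (Inr (i, \<alpha>)) * w (Inr (i, \<beta>)) else 0)" by (simp add: p_def)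
      also have "\<dots> = square_coeff k n d F \<tau>"
        unfolding square_coeff_def by (intro sum.cong refl if_cong) (simp_all add: lookupF del: atLeastAtMost_iff)
      finally show ?thesis using w(2) True by (simp add: J_def lift_def)
    next
      case False
      have "(\<Sum>i=1..k. (F i)\<^sup>2) \<in> Sym n (2 * d)" "f \<in> Sym n (2 * d)"
        using sum_squares_Sym[OF F] f(1) SOS_subset by auto
      then show ?thesis using False lookup_sum_squares[OF F] by (auto simp: Sym_iff)
    qed
    then have Fdec: "F \<in> SOS_decompositions n d k f"
      unfolding SOS_decompositions_eq using F by auto
    obtain b where b: "\<forall>r<k. \<forall>c<k. (\<Sum>l<k. b r l * w (Inr (Suc c, e l))) = (if r = c then 1 else 0)"
      using det_nonzero_left_inverse[of k "\<lambda>r c. w (Inr (Suc c, e r))"] w(3) unfolding v_def by blast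
    \<comment> \<open>Row c - 1 of the inverse matrix, read as a functional supported on the
      monomials \<open>e l\<close>.\<close>
    define a where "a c \<alpha> = (\<Sum>l<k. if \<alpha> = e l then b (c - 1) l else 0)" for c \<alpha>
    have "dual_form n d (a c) (F m) = (if c = m then 1 else 0)" if c: "c \<in> {1..k}" and m: "m \<in> {1..k}" for c m
    proof -
      have "dual_form n d (a c) (F m) = (\<Sum>\<alpha>\<in>?A. \<Sum>l<k. if \<alpha> = e l then b (c - 1) l * Poly_Mapping.lookup (F m) \<alpha> else 0)"
        unfolding dual_form_def a_def sum_distrib_right by (intro sum.cong) auto
      also have "\<dots> = (\<Sum>l<k. \<Sum>\<alpha>\<in>?A. if \<alpha> = e l then b (c - 1) l * Poly_Mapping.lookup (F m) \<alpha> else 0)"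
        by (rule sum.swap)
      also have "\<dots> = (\<Sum>l<k. b (c - 1) l * w (Inr (Suc (m - 1), e l)))"
      proof (rule sum.cong)
        fix l assume "l \<in> {..<k}"
        then show "(\<Sum>\<alpha>\<in>?A. if \<alpha> = e l then b (c - 1) l * Poly_Mapping.lookup (F m) \<alpha> else 0) =
            b (c - 1) l * w (Inr (Suc (m - 1), e l))"
          using m e[of l] by (simp add: sum.delta finite_monomials_of_degree lookupF[OF m])
      qed simp
      also have "\<dots> = (if c - 1 = m - 1 then 1 else 0)"
      proof -
        have "c - 1 < k" "m - 1 < k" using c m by auto
        with b show ?thesis by blast
      qed
      also have "\<dots> = (if c = m then 1 else 0)" using c m by auto
      finally show ?thesis .
    qed
    then show "\<exists>F\<in>SOS_decompositions n d k f. \<exists>a. \<forall>c\<in>{1..k}. \<forall>m\<in>{1..k}.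
        dual_form n d (a c) (F m) = (if c = m then 1 else 0)"
      using Fdec by (intro bexI[of _ F] exI[of _ a]) auto
  qed
qed

text \<open>The fibre over a coefficient vector is the set of decompositions. The exponent
  \<open>t\<close> is the number of tuple coordinates minus the number of independent
  coefficients.\<close>

lemma SOS_generic_growth:
  assumes "k \<le> n"
  shows "\<exists>s\<in>PF (coords (monomials_of_degree n (2 * d))).
    \<not> (\<forall>F\<in>Sym_tuples k n d. s (square_coeff k n d F) = 0) \<and>
    (\<forall>f. s (Poly_Mapping.lookup f) \<noteq> 0 \<longrightarrow>
      (\<exists>t\<le>k choose 2. growth_le (tuple_coords k n d) (SOS_decompositions n d k f) t))"
proof -
  let ?I = "{1..k} \<times> monomials_of_degree n d" and ?T = "tangent_index k n d"
  define g :: "nat \<times> (nat \<Rightarrow>\<^sub>0 nat) \<Rightarrow> (nat \<Rightarrow> cpoly) \<Rightarrow> complex" where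
    "g = (\<lambda>(i, \<alpha>) F. Poly_Mapping.lookup (F i) \<alpha>)"
  define \<psi> :: "nat \<times> (nat \<Rightarrow>\<^sub>0 nat) \<Rightarrow> ((nat \<Rightarrow>\<^sub>0 nat) \<Rightarrow> complex) \<Rightarrow> complex" where
    "\<psi> = (\<lambda>(i, m) h. h (Poly_Mapping.single i d + m))"
  have gI: "g ` ?I = tuple_coords k n d" by (force simp: g_def tuple_coords_def)
  have fin: "finite ?I" "finite ?T" by (simp_all add: tangent_index_def finite_monomials_of_degree)
  have "\<exists>s\<in>PF (coords (monomials_of_degree n (2 * d))). (\<lambda>F. s (square_coeff k n d F)) \<in> PF (g ` ?I) \<and>
    \<not> (\<forall>F\<in>Sym_tuples k n d. s (square_coeff k n d F) = 0) \<and>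
    (\<forall>h. s h \<noteq> 0 \<longrightarrow> growth_le (g ` ?I) {F \<in> Sym_tuples k n d. square_coeff k n d F = h} (card ?I - card ?T))"
  proof (rule generic_fibre_growth[OF fin fin(1), where \<psi> = \<psi>])
    show "\<psi> t \<in> PF (coords (monomials_of_degree n (2 * d)))" if "t \<in> ?T" for t
    proof -
      obtain i m where t: "t = (i, m)" "i \<in> {1..k}" "m \<in> monomials_of_degree n d"
        using \<open>t \<in> ?T\<close> by (auto simp: tangent_index_def)
      have "Poly_Mapping.single i d + m \<in> monomials_of_degree n (2 * d)"
        using monomials_of_degree_add[OF pure_power_monomial t(3), of i d] t(2) assms by (simp add: mult_2)
      then show ?thesis unfolding t \<psi>_def by (auto simp: coords_def intro!: polynomial_functions.coord)
    qed
    show "(\<lambda>F. \<psi> t (square_coeff k n d F)) \<in> PF (g ` ?I)" for t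
      unfolding gI \<psi>_def by (cases t) (simp add: square_coeff_PF)
    show "alg_indep ?T (\<lambda>t F. \<psi> t (square_coeff k n d F)) (Sym_tuples k n d)"
      using alg_indep_square_coeffs[OF assms, of d] by (simp add: \<psi>_def case_prod_unfold)
    show "domain_on (g ` ?I) (Sym_tuples k n d)" unfolding gI by (rule domain_on_Sym_tuples)
    show "g t \<in> PF (g ` ?I)" if "t \<in> ?I" for t
      using that by (intro polynomial_functions.coord) auto
  qed
  then obtain s where s: "s \<in> PF (coords (monomials_of_degree n (2 * d)))"
    "\<not> (\<forall>F\<in>Sym_tuples k n d. s (square_coeff k n d F) = 0)"
    "\<forall>h. s h \<noteq> 0 \<longrightarrow> growth_le (g ` ?I) {F \<in> Sym_tuples k n d. square_coeff k n d F = h} (card ?I - card ?T)"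
    by blast
  show ?thesis
  proof (intro bexI[of _ s] conjI allI impI s(1,2))
    fix f assume "s (Poly_Mapping.lookup f) \<noteq> 0"
    with s(3) have "growth_le (tuple_coords k n d) (SOS_decompositions n d k f) (card ?I - card ?T)"
      unfolding gI SOS_decompositions_eq by blast
    then show "\<exists>t\<le>k choose 2. growth_le (tuple_coords k n d) (SOS_decompositions n d k f) t"
      using card_tangent_index[of k n d] by blast
  qed
qed

section \<open>The dimension of a generic fibre\<close>

theorem theorem1p5:
  fixes n d k :: nat
  assumes "d \<ge> 1" and "1 \<le> k" and "k \<le> n"
  shows "for_generic (subtopology (zariski_Sym n (2 * d)) (SOS n d k))
           (\<lambda>f. krull_dim (subtopology (zariski_Sym_tuples k n d) (SOS_decompositions n d k f))
                = ereal (real (k choose 2)))"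
proof -
  let ?X = "Sym_tuples k n d" and ?C = "form_coords n (2 * d)" and ?D = "tuple_coords k n d"
  have SOS_top: "subtopology (zariski_Sym n (2 * d)) (SOS n d k) = zariski ?C (SOS n d k)"
    unfolding zariski_Sym_eq by (rule subtopology_zariski[OF SOS_subset])
  obtain s1 where s1: "s1 \<in> PF (coords (monomials_of_degree n (2 * d)))"
    "\<not> (\<forall>F\<in>?X. s1 (square_coeff k n d F) = 0)"
    "\<forall>f. s1 (Poly_Mapping.lookup f) \<noteq> 0 \<longrightarrow>
      (\<exists>t\<le>k choose 2. growth_le ?D (SOS_decompositions n d k f) t)"
    using SOS_generic_growth[OF assms(3), of d] by blast
  obtain s2 where s2: "s2 \<in> PF (coords (monomials_of_degree n (2 * d)))"
    "\<not> (\<forall>F\<in>?X. s2 (square_coeff k n d F) = 0)"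
    "\<forall>f\<in>SOS n d k. s2 (Poly_Mapping.lookup f) \<noteq> 0 \<longrightarrow> (\<exists>F\<in>SOS_decompositions n d k f. \<exists>a.
       \<forall>c\<in>{1..k}. \<forall>m\<in>{1..k}. dual_form n d (a c) (F m) = (if c = m then 1 else 0))"
    using SOS_generic_decomposition[OF assms(1,3)] by blast
  have PFX: "(\<lambda>F. p (square_coeff k n d F)) \<in> PF ?D" if "p \<in> PF (coords (monomials_of_degree n (2 * d)))" for p
    by (rule PF_compose[OF that]) (auto simp: coords_def square_coeff_PF)
  have nonzero_mult: "\<not> (\<forall>F\<in>?X. p (square_coeff k n d F) * q (square_coeff k n d F) = 0)"
    if p: "p \<in> PF (coords (monomials_of_degree n (2 * d)))" "\<not> (\<forall>F\<in>?X. p (square_coeff k n d F) = 0)"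
      and q: "q \<in> PF (coords (monomials_of_degree n (2 * d)))" "\<not> (\<forall>F\<in>?X. q (square_coeff k n d F) = 0)" for p q
    using domain_onD[OF domain_on_Sym_tuples PFX[OF p(1)] PFX[OF q(1)] _ p(2)] q(2) by blast
  define s where "s h = s1 h * s2 h" for h
  have s: "s \<in> PF (coords (monomials_of_degree n (2 * d)))" "\<not> (\<forall>F\<in>?X. s (square_coeff k n d F) = 0)"
    using polynomial_functions.mult[OF s1(1) s2(1)] nonzero_mult[OF s1(1,2) s2(1,2)]
    by (simp_all add: s_def[abs_def])
  define U where "U = SOS n d k - zero_locus (SOS n d k) {\<lambda>f. s (Poly_Mapping.lookup f)}"
  have U: "f \<in> U \<longleftrightarrow> f \<in> SOS n d k \<and> s (Poly_Mapping.lookup f) \<noteq> 0" for f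
    by (auto simp: U_def zero_locus_def)
  have "openin (zariski ?C (SOS n d k)) U"
    unfolding openin_zariski U_def using PF_form_coords[OF s(1)]
    by (intro exI[of _ "{\<lambda>f. s (Poly_Mapping.lookup f)}"]) simp
  \<comment> \<open>Density is checked on tuples, whose functions form a domain: the function
    defining \<open>U\<close> and one that is nonzero at a given f both pull back to nonzero
    functions, so some sum of squares lies in \<open>U\<close> and in the given
    neighbourhood.\<close>
  moreover have "zariski ?C (SOS n d k) closure_of U = topspace (zariski ?C (SOS n d k))"
  proof (intro equalityI closure_of_subset_topspace subsetI)
    fix f assume f: "f \<in> topspace (zariski ?C (SOS n d k))"
    show "f \<in> zariski ?C (SOS n d k) closure_of U"
      unfolding in_closure_of
    proof (intro conjI f allI impI)
      fix V assume V: "f \<in> V \<and> openin (zariski ?C (SOS n d k)) V"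
      then obtain S where S: "S \<subseteq> PF ?C" "V = SOS n d k - zero_locus (SOS n d k) S"
        unfolding openin_zariski by blast
      then obtain q where q: "q \<in> S" "q f \<noteq> 0" using V by (auto simp: zero_locus_def)
      obtain q' where q': "q' \<in> PF (coords (monomials_of_degree n (2 * d)))" "\<And>f. q f = q' (Poly_Mapping.lookup f)"
        using PF_form_coordsE[of q n "2 * d"] q(1) S(1) by blast
      have "\<not> (\<forall>F\<in>?X. q' (square_coeff k n d F) = 0)"
      proof
        assume "\<forall>F\<in>?X. q' (square_coeff k n d F) = 0"
        then have "q f = 0"
          using q(1) S(1) f by (intro SOS_vanish[of q n d f k]) (auto simp: q'(2) lookup_sum_squares simp del: One_nat_def)
        with q(2) show False by simp
      qed
      from nonzero_mult[OF q'(1) this s] obtain F where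
        F: "F \<in> ?X" "q' (square_coeff k n d F) \<noteq> 0" "s (square_coeff k n d F) \<noteq> 0" by auto
      let ?h = "\<Sum>i=1..k. (F i)\<^sup>2"
      have "?h \<in> U" using F sum_squares_in_SOS[OF F(1)] by (simp add: U lookup_sum_squares del: One_nat_def)
      moreover have "q ?h \<noteq> 0" using F q'(2) by (simp add: lookup_sum_squares del: One_nat_def)
      then have "?h \<in> V" using sum_squares_in_SOS[OF F(1)] q(1) unfolding S(2) zero_locus_def by blast
      ultimately show "\<exists>h. h \<in> U \<and> h \<in> V" by blast
    qed
  qed
  moreover have "krull_dim (subtopology (zariski_Sym_tuples k n d) (SOS_decompositions n d k f)) = ereal (real (k choose 2))"
    if "f \<in> U" for f
  proof -
    have f: "f \<in> SOS n d k" "s1 (Poly_Mapping.lookup f) \<noteq> 0" "s2 (Poly_Mapping.lookup f) \<noteq> 0"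
      using that by (auto simp: U s_def)
    have top: "subtopology (zariski_Sym_tuples k n d) (SOS_decompositions n d k f) = zariski ?D (SOS_decompositions n d k f)"
      unfolding zariski_Sym_tuples_def tuple_coords_def[symmetric]
      by (rule subtopology_zariski) (auto simp: SOS_decompositions_def)
    obtain t where t: "t \<le> k choose 2" "growth_le ?D (SOS_decompositions n d k f) t" using s1(3) f(2) by blast
    have "krull_dim (zariski ?D (SOS_decompositions n d k f)) \<le> ereal (real t)"
      using t(2) by (rule krull_dim_le_growth)
    also have "\<dots> \<le> ereal (real (k choose 2))" using t(1) by simp
    finally have upper: "krull_dim (zariski ?D (SOS_decompositions n d k f)) \<le> ereal (real (k choose 2))" .
    obtain F a where F: "F \<in> SOS_decompositions n d k f"
      "\<forall>c\<in>{1..k}. \<forall>m\<in>{1..k}. dual_form n d (a c) (F m) = (if c = m then 1 else 0)"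
      using s2(3) f(1,3) by blast
    obtain S where "rotation_chain n d k a F (k choose 2) S"
      using rotation_chain_exists[OF assms(2), of n d a F] F(2) by blast
    from krull_dim_ge_rotation_chain[OF this F(1)] upper show ?thesis unfolding top by (rule antisym[rotated])
  qed
  ultimately show ?thesis unfolding for_generic_def SOS_top by blast
qed



end
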